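(* Let $n>r>0$ be integers. Let $G_h$ be the subgroup of $G$ that preserves the Grassmannian $\mathrm{Gr}(n,r)\subset\mathbb P^{\binom nr-1}$, i.e. the largest subgroup of $G$ such that all Plücker relations are homogeneous with respect to its action. Then there is an isomorphism $G_h\cong H_{n,r}$.
   Context: Work over $\mathbb{C}$; $k:=n-r$. Ladder quiver: consider the grid with $r$ rows and $k$ columns of unit boxes, with corners $(0,0)$ and $(k,r)$. The vertex set $\mathrm{LQ}_0$ consists of $(0,0)$ (the source vertex $0$), $(k,r)$ and all interior grid points. The arrows $\mathrm{LQ}_1$ are the lattice paths (unit steps up or right, along grid lines) from one vertex to another that pass through no other vertex. $\overline{\mathrm{LQ}}_0=\mathrm{LQ}_0\setminus\{0\}$. $\mathcal P(n,r)$ is the set of partitions fitting in an $r\times k$ box; $\lambda$ is identified with the lattice path from $(0,0)$ to $(k,r)$ such that $\lambda$ is the region of the grid above the path; $a\in\lambda$ means the arrow $a$ is in the path. Plücker coordinates $p_\lambda$ on $\mathbb P^{\binom nr-1}$ are indexed by $\mathcal P(n,r)$: $p_\lambda=p_{I_\lambda}$, $I_\lambda\subset\{1,\dots,n\}$ the set of positions of the vertical steps of the path. Groups: $T=(\mathbb C^* )^{\overline{\mathrm{LQ}}_0}$ acts on $\mathbb C^{|\mathrm{LQ}_1|}$ by scaling $y_a$ by $t_{t(a)}/t_{s(a)}$ ($t_0=1$), and is viewed as a subgroup of diagonal matrices. $\tilde G=\{(\psi_a)_{a\in\mathrm{LQ}_1}:\psi_a^n=1,\prod_a\psi_a=1\}$,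 $G=\tilde G/(T\cap\tilde G)$. $\tilde G$ acts on $\mathbb P^{\binom nr-1}$ by multiplying $p_\lambda$ by $\prod_{a\in\lambda}\psi_a$; $T\cap\tilde G$ acts by scaling, so this descends to an action of $G$. $\tilde H_{n,r}=\{(\zeta_1,\dots,\zeta_n):\zeta_i^n=1,(\prod_i\zeta_i)^r=1\}$ and $H_{n,r}$ is the quotient of $\tilde H_{n,r}$ by the subgroup of its elements of the form $(\zeta,\dots,\zeta)$. *)

theory Defs
  imports
    "HOL-Library.FuncSet"
    "HOL-Library.Sublist"
    "HOL-Algebra.Coset"
    "Jordan_Normal_Form.DL_Rank"
    "Jordan_Normal_Form.DL_Submatrix"
begin

text \<open>Throughout, \<open>k = n - r\<close>. Families indexed by a set are extensional functions
  (\<open>undefined\<close> outside the index set), so that equality of families is equality of functions.\<close>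

section \<open>The ladder quiver\<close>

type_synonym point = "nat \<times> nat"

definition LQ0 :: "nat \<Rightarrow> nat \<Rightarrow> point set" where
  "LQ0 n r = {(0, 0), (n - r, r)} \<union> {0<..<n - r} \<times> {0<..<r}"

definition LQ0_bar :: "nat \<Rightarrow> nat \<Rightarrow> point set" where
  "LQ0_bar n r = LQ0 n r - {(0, 0)}"

definition unit_step :: "point \<Rightarrow> point \<Rightarrow> bool" where
  "unit_step p q \<longleftrightarrow> q = (Suc (fst p), snd p) \<or> q = (fst p, Suc (snd p))"

text \<open>A lattice path is the list of the grid points it visits. The source and the target of an
  arrow \<open>a\<close> are \<open>hd a\<close> and \<open>last a\<close>.\<close>

definition LQ1 :: "nat \<Rightarrow> nat \<Rightarrow> point list set" where
  "LQ1 n r = {a. 2 \<le> length a \<and> set a \<subseteq> {..n - r} \<times> {..r} \<and> successively unit_step a \<and>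
     hd a \<in> LQ0 n r \<and> last a \<in> LQ0 n r \<and> set (butlast (tl a)) \<inter> LQ0 n r = {}}"

section \<open>Partitions and their lattice paths\<close>

text \<open>Partitions are padded with zeros to length exactly \<open>r\<close>.\<close>

definition partitions_in_box :: "nat \<Rightarrow> nat \<Rightarrow> nat list set" where
  "partitions_in_box n r = {lam. length lam = r \<and> sorted_wrt (\<ge>) lam \<and> set lam \<subseteq> {..n - r}}"

text \<open>The partition is drawn in the upper left corner of the grid, its first (longest) part in the
  top row, and it is the region above the path. So the path climbs the rows from bottom to top, the
  vertical step in a row being at the abscissa given by the corresponding part.\<close>

fun path_from :: "nat \<Rightarrow> point \<Rightarrow> nat list \<Rightarrow> point list" where
  "path_from k (x, y) [] = map (\<lambda>i. (i, y)) [x..<Suc k]"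
| "path_from k (x, y) (m # ms) = map (\<lambda>i. (i, y)) [x..<Suc m] @ path_from k (m, Suc y) ms"

definition partition_path :: "nat \<Rightarrow> nat \<Rightarrow> nat list \<Rightarrow> point list" where
  "partition_path n r lam = path_from (n - r) (0, 0) (rev lam)"

definition vertical_steps :: "nat \<Rightarrow> nat \<Rightarrow> nat list \<Rightarrow> nat set" where
  "vertical_steps n r lam = {i \<in> {1..n}.
     snd (partition_path n r lam ! i) = Suc (snd (partition_path n r lam ! (i - 1)))}"

text \<open>\<open>a \<in> lam\<close>: \<open>sublist\<close> means contiguous sublist.\<close>

definition arrows_of :: "nat \<Rightarrow> nat \<Rightarrow> nat list \<Rightarrow> point list set" where
  "arrows_of n r lam = {a \<in> LQ1 n r. sublist a (partition_path n r lam)}"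

section \<open>Projective space and the Grassmannian\<close>

definition nonzero_vecs :: "nat \<Rightarrow> nat \<Rightarrow> (nat list \<Rightarrow> complex) set" where
  "nonzero_vecs n r =
     {p \<in> partitions_in_box n r \<rightarrow>\<^sub>E UNIV. \<exists>lam\<in>partitions_in_box n r. p lam \<noteq> 0}"

text \<open>Points of the projective space are the classes of \<open>proj_rel\<close>.\<close>

definition proj_rel :: "nat \<Rightarrow> nat \<Rightarrow> ((nat list \<Rightarrow> complex) \<times> (nat list \<Rightarrow> complex)) set" where
  "proj_rel n r = {(p, q). p \<in> nonzero_vecs n r \<and> q \<in> nonzero_vecs n r \<and>
     (\<exists>c. c \<noteq> 0 \<and> q = (\<lambda>lam\<in>partitions_in_box n r. c * p lam))}"

text \<open>Matrix columns are indexed from \<open>0\<close>, positions of steps from \<open>1\<close>.\<close>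

definition plucker_vec :: "nat \<Rightarrow> nat \<Rightarrow> complex mat \<Rightarrow> nat list \<Rightarrow> complex" where
  "plucker_vec n r M =
     (\<lambda>lam\<in>partitions_in_box n r. det (submatrix M UNIV {j. Suc j \<in> vertical_steps n r lam}))"

definition Grassmannian :: "nat \<Rightarrow> nat \<Rightarrow> (nat list \<Rightarrow> complex) set set" where
  "Grassmannian n r =
     {proj_rel n r `` {plucker_vec n r M} | M. M \<in> carrier_mat r n \<and> vec_space.rank r M = r}"

text \<open>\<open>p_I\<close> for an \<open>r\<close>-subset \<open>I\<close> of \<open>{1..n}\<close>.\<close>

definition plucker_coord :: "nat \<Rightarrow> nat \<Rightarrow> (nat list \<Rightarrow> complex) \<Rightarrow> nat set \<Rightarrow> complex" where
  "plucker_coord n r p I = p (the_inv_into (partitions_in_box n r) (vertical_steps n r) I)"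

text \<open>The quadratic form \<open>\<Sum>\<^sub>l (-1)\<^sup>l p(i\<^sub>1,...,i\<^sub>r\<^sub>-\<^sub>1,j\<^sub>l) p(j\<^sub>0,...,j\<^sub>l\<^sub>-\<^sub>1,j\<^sub>l\<^sub>+\<^sub>1,...,j\<^sub>r)\<close>
  of an \<open>(r-1)\<close>-subset \<open>I\<close> and an \<open>(r+1)\<close>-subset \<open>J\<close>, written with sorted indices: the first
  exponent below moves \<open>j\<close> from the last to its sorted place in \<open>I \<union> {j}\<close>, the second one is \<open>l\<close>.
  The terms with \<open>j \<in> I\<close> vanish by antisymmetry.\<close>

definition plucker_relation ::
    "nat \<Rightarrow> nat \<Rightarrow> nat set \<Rightarrow> nat set \<Rightarrow> (nat list \<Rightarrow> complex) \<Rightarrow> complex" where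
  "plucker_relation n r I J p =
     (\<Sum>j\<in>J - I. (-1) ^ card {i \<in> I. j < i} * (-1) ^ card {i \<in> J. i < j} *
        plucker_coord n r p (insert j I) * plucker_coord n r p (J - {j}))"

section \<open>The groups\<close>

definition G_tilde :: "nat \<Rightarrow> nat \<Rightarrow> (point list \<Rightarrow> complex) monoid" where
  "G_tilde n r =
     \<lparr>carrier = {\<psi> \<in> LQ1 n r \<rightarrow>\<^sub>E UNIV. (\<forall>a\<in>LQ1 n r. \<psi> a ^ n = 1) \<and> (\<Prod>a\<in>LQ1 n r. \<psi> a) = 1},
      monoid.mult = (\<lambda>\<psi> \<phi>. \<lambda>a\<in>LQ1 n r. \<psi> a * \<phi> a),
      monoid.one = (\<lambda>a\<in>LQ1 n r. 1)\<rparr>"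

text \<open>The torus \<open>T\<close>, as the set of diagonals of the diagonal matrices by which it acts.\<close>

definition torus_diag :: "nat \<Rightarrow> nat \<Rightarrow> (point list \<Rightarrow> complex) set" where
  "torus_diag n r =
     (\<lambda>t. \<lambda>a\<in>LQ1 n r. (t((0, 0) := 1)) (last a) / (t((0, 0) := 1)) (hd a))
       ` (LQ0_bar n r \<rightarrow>\<^sub>E (UNIV - {0}))"

definition G_ladder :: "nat \<Rightarrow> nat \<Rightarrow> (point list \<Rightarrow> complex) set monoid" where
  "G_ladder n r = G_tilde n r Mod (torus_diag n r \<inter> carrier (G_tilde n r))"

definition G_tilde_act ::
    "nat \<Rightarrow> nat \<Rightarrow> (point list \<Rightarrow> complex) \<Rightarrow> (nat list \<Rightarrow> complex) \<Rightarrow> nat list \<Rightarrow> complex" where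
  "G_tilde_act n r \<psi> p = (\<lambda>lam\<in>partitions_in_box n r. (\<Prod>a\<in>arrows_of n r lam. \<psi> a) * p lam)"

text \<open>A coset \<open>C\<close> sends a point \<open>X\<close> of projective space to the point \<open>G_tilde_act n r \<psi> ` X\<close>,
  which is the same for all \<open>\<psi> \<in> C\<close>; the union avoids choosing a representative.\<close>

definition G_act ::
    "nat \<Rightarrow> nat \<Rightarrow> (point list \<Rightarrow> complex) set \<Rightarrow> (nat list \<Rightarrow> complex) set \<Rightarrow>
     (nat list \<Rightarrow> complex) set" where
  "G_act n r C X = (\<Union>\<psi>\<in>C. G_tilde_act n r \<psi> ` X)"

definition G_h :: "nat \<Rightarrow> nat \<Rightarrow> (point list \<Rightarrow> complex) set set" where
  "G_h n r = {C \<in> carrier (G_ladder n r). G_act n r C ` Grassmannian n r = Grassmannian n r}"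

text \<open>All Pluecker relations are homogeneous, i.e. semi-invariant, under the elements of \<open>K\<close>.
  Representatives of one coset act by proportional diagonal matrices, so the condition does not
  depend on the representative.\<close>

definition plucker_homogeneous :: "nat \<Rightarrow> nat \<Rightarrow> (point list \<Rightarrow> complex) set set \<Rightarrow> bool" where
  "plucker_homogeneous n r K \<longleftrightarrow>
     (\<forall>C\<in>K. \<forall>\<psi>\<in>C. \<forall>I J. I \<subseteq> {1..n} \<and> card I = r - 1 \<and> J \<subseteq> {1..n} \<and> card J = r + 1 \<longrightarrow>
        (\<exists>c. \<forall>p \<in> partitions_in_box n r \<rightarrow>\<^sub>E UNIV.
           plucker_relation n r I J (G_tilde_act n r \<psi> p) = c * plucker_relation n r I J p))"

definition H_tilde :: "nat \<Rightarrow> nat \<Rightarrow> (nat \<Rightarrow> complex) monoid" where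
  "H_tilde n r =
     \<lparr>carrier = {\<zeta> \<in> {1..n} \<rightarrow>\<^sub>E UNIV. (\<forall>i\<in>{1..n}. \<zeta> i ^ n = 1) \<and> (\<Prod>i\<in>{1..n}. \<zeta> i) ^ r = 1},
      monoid.mult = (\<lambda>\<zeta> \<xi>. \<lambda>i\<in>{1..n}. \<zeta> i * \<xi> i),
      monoid.one = (\<lambda>i\<in>{1..n}. 1)\<rparr>"

definition H_group :: "nat \<Rightarrow> nat \<Rightarrow> (nat \<Rightarrow> complex) set monoid" where
  "H_group n r =
     H_tilde n r Mod {\<zeta> \<in> carrier (H_tilde n r). \<exists>z. \<forall>i\<in>{1..n}. \<zeta> i = z}"

end

theory Submission
  imports Defs "Jordan_Normal_Form.DL_Rank_Submatrix"
begin

text \<open>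
  An element of \<open>G_tilde\<close> acts on the Pluecker coordinates by a diagonal matrix. The entry at the
  coordinate \<open>p\<^sub>I\<close> is the product of \<open>\<psi>\<^sub>a\<close> over the arrows \<open>a\<close> of the lattice path with vertical steps
  \<open>I\<close>; below it is \<open>coord_weight n r \<psi> I\<close>. The proof compares three properties of a family \<open>\<psi>\<close> that can
  be read off from this diagonal matrix.

  The matrix is scalar exactly when \<open>\<psi>\<close> lies in the torus (\<open>scalars_iff\<close>): if all complete paths have the
  same product, then so have any two paths from the source to a vertex \<open>v\<close>, and this common product is
  the coordinate \<open>t\<^sub>v\<close>. So \<open>G\<close> is a group of diagonal matrices modulo scalars.

  Let \<open>d\<close> be a diagonal matrix with nonzero entries. If it maps the Grassmannian to itself, or if the
  Pluecker relations are homogeneous under it, then the three-term relations force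
  \<open>d(S,a,i) d(S,b,j) = d(S,a,j) d(S,b,i)\<close> (\<open>exchange_if_preserves_Grassmannian\<close>,
  \<open>exchange_if_homogeneous\<close>). Hence the ratio of \<open>d\<close> at \<open>T \<union> {i}\<close> and \<open>T \<union> {j}\<close> depends only on \<open>i\<close> and
  \<open>j\<close>, and \<open>d\<^sub>I = c \<Prod>\<^sub>i\<^sub>\<in>\<^sub>I \<zeta>\<^sub>i\<close> for suitable \<open>c\<close> and \<open>\<zeta>\<close> (\<open>exchange_imp_monomial\<close>). Conversely such a
  matrix scales the columns of the matrices that represent points of the Grassmannian, and it multiplies
  every Pluecker relation by a constant. So \<open>G_h\<close> consists of the cosets of the \<open>\<psi>\<close> whose diagonal matrix
  has this form (\<open>coset_in_G_h_iff\<close>), and it contains every subgroup under which the relations are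
  homogeneous.

  A family \<open>\<zeta>\<close> of \<open>n\<close>-th roots of unity gives a family on the arrows, namely the product of \<open>\<zeta>\<^sub>i\<close> over the
  vertical steps \<open>i\<close> of an arrow (\<open>step_family\<close>), whose diagonal matrix has the entries
  \<open>\<Prod>\<^sub>i\<^sub>\<in>\<^sub>I \<zeta>\<^sub>i\<close>. It remains to see when the product over all arrows is \<open>1\<close>. The paths of the \<open>n\<close> cyclic
  intervals of length \<open>r\<close> in \<open>{1..n}\<close> partition the set of arrows (\<open>prod_LQ1\<close>), and every \<open>i\<close> lies in
  exactly \<open>r\<close> cyclic intervals. Therefore the product over all arrows is \<open>(\<Prod>\<zeta>\<^sub>i)\<^sup>r\<close>, which is the condition
  that defines \<open>H_tilde\<close>. The resulting homomorphism from \<open>H_tilde\<close> to \<open>G\<close> has image \<open>G_h\<close>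
  (\<open>G_h_eq_image\<close>), and its kernel consists of the constant families (\<open>kernel_ladder_hom\<close>).
\<close>

section \<open>Lattice paths, partitions and subsets\<close>

text \<open>A unit step raises the level by one. So a path from the origin has its point of level \<open>i\<close> at
  position \<open>i\<close>, and a path meets every level at most once.\<close>

definition level :: "point \<Rightarrow> nat" where
  "level p = fst p + snd p"

lemma unit_step_level: "unit_step p q \<Longrightarrow> level q = Suc (level p)"
  by (auto simp: unit_step_def level_def)

lemma level_nth:
  assumes "successively unit_step P" "i < length P"
  shows "level (P ! i) = level (hd P) + i"
  using assms(2)
proof (induction i)
  case 0
  then show ?case by (simp add: hd_conv_nth)
next
  case (Suc i)
  then show ?case
    using successively_nth[OF assms(1), of i] unit_step_level by fastforce
qed

text \<open>A step is numbered by the position of its end point, as in \<open>vertical_steps\<close>.\<close>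

definition vsteps :: "point list \<Rightarrow> nat set" where
  "vsteps P = {i \<in> {1..<length P}. snd (P ! i) = Suc (snd (P ! (i - 1)))}"

text \<open>The ordinate after \<open>m\<close> steps of a path from the origin whose vertical steps are \<open>I\<close>.\<close>

definition height :: "nat set \<Rightarrow> nat \<Rightarrow> nat" where
  "height I m = card (I \<inter> {1..m})"

lemma height_le: "height I m \<le> m"
  unfolding height_def using card_mono[of "{1..m}" "I \<inter> {1..m}"] by simp

lemma height_0 [simp]: "height I 0 = 0"
  by (simp add: height_def)

lemma height_Suc: "height I (Suc m) = (if Suc m \<in> I then Suc (height I m) else height I m)"
proof -
  have "I \<inter> {1..Suc m} = (if Suc m \<in> I then insert (Suc m) (I \<inter> {1..m}) else I \<inter> {1..m})"
    by (auto simp: le_Suc_eq)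
  then show ?thesis by (simp add: height_def)
qed

definition path_of_set :: "nat \<Rightarrow> nat set \<Rightarrow> point list" where
  "path_of_set n I = map (\<lambda>m. (m - height I m, height I m)) [0..<Suc n]"

lemma length_path_of_set [simp]: "length (path_of_set n I) = Suc n"
  by (simp add: path_of_set_def)

lemma path_of_set_nth: "m \<le> n \<Longrightarrow> path_of_set n I ! m = (m - height I m, height I m)"
  by (simp add: path_of_set_def del: upt_Suc)

lemma mem_path_of_set: "(x, y) \<in> set (path_of_set n I) \<longleftrightarrow> x + y \<le> n \<and> height I (x + y) = y"
proof
  assume "(x, y) \<in> set (path_of_set n I)"
  then obtain m where "m \<le> n" "x = m - height I m" "y = height I m"
    by (force simp: path_of_set_def less_Suc_eq_le simp del: upt_Suc)
  then show "x + y \<le> n \<and> height I (x + y) = y" using height_le[of I m] by simp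
next
  assume "x + y \<le> n \<and> height I (x + y) = y"
  then have "(x, y) = path_of_set n I ! (x + y)" "x + y < length (path_of_set n I)"
    by (auto simp: path_of_set_nth)
  then show "(x, y) \<in> set (path_of_set n I)" by (metis nth_mem)
qed

lemma vsteps_path_of_set:
  assumes "I \<subseteq> {1..n}"
  shows "vsteps (path_of_set n I) = I"
proof -
  have "snd (path_of_set n I ! i) = Suc (snd (path_of_set n I ! (i - 1))) \<longleftrightarrow> i \<in> I"
    if "i \<in> {1..n}" for i
  proof -
    have "i \<le> n" "i - 1 \<le> n" "Suc (i - 1) = i" using that by auto
    then show ?thesis using height_Suc[of I "i - 1"] by (simp only: path_of_set_nth) simp
  qed
  then show ?thesis using assms by (auto simp: vsteps_def)
qed

lemma successively_path_of_set: "successively unit_step (path_of_set n I)"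
  by (auto simp: successively_conv_nth path_of_set_nth unit_step_def height_Suc Suc_diff_le height_le)

definition lattice_paths :: "nat \<Rightarrow> nat \<Rightarrow> point list set" where
  "lattice_paths n r =
     {P. P \<noteq> [] \<and> successively unit_step P \<and> hd P = (0, 0) \<and> last P = (n - r, r)}"

lemma length_lattice_path:
  assumes "P \<in> lattice_paths n r" "r \<le> n"
  shows "length P = Suc n"
proof -
  have "level (last P) = level (hd P) + (length P - 1)"
    using assms level_nth[of P "length P - 1"] by (auto simp: lattice_paths_def last_conv_nth)
  then show ?thesis using assms by (cases P) (auto simp: lattice_paths_def level_def)
qed

lemma snd_nth_eq_height:
  assumes "successively unit_step P" "hd P = (0, 0)" "m < length P"
  shows "snd (P ! m) = height (vsteps P) m"
  using assms(3)
proof (induction m)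
  case 0
  then show ?case using assms(2) by (simp add: hd_conv_nth)
next
  case (Suc m)
  then show ?case using successively_nth[OF assms(1), of m]
    by (auto simp: height_Suc vsteps_def unit_step_def)
qed

lemma path_of_set_vsteps:
  assumes "P \<in> lattice_paths n r" "r \<le> n"
  shows "path_of_set n (vsteps P) = P"
proof (rule nth_equalityI)
  show len: "length (path_of_set n (vsteps P)) = length P"
    using length_lattice_path[OF assms] by simp
  fix m assume "m < length (path_of_set n (vsteps P))"
  then have m: "m < length P" "m \<le> n" using len by auto
  have P: "successively unit_step P" "hd P = (0, 0)" using assms by (auto simp: lattice_paths_def)
  have "fst (P ! m) + snd (P ! m) = m" using level_nth[OF P(1) m(1)] P(2) by (simp add: level_def)
  then show "path_of_set n (vsteps P) ! m = P ! m"
    using snd_nth_eq_height[OF P m(1)] m(2) by (simp add: path_of_set_nth prod_eq_iff)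
qed

lemma bij_betw_vsteps:
  assumes "r \<le> n"
  shows "bij_betw vsteps (lattice_paths n r) {I. I \<subseteq> {1..n} \<and> card I = r}"
proof (rule bij_betw_byWitness[where f' = "path_of_set n"])
  show "\<forall>P\<in>lattice_paths n r. path_of_set n (vsteps P) = P"
    using path_of_set_vsteps assms by blast
  show "\<forall>I\<in>{I. I \<subseteq> {1..n} \<and> card I = r}. vsteps (path_of_set n I) = I"
    using vsteps_path_of_set by blast
  show "vsteps ` lattice_paths n r \<subseteq> {I. I \<subseteq> {1..n} \<and> card I = r}"
  proof clarify
    fix P assume P: "P \<in> lattice_paths n r"
    have len: "length P = Suc n" using length_lattice_path[OF P assms] .
    have sub: "vsteps P \<subseteq> {1..n}" using len by (auto simp: vsteps_def)
    have "snd (P ! n) = height (vsteps P) n"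
      using snd_nth_eq_height[of P n] P len by (auto simp: lattice_paths_def)
    moreover have "P ! n = (n - r, r)"
      using P len by (auto simp: lattice_paths_def last_conv_nth)
    ultimately show "vsteps P \<subseteq> {1..n} \<and> card (vsteps P) = r"
      using sub by (simp add: height_def Int_absorb2)
  qed
  show "path_of_set n ` {I. I \<subseteq> {1..n} \<and> card I = r} \<subseteq> lattice_paths n r"
  proof clarify
    fix I assume I: "I \<subseteq> {1..n}" "r = card I"
    have "height I n = card I" using I by (simp add: height_def Int_absorb2)
    then show "path_of_set n I \<in> lattice_paths n (card I)"
      using successively_path_of_set path_of_set_nth[of 0 n I] path_of_set_nth[of n n I]
      by (auto simp: lattice_paths_def hd_conv_nth last_conv_nth path_of_set_def simp del: upt_Suc)
  qed
qed

text \<open>Each row contributes a horizontal segment that ends at the abscissa of the vertical step to the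
  next row.\<close>

lemma path_from_is_path:
  assumes "sorted ms" "set ms \<subseteq> {x..k}" "x \<le> k"
  shows "path_from k (x, y) ms \<noteq> [] \<and> hd (path_from k (x, y) ms) = (x, y) \<and>
    last (path_from k (x, y) ms) = (k, y + length ms) \<and>
    successively unit_step (path_from k (x, y) ms)"
  using assms
proof (induction ms arbitrary: x y)
  case Nil
  then show ?case
    by (auto simp: hd_map last_map successively_conv_nth unit_step_def simp del: upt_Suc)
next
  case (Cons m ms)
  have IH: "path_from k (m, Suc y) ms \<noteq> [] \<and> hd (path_from k (m, Suc y) ms) = (m, Suc y) \<and>
    last (path_from k (m, Suc y) ms) = (k, Suc y + length ms) \<and>
    successively unit_step (path_from k (m, Suc y) ms)"
    using Cons.prems by (intro Cons.IH) auto
  have "x \<le> m" using Cons.prems by auto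
  moreover have "successively unit_step (map (\<lambda>i. (i, y)) [x..<Suc m])"
    by (auto simp: successively_conv_nth unit_step_def simp del: upt_Suc)
  moreover have "unit_step (m, y) (m, Suc y)" by (simp add: unit_step_def)
  ultimately show ?case using IH
    by (auto simp: hd_map last_map successively_append_iff simp del: upt_Suc)
qed

text \<open>In the first row in which two partitions differ, the path with the smaller part turns up
  while the other one goes on to the right.\<close>

lemma path_from_inj:
  assumes "path_from k (x, y) ms = path_from k (x, y) ms'" "length ms = length ms'"
    "sorted ms" "set ms \<subseteq> {x..k}" "sorted ms'" "set ms' \<subseteq> {x..k}"
  shows "ms = ms'"
  using assms
proof (induction ms arbitrary: x y ms')
  case Nil
  then show ?case by simp
next
  case (Cons m ms)
  then obtain m' ns where ms': "ms' = m' # ns" by (cases ms') auto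
  \<comment> \<open>The entry after the segment up to \<open>a\<close> is one row higher in the first path, but not in the second.\<close>
  have aux: False
    if "a < b" "x \<le> a" "sorted as" "set as \<subseteq> {a..k}" "a \<le> k"
      and eq: "map (\<lambda>i. (i, y)) [x..<Suc a] @ path_from k (a, Suc y) as =
         map (\<lambda>i. (i, y)) [x..<Suc b] @ path_from k (b, Suc y) bs" for a b as bs
  proof -
    have "path_from k (a, Suc y) as \<noteq> []" "hd (path_from k (a, Suc y) as) = (a, Suc y)"
      using path_from_is_path[of as a k "Suc y"] that by auto
    then have "(map (\<lambda>i. (i, y)) [x..<Suc a] @ path_from k (a, Suc y) as) ! (Suc a - x) = (a, Suc y)"
      by (simp add: nth_append hd_conv_nth del: upt_Suc)
    moreover have "(map (\<lambda>i. (i, y)) [x..<Suc b] @ path_from k (b, Suc y) bs) ! (Suc a - x) = (Suc a, y)"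
    proof -
      have "Suc a - x < Suc b - x" "x + (Suc a - x) = Suc a" using that(1,2) by auto
      then show ?thesis by (simp add: nth_append del: upt_Suc)
    qed
    ultimately show False using eq by simp
  qed
  have prems: "x \<le> m" "m \<le> k" "x \<le> m'" "m' \<le> k" "set ms \<subseteq> {m..k}" "set ns \<subseteq> {m'..k}"
    "sorted ms" "sorted ns"
    using Cons.prems unfolding ms' by auto
  have "m = m'"
  proof (rule ccontr)
    assume "m \<noteq> m'"
    then consider "m < m'" | "m' < m" by linarith
    then show False
    proof cases
      case 1
      then show False using aux[of m m' ms ns] prems Cons.prems(1) unfolding ms' by simp
    next
      case 2
      then show False using aux[of m' m ns ms] prems Cons.prems(1) unfolding ms' by simp
    qed
  qed
  moreover from this have "ms = ns"
    using Cons.IH[of m "Suc y" ns] Cons.prems prems unfolding ms' by simp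
  ultimately show ?case using ms' by simp
qed

text \<open>Read the path from its start: a step to the right does not change the list of parts, and a
  step up records the current abscissa as the next part.\<close>

lemma path_from_surj:
  assumes "P \<noteq> []" "hd P = (x, y)" "last P = (k, y + l)" "successively unit_step P"
  shows "\<exists>ms. length ms = l \<and> sorted ms \<and> set ms \<subseteq> {x..k} \<and> x \<le> k \<and> path_from k (x, y) ms = P"
  using assms
proof (induction P arbitrary: x y l)
  case Nil
  then show ?case by simp
next
  case (Cons p P)
  have p: "p = (x, y)" using Cons.prems by simp
  show ?case
  proof (cases "P = []")
    case True
    then have "x = k" "l = 0" using Cons.prems by auto
    then show ?thesis using True p by (intro exI[of _ "[]"]) simp
  next
    case False
    then have step: "unit_step (x, y) (hd P)" and suc: "successively unit_step P"
      and last: "last P = (k, y + l)"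
      using Cons.prems p by (auto simp: successively_Cons)
    from step consider "hd P = (Suc x, y)" | "hd P = (x, Suc y)" by (auto simp: unit_step_def)
    then show ?thesis
    proof cases
      case 1
      then obtain ms where ms: "length ms = l" "sorted ms" "set ms \<subseteq> {Suc x..k}" "Suc x \<le> k"
        "path_from k (Suc x, y) ms = P"
        using Cons.IH[OF False _ last suc] by blast
      then have "path_from k (x, y) ms = p # P"
        using p by (cases ms) (auto simp: upt_rec[of x])
      then show ?thesis using ms by (intro exI[of _ ms]) auto
    next
      case 2
      have "level (hd P) \<le> level (last P)" "snd (hd P) \<le> snd (last P)"
      proof -
        have "successively (\<lambda>p q. snd p \<le> snd q) P"
          using suc by (rule successively_mono) (auto simp: unit_step_def)
        then have "sorted_wrt (\<lambda>p q. snd p \<le> snd q) P"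
          by (subst (asm) successively_conv_sorted_wrt) (auto intro!: transpI)
        then show "snd (hd P) \<le> snd (last P)" using False
          by (cases P) auto
        show "level (hd P) \<le> level (last P)"
          using level_nth[OF suc, of "length P - 1"] False by (simp add: last_conv_nth)
      qed
      then have "Suc y \<le> y + l" using 2 last by simp
      then obtain l' where l: "l = Suc l'" by (cases l) auto
      obtain ms where ms: "length ms = l'" "sorted ms" "set ms \<subseteq> {x..k}" "x \<le> k"
        "path_from k (x, Suc y) ms = P"
        using Cons.IH[OF False 2 _ suc, of l'] last l by auto
      then show ?thesis using p l by (intro exI[of _ "x # ms"]) auto
    qed
  qed
qed

lemma bij_betw_partition_path:
  "bij_betw (partition_path n r) (partitions_in_box n r) (lattice_paths n r)"
  unfolding bij_betw_def
proof (intro conjI equalityI subsetI)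
  have part: "length (rev lam) = r \<and> sorted (rev lam) \<and> set (rev lam) \<subseteq> {0..n - r}"
    if "lam \<in> partitions_in_box n r" for lam
    using that by (auto simp: partitions_in_box_def sorted_wrt_rev)
  show "inj_on (partition_path n r) (partitions_in_box n r)"
  proof (rule inj_onI)
    fix lam mu assume *: "lam \<in> partitions_in_box n r" "mu \<in> partitions_in_box n r"
      "partition_path n r lam = partition_path n r mu"
    then have "rev lam = rev mu"
      using part[OF *(1)] part[OF *(2)] unfolding partition_path_def
      by (intro path_from_inj[of "n - r" 0 0]) auto
    then show "lam = mu" by simp
  qed
  fix P
  show "P \<in> lattice_paths n r" if "P \<in> partition_path n r ` partitions_in_box n r"
    using that part path_from_is_path[of "rev _" 0 "n - r" 0]
    by (force simp: lattice_paths_def partition_path_def)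
  assume "P \<in> lattice_paths n r"
  then obtain ms where ms: "length ms = r" "sorted ms" "set ms \<subseteq> {0..n - r}"
    "path_from (n - r) (0, 0) ms = P"
    using path_from_surj[of P 0 0 "n - r" r] by (auto simp: lattice_paths_def)
  then have "rev ms \<in> partitions_in_box n r" "partition_path n r (rev ms) = P"
    by (auto simp: partitions_in_box_def partition_path_def sorted_wrt_rev)
  then show "P \<in> partition_path n r ` partitions_in_box n r" by blast
qed

lemma vertical_steps_eq_vsteps:
  assumes "lam \<in> partitions_in_box n r" "r \<le> n"
  shows "vertical_steps n r lam = vsteps (partition_path n r lam)"
proof -
  have "partition_path n r lam \<in> lattice_paths n r"
    using assms bij_betw_partition_path bij_betw_apply by metis
  then show ?thesis
    using length_lattice_path assms(2) by (auto simp: vertical_steps_def vsteps_def)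
qed

text \<open>This makes the Pluecker coordinates of subsets and those of partitions interchangeable.\<close>

lemma bij_betw_vertical_steps:
  assumes "r \<le> n"
  shows "bij_betw (vertical_steps n r) (partitions_in_box n r) {I. I \<subseteq> {1..n} \<and> card I = r}"
proof -
  have "bij_betw (vsteps \<circ> partition_path n r) (partitions_in_box n r) {I. I \<subseteq> {1..n} \<and> card I = r}"
    using bij_betw_trans[OF bij_betw_partition_path bij_betw_vsteps[OF assms]] .
  then show ?thesis
    by (rule bij_betw_cong[THEN iffD1, rotated]) (simp add: vertical_steps_eq_vsteps assms)
qed

section \<open>Products over the arrows of a path\<close>

lemma distinct_unit_steps:
  assumes "successively unit_step P"
  shows "distinct P"
  unfolding distinct_conv_nth using level_nth[OF assms] by (metis add_left_cancel)

lemma unit_steps_between: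
  assumes "successively unit_step P" "p \<in> set P"
  shows "fst (hd P) \<le> fst p" "snd (hd P) \<le> snd p" "fst p \<le> fst (last P)" "snd p \<le> snd (last P)"
proof -
  let ?le = "\<lambda>p q :: point. fst p \<le> fst q \<and> snd p \<le> snd q"
  have "successively ?le P"
    using assms(1) by (rule successively_mono) (auto simp: unit_step_def)
  then have "sorted_wrt ?le P"
    by (subst (asm) successively_conv_sorted_wrt) (auto intro!: transpI)
  with assms(2) have "?le (hd P) p \<and> ?le p (last P)"
  proof (induction P arbitrary: p)
    case (Cons q P)
    then show ?case by (cases "P = []"; cases "p = q") (auto dest: last_in_set)
  qed simp
  then show "fst (hd P) \<le> fst p" "snd (hd P) \<le> snd p" "fst p \<le> fst (last P)" "snd p \<le> snd (last P)"
    by auto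
qed

text \<open>Paths between vertices of the quiver, that is, concatenations of arrows or single vertices.\<close>

definition ladder_paths :: "nat \<Rightarrow> nat \<Rightarrow> point list set" where
  "ladder_paths n r = {P. P \<noteq> [] \<and> set P \<subseteq> {..n - r} \<times> {..r} \<and> successively unit_step P \<and>
     hd P \<in> LQ0 n r \<and> last P \<in> LQ0 n r}"

definition arrows_in :: "nat \<Rightarrow> nat \<Rightarrow> point list \<Rightarrow> point list set" where
  "arrows_in n r P = {a \<in> LQ1 n r. sublist a P}"

definition arrow_prod :: "nat \<Rightarrow> nat \<Rightarrow> (point list \<Rightarrow> complex) \<Rightarrow> point list \<Rightarrow> complex" where
  "arrow_prod n r f P = (\<Prod>a\<in>arrows_in n r P. f a)"

lemma finite_arrows_in: "finite (arrows_in n r P)"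
  by (rule finite_subset[of _ "set (sublists P)"]) (auto simp: arrows_in_def)

lemma LQ0_ends [simp]: "(0, 0) \<in> LQ0 n r" "(n - r, r) \<in> LQ0 n r"
  by (auto simp: LQ0_def)

lemma LQ0_box: "v \<in> LQ0 n r \<Longrightarrow> fst v \<le> n - r \<and> snd v \<le> r"
  by (auto simp: LQ0_def)

lemma LQ1_subset_ladder_paths: "LQ1 n r \<subseteq> ladder_paths n r"
  by (auto simp: LQ1_def ladder_paths_def)

lemma lattice_paths_subset_ladder_paths: "lattice_paths n r \<subseteq> ladder_paths n r"
proof
  fix P assume P: "P \<in> lattice_paths n r"
  then have "set P \<subseteq> {..n - r} \<times> {..r}"
    using unit_steps_between[of P] by (fastforce simp: lattice_paths_def)
  then show "P \<in> ladder_paths n r" using P by (auto simp: lattice_paths_def ladder_paths_def)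
qed

text \<open>A sublist that starts outside an initial segment cannot begin inside it.\<close>

lemma sublist_append_skip:
  assumes "sublist b (us @ w)" "b \<noteq> []" "hd b \<notin> set us"
  shows "sublist b w"
  using assms
proof (induction us)
  case (Cons u us)
  then have "\<not> prefix b (u # us @ w)" by (cases b) auto
  then show ?case using Cons by (auto simp: sublist_Cons_right)
qed simp

text \<open>An arrow ends at the first vertex that it meets, so no arrow continues another one.\<close>

lemma LQ1_prefix_eq:
  assumes "a \<in> LQ1 n r" "b \<in> LQ1 n r" "prefix a b"
  shows "a = b"
proof (rule ccontr)
  assume "a \<noteq> b"
  then obtain c cs where b: "b = a @ c # cs" using assms(3) by (metis prefixE append_Nil2 list.exhaust)
  obtain x y zs where a: "a = x # y # zs" using assms(1)
    by (auto simp: LQ1_def numeral_2_eq_2 Suc_le_length_iff)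
  have "last a \<in> set (butlast (tl b))" unfolding a b by (simp add: butlast_append)
  then show False using assms(1,2) by (auto simp: LQ1_def)
qed

text \<open>An arrow inside the path starts at a vertex. It cannot start in the interior of \<open>a\<close>, so it
  either starts together with \<open>a\<close>, and is then equal to \<open>a\<close>, or it lies in the remaining path. The arrow
  \<open>a\<close> itself is not in the remaining path because a lattice path never returns to a point.\<close>

lemma arrows_in_Cons_arrow:
  assumes a: "a \<in> LQ1 n r" and chain: "successively unit_step (a @ vs)"
  shows "arrows_in n r (a @ vs) = insert a (arrows_in n r (last a # vs))"
    and "a \<notin> arrows_in n r (last a # vs)"
proof -
  obtain p us where aeq: "a = p # us @ [last a]" and us: "set us \<inter> LQ0 n r = {}"
  proof -
    obtain x y zs where "a = x # y # zs" using a
      by (auto simp: LQ1_def numeral_2_eq_2 Suc_le_length_iff)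
    then show thesis using a that[of x "butlast (y # zs)"]
      by (auto simp: LQ1_def simp del: butlast.simps last.simps) (simp add: last_ConsR)
  qed
  have "p \<notin> set (last a # vs)"
    using distinct_unit_steps[OF chain] by (subst (asm) aeq) auto
  moreover have "p \<in> set a" by (subst aeq) simp
  ultimately show notin: "a \<notin> arrows_in n r (last a # vs)"
    using set_mono_sublist by (fastforce simp: arrows_in_def)
  show "arrows_in n r (a @ vs) = insert a (arrows_in n r (last a # vs))"
  proof (intro equalityI subsetI)
    fix b assume "b \<in> arrows_in n r (a @ vs)"
    then have b: "b \<in> LQ1 n r" "sublist b (p # us @ last a # vs)"
      using aeq unfolding arrows_in_def by (auto, metis append.assoc append_Cons append_Nil)
    show "b \<in> insert a (arrows_in n r (last a # vs))"
    proof (cases "prefix b (p # us @ last a # vs)")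
      case True
      moreover have "prefix a (p # us @ last a # vs)" by (subst aeq) simp
      ultimately have "prefix a b \<or> prefix b a" using prefix_same_cases by blast
      then show ?thesis using LQ1_prefix_eq a b(1) by blast
    next
      case False
      then have "sublist b (us @ last a # vs)" using b(2) by (simp add: sublist_Cons_right)
      moreover have "b \<noteq> []" "hd b \<notin> set us" using b(1) us by (auto simp: LQ1_def)
      ultimately show ?thesis using sublist_append_skip b(1) by (auto simp: arrows_in_def)
    qed
  next
    fix b assume "b \<in> insert a (arrows_in n r (last a # vs))"
    moreover have "sublist (last a # vs) (a @ vs)"
      by (subst (2) aeq) (simp, metis sublist_appendI append_Cons append_Nil2)
    ultimately show "b \<in> arrows_in n r (a @ vs)"
      using a by (auto simp: arrows_in_def intro: sublist_order.order_trans)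
  qed
qed

text \<open>Cutting a path at the first vertex after its start splits off one arrow.\<close>

lemma ladder_path_induct [consumes 1, case_names vertex arrow]:
  assumes "P \<in> ladder_paths n r"
    and "\<And>v. v \<in> LQ0 n r \<Longrightarrow> Q [v]"
    and "\<And>a vs. a \<in> LQ1 n r \<Longrightarrow> last a # vs \<in> ladder_paths n r \<Longrightarrow>
      successively unit_step (a @ vs) \<Longrightarrow> Q (last a # vs) \<Longrightarrow> Q (a @ vs)"
  shows "Q P"
  using assms(1)
proof (induction P rule: length_induct)
  case (1 P)
  then have P: "P \<noteq> []" "set P \<subseteq> {..n - r} \<times> {..r}" "successively unit_step P"
    "hd P \<in> LQ0 n r" "last P \<in> LQ0 n r" by (auto simp: ladder_paths_def)
  then obtain p L where PL: "P = p # L" by (cases P) auto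
  show ?case
  proof (cases "L = []")
    case True
    then show ?thesis using assms(2)[of p] P PL by simp
  next
    case False
    then have "last P \<in> set L" using PL by simp
    then have "\<exists>x\<in>set L. x \<in> LQ0 n r" using P by blast
    then obtain us v vs where L: "L = us @ v # vs" "v \<in> LQ0 n r" "\<forall>x\<in>set us. x \<notin> LQ0 n r"
      using split_list_first_propE[of L "\<lambda>x. x \<in> LQ0 n r"] by blast
    define a where "a = p # us @ [v]"
    have Peq: "P = a @ vs" "last a = v" by (simp_all add: a_def PL L(1))
    have chain: "successively unit_step (a @ vs)" using P(3) unfolding Peq(1) .
    have "successively unit_step a"
      using chain successively_append_iff by blast
    moreover have "set (butlast (tl a)) \<inter> LQ0 n r = {}" using L by (auto simp: a_def)
    moreover have "hd a = hd P" "2 \<le> length a" by (auto simp: a_def PL)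
    moreover have "set a \<subseteq> set P" unfolding Peq(1) by simp
    moreover have "hd P \<in> LQ0 n r" "set P \<subseteq> {..n - r} \<times> {..r}" "last a \<in> LQ0 n r"
      using P(2,4) L(2) Peq(2) by simp_all
    ultimately have a: "a \<in> LQ1 n r" unfolding LQ1_def by simp
    have "last a # vs \<in> ladder_paths n r"
    proof -
      have "successively unit_step (v # vs)"
        using chain unfolding a_def by (auto simp: successively_append_iff successively_Cons)
      moreover have "last (v # vs) = last P" by (simp add: PL L(1))
      moreover have "set (v # vs) \<subseteq> set P" unfolding PL L(1) by auto
      moreover have "last P \<in> LQ0 n r" "set P \<subseteq> {..n - r} \<times> {..r}" using P(2,5) by simp_all
      ultimately show ?thesis unfolding ladder_paths_def Peq(2) using L(2)
        by (auto simp del: last.simps set_simps)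
    qed
    moreover have "length (last a # vs) < length P" unfolding PL L(1) by simp
    ultimately have "Q (last a # vs)" using 1(1) by blast
    then show ?thesis
      using assms(3)[OF a \<open>last a # vs \<in> ladder_paths n r\<close> chain] Peq by simp
  qed
qed

lemma arrow_prod_single [simp]: "arrow_prod n r f [v] = 1"
proof -
  have "arrows_in n r [v] = {}"
    using sublist_length_le[of _ "[v]"] by (fastforce simp: arrows_in_def LQ1_def)
  then show ?thesis by (simp add: arrow_prod_def)
qed

lemma arrow_prod_Cons_arrow:
  assumes "a \<in> LQ1 n r" "successively unit_step (a @ vs)"
  shows "arrow_prod n r f (a @ vs) = f a * arrow_prod n r f (last a # vs)"
  using arrows_in_Cons_arrow[OF assms] finite_arrows_in by (simp add: arrow_prod_def)

lemma arrow_prod_arrow: "a \<in> LQ1 n r \<Longrightarrow> arrow_prod n r f a = f a"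
  using arrow_prod_Cons_arrow[of a n r "[]" f] by (simp add: LQ1_def)

lemma ladder_path_join:
  assumes "P \<in> ladder_paths n r" "P' \<in> ladder_paths n r" "last P = hd P'"
  shows "P @ tl P' \<in> ladder_paths n r" "hd (P @ tl P') = hd P" "last (P @ tl P') = last P'"
proof -
  obtain q L where P': "P' = q # L" using assms(2) by (cases P') (auto simp: ladder_paths_def)
  have P: "P \<noteq> []" using assms(1) by (simp add: ladder_paths_def)
  show hd: "hd (P @ tl P') = hd P" and last: "last (P @ tl P') = last P'"
    using P assms(3) by (simp_all add: P')
  have "successively unit_step (P @ L)"
    using assms P by (auto simp: ladder_paths_def P' successively_append_iff successively_Cons)
  moreover have "set (P @ tl P') \<subseteq> {..n - r} \<times> {..r}" "hd P \<in> LQ0 n r" "last P' \<in> LQ0 n r"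
    using assms(1,2) by (auto simp: ladder_paths_def P')
  ultimately show "P @ tl P' \<in> ladder_paths n r"
    using hd last P unfolding ladder_paths_def by (simp add: P')
qed

lemma arrow_prod_join:
  assumes "P \<in> ladder_paths n r" "P' \<in> ladder_paths n r" "last P = hd P'"
  shows "arrow_prod n r f (P @ tl P') = arrow_prod n r f P * arrow_prod n r f P'"
  using assms
proof (induction rule: ladder_path_induct)
  case (vertex v)
  then have "v # tl P' = P'" by (cases P') (auto simp: ladder_paths_def)
  then show ?case by simp
next
  case (arrow a vs)
  have "a \<noteq> []" using arrow(1) by (auto simp: LQ1_def)
  then have last: "last (last a # vs) = hd P'" using arrow.prems(2) by (cases "vs = []") simp_all
  have "a @ vs \<in> ladder_paths n r"
    using ladder_path_join(1)[of a n r "last a # vs"] LQ1_subset_ladder_paths arrow by auto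
  then have "successively unit_step (a @ vs @ tl P')"
    using ladder_path_join(1)[of "a @ vs" n r P'] arrow.prems by (simp add: ladder_paths_def)
  then show ?case
    using arrow_prod_Cons_arrow[OF arrow(1), of "vs @ tl P'" f]
      arrow_prod_Cons_arrow[OF arrow(1,3), of f] arrow.IH[OF arrow.prems(1) last] by simp
qed

text \<open>The product telescopes along the path.\<close>

lemma arrow_prod_potential:
  assumes "P \<in> ladder_paths n r" "\<And>v. v \<in> LQ0 n r \<Longrightarrow> t v \<noteq> 0"
    "\<And>a. a \<in> LQ1 n r \<Longrightarrow> f a = t (last a) / t (hd a)"
  shows "arrow_prod n r f P = t (last P) / t (hd P)"
  using assms(1)
proof (induction rule: ladder_path_induct)
  case (vertex v)
  then show ?case using assms(2) by simp
next
  case (arrow a vs)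
  have "a \<noteq> []" "last a \<in> LQ0 n r" using arrow(1) by (auto simp: LQ1_def)
  then show ?case using arrow_prod_Cons_arrow[OF arrow(1,3), of f] arrow.IH
      assms(2)[of "last a"] assms(3)[OF arrow(1)] by simp
qed

lemma arrow_prod_nonzero:
  assumes "\<And>a. a \<in> LQ1 n r \<Longrightarrow> f a \<noteq> 0"
  shows "arrow_prod n r f P \<noteq> 0"
  using assms finite_arrows_in by (auto simp: arrow_prod_def arrows_in_def prod_zero_iff)

lemma ladder_path_exists:
  assumes "v \<in> LQ0 n r" "w \<in> LQ0 n r" "fst v \<le> fst w" "snd v \<le> snd w"
  shows "\<exists>P\<in>ladder_paths n r. hd P = v \<and> last P = w"
proof -
  define P where "P = path_from (fst w) v (replicate (snd w - snd v) (fst v))"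
  have P: "P \<noteq> [] \<and> hd P = v \<and> last P = w \<and> successively unit_step P"
    using path_from_is_path[of "replicate (snd w - snd v) (fst v)" "fst v" "fst w" "snd v"] assms(3,4)
    by (auto simp: P_def subset_iff split: if_splits)
  then have "set P \<subseteq> {..n - r} \<times> {..r}"
    using unit_steps_between[of P] LQ0_box[OF assms(2)] by fastforce
  then show ?thesis using P assms by (intro bexI[of _ P]) (auto simp: ladder_paths_def)
qed

text \<open>Extending \<open>t\<close> to the source by the value \<open>1\<close> removes the case distinction at the source.\<close>

lemma torus_diag_iff:
  "psi \<in> torus_diag n r \<longleftrightarrow> psi \<in> extensional (LQ1 n r) \<and>
    (\<exists>t. t (0, 0) = 1 \<and> (\<forall>v\<in>LQ0 n r. t v \<noteq> 0) \<and> (\<forall>a\<in>LQ1 n r. psi a = t (last a) / t (hd a)))"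
    (is "_ \<longleftrightarrow> ?R")
proof
  assume "psi \<in> torus_diag n r"
  then obtain s where s: "s \<in> LQ0_bar n r \<rightarrow>\<^sub>E (UNIV - {0})"
    "psi = (\<lambda>a\<in>LQ1 n r. (s((0, 0) := 1)) (last a) / (s((0, 0) := 1)) (hd a))"
    by (auto simp: torus_diag_def)
  show ?R
    using s by (intro conjI exI[of _ "s((0, 0) := 1)"]) (auto simp: LQ0_bar_def PiE_def Pi_def)
next
  assume ?R
  then obtain t where t: "t (0, 0) = 1" "\<forall>v\<in>LQ0 n r. t v \<noteq> 0"
    "\<forall>a\<in>LQ1 n r. psi a = t (last a) / t (hd a)" and ext: "psi \<in> extensional (LQ1 n r)" by blast
  define s where "s = restrict t (LQ0_bar n r)"
  have s: "(s((0, 0) := 1)) v = t v" if "v \<in> LQ0 n r" for v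
    using that t(1) by (auto simp: s_def LQ0_bar_def)
  have "s \<in> LQ0_bar n r \<rightarrow>\<^sub>E (UNIV - {0})" using t by (auto simp: s_def LQ0_bar_def)
  moreover have "psi = (\<lambda>a\<in>LQ1 n r. (s((0, 0) := 1)) (last a) / (s((0, 0) := 1)) (hd a))"
  proof (rule extensionalityI[OF ext restrict_extensional])
    fix a assume "a \<in> LQ1 n r"
    moreover from this have "hd a \<in> LQ0 n r" "last a \<in> LQ0 n r" by (auto simp: LQ1_def)
    ultimately show "psi a = (\<lambda>a\<in>LQ1 n r. (s((0, 0) := 1)) (last a) / (s((0, 0) := 1)) (hd a)) a"
      using t s by (simp del: fun_upd_apply)
  qed
  ultimately show "psi \<in> torus_diag n r" unfolding torus_diag_def by blast
qed

lemma arrow_prod_torus: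
  assumes "psi \<in> torus_diag n r"
  shows "\<exists>c. c \<noteq> 0 \<and> (\<forall>P\<in>lattice_paths n r. arrow_prod n r psi P = c)"
proof -
  obtain t where t: "t (0, 0) = 1" "\<forall>v\<in>LQ0 n r. t v \<noteq> 0"
    "\<forall>a\<in>LQ1 n r. psi a = t (last a) / t (hd a)"
    using assms torus_diag_iff by blast
  have "arrow_prod n r psi P = t (n - r, r)" if "P \<in> lattice_paths n r" for P
    using arrow_prod_potential[of P n r t psi] lattice_paths_subset_ladder_paths that t
    by (auto simp: lattice_paths_def)
  then show ?thesis using t LQ0_ends by blast
qed

text \<open>Two paths from the source to a vertex \<open>v\<close> can be continued by the same path to the end
  vertex. The products over the two complete paths agree, and the product over the continuation is
  nonzero, so the products over the two paths agree as well. This common value is \<open>t\<^sub>v\<close>, and a path to the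
  source of an arrow followed by the arrow shows that \<open>\<psi>\<^sub>a\<close> is the quotient of the values at its ends.\<close>

lemma torus_diag_if_arrow_prod_const:
  assumes ext: "psi \<in> extensional (LQ1 n r)" and nz: "\<And>a. a \<in> LQ1 n r \<Longrightarrow> psi a \<noteq> 0"
    and const: "\<And>P. P \<in> lattice_paths n r \<Longrightarrow> arrow_prod n r psi P = c"
  shows "psi \<in> torus_diag n r"
proof -
  have unique: "arrow_prod n r psi P = arrow_prod n r psi P'"
    if P: "P \<in> ladder_paths n r" "hd P = (0, 0)" and P': "P' \<in> ladder_paths n r" "hd P' = (0, 0)"
      and eq: "last P = last P'" for P P'
  proof -
    have v: "last P \<in> LQ0 n r" using P by (simp add: ladder_paths_def)
    obtain R where R: "R \<in> ladder_paths n r" "hd R = last P" "last R = (n - r, r)"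
      using ladder_path_exists[OF v LQ0_ends(2)] LQ0_box[OF v] by auto
    have lat: "S @ tl R \<in> lattice_paths n r"
      if "S \<in> ladder_paths n r" "hd S = (0, 0)" "last S = hd R" for S
    proof -
      note join = ladder_path_join[OF that(1) R(1) that(3)]
      have "S @ tl R \<noteq> [] \<and> successively unit_step (S @ tl R)"
        using join(1) unfolding ladder_paths_def mem_Collect_eq by blast
      then show ?thesis using join(2,3) that(2) R(3) unfolding lattice_paths_def by simp
    qed
    have "arrow_prod n r psi P * arrow_prod n r psi R = c"
      using const[OF lat[of P]] arrow_prod_join[of P n r R psi] P R by simp
    moreover have "arrow_prod n r psi P' * arrow_prod n r psi R = c"
      using const[OF lat[of P']] arrow_prod_join[of P' n r R psi] P' R eq by simp
    ultimately have "arrow_prod n r psi P * arrow_prod n r psi R =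
      arrow_prod n r psi P' * arrow_prod n r psi R" by simp
    moreover have "arrow_prod n r psi R \<noteq> 0" using nz by (rule arrow_prod_nonzero)
    ultimately show ?thesis by simp
  qed
  define path where
    "path v = (SOME P. P \<in> ladder_paths n r \<and> hd P = (0, 0) \<and> last P = v)" for v
  define t where "t v = arrow_prod n r psi (path v)" for v
  have path: "path v \<in> ladder_paths n r \<and> hd (path v) = (0, 0) \<and> last (path v) = v"
    if "v \<in> LQ0 n r" for v
  proof -
    have "\<exists>P. P \<in> ladder_paths n r \<and> hd P = (0, 0) \<and> last P = v"
      using ladder_path_exists[OF LQ0_ends(1) that] by auto
    from someI_ex[OF this] show ?thesis unfolding path_def .
  qed
  have t_eq: "t (last P) = arrow_prod n r psi P" if "P \<in> ladder_paths n r" "hd P = (0, 0)" for P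
  proof -
    have "last P \<in> LQ0 n r" using that(1) by (simp add: ladder_paths_def)
    note p = path[OF this]
    show ?thesis unfolding t_def using p that by (intro unique) simp_all
  qed
  have "t (0, 0) = 1"
    using t_eq[of "[(0, 0)]"] by (auto simp: ladder_paths_def)
  moreover have "\<forall>v\<in>LQ0 n r. t v \<noteq> 0" unfolding t_def using arrow_prod_nonzero nz by blast
  moreover have "\<forall>a\<in>LQ1 n r. psi a = t (last a) / t (hd a)"
  proof
    fix a assume a: "a \<in> LQ1 n r"
    then have a': "a \<in> ladder_paths n r" "hd a \<in> LQ0 n r"
      using LQ1_subset_ladder_paths by (auto simp: LQ1_def)
    note p = path[OF a'(2)]
    have "t (last a) = arrow_prod n r psi (path (hd a) @ tl a)"
      using t_eq[of "path (hd a) @ tl a"] ladder_path_join[of "path (hd a)" n r a] p a' by simp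
    also have "\<dots> = t (hd a) * psi a"
      using arrow_prod_join[of "path (hd a)" n r a psi] p a' arrow_prod_arrow[OF a] by (simp add: t_def)
    finally show "psi a = t (last a) / t (hd a)"
      using \<open>\<forall>v\<in>LQ0 n r. t v \<noteq> 0\<close> a' by simp
  qed
  ultimately show ?thesis unfolding torus_diag_iff using ext by blast
qed

section \<open>Weights of the vertical steps\<close>

text \<open>The product of \<open>\<zeta>\<^sub>i\<close> over the vertical steps of a path, where the step that ends at level \<open>i\<close>
  has number \<open>i\<close>. Numbering by level rather than by position makes this meaningful for arrows that do not
  start at the origin.\<close>

fun step_weight :: "(nat \<Rightarrow> complex) \<Rightarrow> point list \<Rightarrow> complex" where
  "step_weight zeta (p # q # P) =
     (if snd q = Suc (snd p) then zeta (level q) else 1) * step_weight zeta (q # P)"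
| "step_weight zeta P = 1"

lemma step_weight_append:
  "P \<noteq> [] \<Longrightarrow> step_weight zeta (P @ Q) = step_weight zeta P * step_weight zeta (last P # Q)"
  by (induction zeta P rule: step_weight.induct) auto

lemma step_weight_eq_prod_vsteps:
  assumes "successively unit_step P" "P \<noteq> []" "hd P = (0, 0)"
  shows "step_weight zeta P = (\<Prod>i\<in>vsteps P. zeta i)"
  using assms
proof (induction P rule: rev_induct)
  case (snoc q P)
  show ?case
  proof (cases "P = []")
    case True
    then show ?thesis by (simp add: vsteps_def)
  next
    case False
    have "level q = length P"
      using level_nth[OF snoc.prems(1), of "length P"] snoc.prems by (simp add: level_def)
    moreover have "vsteps (P @ [q]) =
      (if snd q = Suc (snd (last P)) then insert (length P) (vsteps P) else vsteps P)"
      using False by (auto simp: vsteps_def nth_append last_conv_nth less_Suc_eq Suc_le_eq)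
    moreover have "finite (vsteps P)" "length P \<notin> vsteps P" by (auto simp: vsteps_def)
    ultimately show ?thesis
      using snoc False step_weight_append[OF False, of zeta "[q]"]
      by (simp add: successively_append_iff mult.commute)
  qed
qed simp

lemma arrow_prod_step_weight:
  assumes "P \<in> ladder_paths n r" "\<And>a. a \<in> LQ1 n r \<Longrightarrow> f a = step_weight zeta a"
  shows "arrow_prod n r f P = step_weight zeta P"
  using assms(1)
proof (induction rule: ladder_path_induct)
  case (arrow a vs)
  have "a \<noteq> []" using arrow(1) by (auto simp: LQ1_def)
  then show ?case
    using arrow_prod_Cons_arrow[OF arrow(1,3), of f] assms(2)[OF arrow(1)]
      step_weight_append[of a zeta vs] arrow.IH by simp
qed simp

lemma arrow_prod_vsteps:
  assumes "P \<in> lattice_paths n r" "\<And>a. a \<in> LQ1 n r \<Longrightarrow> f a = step_weight zeta a"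
  shows "arrow_prod n r f P = (\<Prod>i\<in>vsteps P. zeta i)"
proof -
  have "P \<in> ladder_paths n r" using assms(1) lattice_paths_subset_ladder_paths by blast
  then show ?thesis
    using arrow_prod_step_weight[OF _ assms(2)] step_weight_eq_prod_vsteps[of P zeta] assms(1)
    by (simp add: lattice_paths_def)
qed

section \<open>Cyclic intervals\<close>

text \<open>The \<open>r\<close> elements after \<open>c\<close> in the cyclic order of \<open>{1..n}\<close>. The second alternative says
  \<open>i + n \<le> c + r\<close> and describes the elements after the wrap around.\<close>

definition cyclic_interval :: "nat \<Rightarrow> nat \<Rightarrow> nat \<Rightarrow> nat set" where
  "cyclic_interval n r c = {i \<in> {1..n}. c < i \<and> i \<le> c + r \<or> i + (n - r) \<le> c}"

lemma height_cyclic_interval: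
  assumes "c < n" "r < n" "m \<le> n"
  shows "height (cyclic_interval n r c) m =
    (if c \<le> n - r then min (m - c) r else min m (c - (n - r)) + (m - c))"
proof (cases "c \<le> n - r")
  case True
  then have "cyclic_interval n r c \<inter> {1..m} = {c<..min m (c + r)}"
    using assms by (auto simp: cyclic_interval_def)
  then show ?thesis using True by (auto simp: height_def)
next
  case False
  then have "cyclic_interval n r c \<inter> {1..m} = {1..min m (c - (n - r))} \<union> {c<..m}"
    using assms by (auto simp: cyclic_interval_def)
  moreover have "{1..min m (c - (n - r))} \<inter> {c<..m} = {}" by auto
  ultimately show ?thesis using False by (simp add: height_def card_Un_disjoint)
qed

lemma card_cyclic_interval:
  assumes "c < n" "r < n"
  shows "card (cyclic_interval n r c) = r"
proof -
  have "cyclic_interval n r c \<inter> {1..n} = cyclic_interval n r c" by (auto simp: cyclic_interval_def)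
  then have "card (cyclic_interval n r c) = height (cyclic_interval n r c) n" by (simp add: height_def)
  then show ?thesis using height_cyclic_interval[OF assms, of n] assms by auto
qed

text \<open>The interval after \<open>c\<close> contains \<open>i\<close> when \<open>c\<close> is one of the \<open>r\<close> cyclic predecessors of \<open>i\<close>.\<close>

lemma card_cyclic_intervals_containing:
  assumes "i \<in> {1..n}" "r < n"
  shows "card {c \<in> {..<n}. i \<in> cyclic_interval n r c} = r"
proof -
  have "{c \<in> {..<n}. i \<in> cyclic_interval n r c} = {i - r..<i} \<union> {i + (n - r)..<n}"
    using assms by (auto simp: cyclic_interval_def)
  moreover have "{i - r..<i} \<inter> {i + (n - r)..<n} = {}" by auto
  ultimately show ?thesis using assms by (simp add: card_Un_disjoint)
qed

definition cyclic_path :: "nat \<Rightarrow> nat \<Rightarrow> nat \<Rightarrow> point list" where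
  "cyclic_path n r c = path_of_set n (cyclic_interval n r c)"

lemma path_of_set_in_lattice_paths:
  assumes "I \<subseteq> {1..n}" "card I = r" "r \<le> n"
  shows "path_of_set n I \<in> lattice_paths n r"
proof -
  have "I \<in> vsteps ` lattice_paths n r"
    using bij_betw_vsteps[OF assms(3)] assms(1,2) by (auto simp: bij_betw_def)
  then show ?thesis using path_of_set_vsteps[OF _ assms(3)] by auto
qed

lemma cyclic_path_lattice_path:
  assumes "c < n" "r < n"
  shows "cyclic_path n r c \<in> lattice_paths n r"
  unfolding cyclic_path_def using card_cyclic_interval[OF assms] assms(2)
  by (intro path_of_set_in_lattice_paths) (auto simp: cyclic_interval_def)

lemma mem_cyclic_path:
  assumes "c < n" "r < n"
  shows "(x, y) \<in> set (cyclic_path n r c) \<longleftrightarrow> x + y \<le> n \<and>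
    y = (if c \<le> n - r then min (x + y - c) r else min (x + y) (c - (n - r)) + (x + y - c))"
  using height_cyclic_interval[OF assms, of "x + y"]
  by (auto simp: cyclic_path_def mem_path_of_set)

text \<open>The points of a path lie on consecutive levels, one on each. So the points that \<open>P\<close> has on the
  levels of \<open>a\<close> are the points of \<open>a\<close>, in the same order.\<close>

lemma sublist_if_subset:
  assumes P: "successively unit_step P" "P \<noteq> []" and a: "successively unit_step a" "a \<noteq> []"
    and sub: "set a \<subseteq> set P"
  shows "sublist a P"
proof -
  have pos: "\<exists>j < length P. P ! j = p \<and> level p = level (hd P) + j" if "p \<in> set P" for p
    using that level_nth[OF P(1)] by (auto simp: in_set_conv_nth)
  obtain s where s: "s < length P" "P ! s = hd a" "level (hd a) = level (hd P) + s"
    using pos[of "hd a"] a(2) sub hd_in_set by blast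
  have nth: "s + i < length P \<and> P ! (s + i) = a ! i" if i: "i < length a" for i
  proof -
    obtain j where "j < length P" "P ! j = a ! i" "level (a ! i) = level (hd P) + j"
      using pos[of "a ! i"] nth_mem[OF i] sub by auto
    moreover have "level (a ! i) = level (hd a) + i" using level_nth[OF a(1) i] .
    ultimately show ?thesis using s(3) by auto
  qed
  have "take (length a) (drop s P) = a"
  proof (rule nth_equalityI)
    have "s + (length a - 1) < length P" using nth[of "length a - 1"] a(2) by simp
    then show "length (take (length a) (drop s P)) = length a" using a(2) by (cases a) auto
  qed (use nth in auto)
  then show ?thesis by (metis sublist_take sublist_drop sublist_order.order_trans)
qed

lemma LQ1_vertices_at_ends:
  assumes "a \<in> LQ1 n r" "r < n"
  shows "a \<noteq> []" "successively unit_step a" "hd a \<noteq> last a"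
    "\<And>p. p \<in> set a \<Longrightarrow> p \<in> LQ0 n r \<Longrightarrow> p = hd a \<or> p = last a"
proof -
  obtain x y zs where a: "a = x # y # zs" using assms(1)
    by (auto simp: LQ1_def numeral_2_eq_2 Suc_le_length_iff)
  show "a \<noteq> []" "successively unit_step a" using assms(1) by (auto simp: LQ1_def)
  then have "distinct a" using distinct_unit_steps by blast
  then show "hd a \<noteq> last a" unfolding a by auto
  fix p assume p: "p \<in> set a" "p \<in> LQ0 n r"
  have "set (y # zs) = insert (last (y # zs)) (set (butlast (y # zs)))"
    by (subst append_butlast_last_id[of "y # zs", symmetric]) (simp_all del: append_butlast_last_id)
  then have "set a = insert (hd a) (insert (last a) (set (butlast (tl a))))"
    unfolding a by simp
  moreover have "p \<notin> set (butlast (tl a))" using assms(1) p(2) by (auto simp: LQ1_def)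
  ultimately show "p = hd a \<or> p = last a" using p(1) by auto
qed

text \<open>If the interval does not wrap around, its path runs along the bottom edge to the abscissa \<open>c\<close>,
  climbs to the top edge and follows it to the end.\<close>

lemma mem_cyclic_path_vertical:
  assumes "c \<le> n - r" "0 < r" "r < n" "x \<le> n - r" "y \<le> r"
  shows "(x, y) \<in> set (cyclic_path n r c) \<longleftrightarrow> x = c \<or> y = 0 \<and> x \<le> c \<or> y = r \<and> c \<le> x"
proof -
  have "c < n" using assms by simp
  then have "(x, y) \<in> set (cyclic_path n r c) \<longleftrightarrow> x + y \<le> n \<and> y = min (x + y - c) r"
    by (simp only: mem_cyclic_path assms if_True)
  also have "\<dots> \<longleftrightarrow> x = c \<or> y = 0 \<and> x \<le> c \<or> y = r \<and> c \<le> x"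
    using assms by linarith
  finally show ?thesis .
qed

text \<open>If the interval wraps around, its path climbs the left edge to the height \<open>d\<close>, crosses the
  grid and then climbs the right edge.\<close>

lemma mem_cyclic_path_horizontal:
  assumes "0 < d" "d < r" "r < n" "x \<le> n - r" "y \<le> r"
  shows "(x, y) \<in> set (cyclic_path n r (n - r + d)) \<longleftrightarrow>
    y = d \<or> x = 0 \<and> y \<le> d \<or> x = n - r \<and> d \<le> y"
proof -
  have "n - r + d < n" "\<not> n - r + d \<le> n - r" "n - r + d - (n - r) = d" using assms by auto
  then have "(x, y) \<in> set (cyclic_path n r (n - r + d)) \<longleftrightarrow>
      x + y \<le> n \<and> y = min (x + y) d + (x + y - (n - r + d))"
    by (simp only: mem_cyclic_path assms if_False)
  also have "\<dots> \<longleftrightarrow> y = d \<or> x = 0 \<and> y \<le> d \<or> x = n - r \<and> d \<le> y"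
    using assms by linarith
  finally show ?thesis .
qed

lemma not_successivelyE:
  assumes "\<not> successively R xs"
  obtains A p q B where "xs = A @ p # q # B" "\<not> R p q"
proof -
  obtain i where i: "Suc i < length xs" "\<not> R (xs ! i) (xs ! Suc i)"
    using assms by (auto simp: successively_conv_nth)
  have "xs = take i xs @ xs ! i # xs ! Suc i # drop (Suc (Suc i)) xs"
    using i(1) by (simp add: Cons_nth_drop_Suc)
  then show thesis using i(2) that by blast
qed

lemma successively_invariant:
  assumes "successively R xs" "Q (hd xs)" "\<And>x y. Q x \<Longrightarrow> R x y \<Longrightarrow> Q y" "x \<in> set xs"
  shows "Q x"
proof -
  have "Q (xs ! i)" if "i < length xs" for i
    using that
  proof (induction i)
    case 0
    then have "hd xs = xs ! 0" by (intro hd_conv_nth) auto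
    then show ?case using assms(2) by metis
  next
    case (Suc i)
    then have "Q (xs ! i)" by linarith
    moreover have "R (xs ! i) (xs ! Suc i)" using successively_nth[OF assms(1) Suc.prems] .
    ultimately show ?case by (rule assms(3))
  qed
  moreover obtain i where "i < length xs" "xs ! i = x" using assms(4) unfolding in_set_conv_nth by blast
  ultimately show ?thesis by blast
qed

text \<open>If an arrow has an interior vertical step, at abscissa \<open>c\<close> say, then its points before
  this step lie on the bottom edge and those after it on the top edge, since otherwise the arrow would
  meet an interior vertex. So the arrow lies in the path that climbs at the abscissa \<open>c\<close>. An interior
  horizontal step is treated in the same way. If all steps run along the boundary, the arrow goes from
  the source to the end along one of the two halves of the boundary.\<close>

lemma LQ1_in_cyclic_path:
  assumes a: "a \<in> LQ1 n r" and r: "0 < r" "r < n"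
  shows "\<exists>c<n. set a \<subseteq> set (cyclic_path n r c)"
proof -
  let ?k = "n - r"
  have k: "0 < ?k" "?k < n" using r by auto
  note cases = LQ1_vertices_at_ends[OF a r(2)]
  have box: "fst p \<le> ?k \<and> snd p \<le> r" if "p \<in> set a" for p using a that by (auto simp: LQ1_def)
  \<comment> \<open>The unit steps along the boundary of the grid.\<close>
  define R where "R p q \<longleftrightarrow> unit_step p q \<and>
    (if fst q = fst p then fst p = 0 \<or> fst p = ?k else snd p = 0 \<or> snd p = r)" for p q
  show ?thesis
  proof (cases "successively R a")
    case False
    then obtain A p q B where A: "a = A @ p # q # B" and nR: "\<not> R p q" by (rule not_successivelyE)
    have pq: "unit_step p q" and chain: "successively unit_step (A @ [p])" "successively unit_step (q # B)"
      using cases(2) unfolding A by (auto simp: successively_append_iff)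
    \<comment> \<open>A step of an arrow, unless it is the first, starts at a point that is not a vertex.\<close>
    have before: "fst s \<le> fst p \<and> snd s \<le> snd p \<and> p \<notin> LQ0 n r" if "s \<in> set A" for s
    proof -
      have "p \<noteq> hd a" "p \<noteq> last a"
        using that distinct_unit_steps[OF cases(2)] unfolding A by (cases A; auto)+
      then show ?thesis using unit_steps_between[OF chain(1), of s] that cases(4)[of p] A by auto
    qed
    have after: "fst q \<le> fst s \<and> snd q \<le> snd s \<and> q \<notin> LQ0 n r" if "s \<in> set B" for s
    proof -
      have "q \<noteq> hd a" "q \<noteq> last a"
        using that distinct_unit_steps[OF cases(2)] unfolding A by (cases A; auto)+
      then show ?thesis using unit_steps_between[OF chain(2), of s] that cases(4)[of q] A by auto
    qed
    have inpq: "p \<in> set a" "q \<in> set a" unfolding A by auto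
    show ?thesis
    proof (cases "fst q = fst p")
      case True
      then have q: "q = (fst p, Suc (snd p))" and c: "0 < fst p" "fst p < ?k"
        using pq nR box[OF inpq(1)] by (auto simp: R_def unit_step_def)
      have "s \<in> set (cyclic_path n r (fst p))" if s: "s \<in> set a" for s
      proof -
        consider "s \<in> set A" | "s = p" | "s = q" | "s \<in> set B" using s unfolding A by auto
        then have "fst s = fst p \<or> snd s = 0 \<and> fst s \<le> fst p \<or> snd s = r \<and> fst p \<le> fst s"
        proof cases
          case 1
          then show ?thesis using before[OF 1] box[OF inpq(2)] c q
            by (cases p) (auto simp: LQ0_def)
        next
          case 4
          then show ?thesis using after[OF 4] box[OF inpq(2)] box[OF s] c q
            by (cases p) (auto simp: LQ0_def)
        qed (simp_all add: q)
        then show ?thesis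
          using mem_cyclic_path_vertical[of "fst p" n r "fst s" "snd s"] box[OF s] c r by simp
      qed
      then show ?thesis using c k by (intro exI[of _ "fst p"]) auto
    next
      case False
      then have q: "q = (Suc (fst p), snd p)" and d: "0 < snd p" "snd p < r"
        using pq nR box[OF inpq(1)] by (auto simp: R_def unit_step_def)
      have "s \<in> set (cyclic_path n r (?k + snd p))" if s: "s \<in> set a" for s
      proof -
        consider "s \<in> set A" | "s = p" | "s = q" | "s \<in> set B" using s unfolding A by auto
        then have "snd s = snd p \<or> fst s = 0 \<and> snd s \<le> snd p \<or> fst s = ?k \<and> snd p \<le> snd s"
        proof cases
          case 1
          then show ?thesis using before[OF 1] box[OF inpq(2)] d q
            by (cases p) (auto simp: LQ0_def)
        next
          case 4
          then show ?thesis using after[OF 4] box[OF inpq(2)] box[OF s] d q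
            by (cases p) (auto simp: LQ0_def)
        qed (simp_all add: q)
        then show ?thesis
          using mem_cyclic_path_horizontal[of "snd p" r n "fst s" "snd s"] box[OF s] d r by simp
      qed
      then show ?thesis using d r by (intro exI[of _ "?k + snd p"]) auto
    qed
  next
    case True
    obtain p q L where L: "a = p # q # L" using a
      by (auto simp: LQ1_def numeral_2_eq_2 Suc_le_length_iff)
    have Rpq: "R p q" and chain: "successively R (q # L)" using True unfolding L by auto
    have p: "p \<in> LQ0 n r" using a L by (auto simp: LQ1_def)
    have "p = (0, 0)"
      using p Rpq box[of q] unfolding L by (auto simp: LQ0_def R_def unit_step_def)
    then consider "q = (0, 1)" | "q = (1, 0)" using Rpq by (auto simp: R_def unit_step_def)
    then show ?thesis
    proof cases
      case 1
      have "s \<in> set (cyclic_path n r 0)" if s: "s \<in> set a" for s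
      proof (cases "s = p")
        case False
        then have "s \<in> set (q # L)" using s L by auto
        \<comment> \<open>The condition \<open>0 < snd s\<close> excludes the origin, from which a boundary step may lead right.\<close>
        then have "fst s = 0 \<and> 0 < snd s \<or> r \<le> snd s"
          by (rule successively_invariant[OF chain, rotated 2])
            (auto simp: 1 R_def unit_step_def split: if_splits)
        then show ?thesis
          using mem_cyclic_path_vertical[of 0 n r "fst s" "snd s"] box[OF s] r by auto
      qed (use \<open>p = (0, 0)\<close> r mem_cyclic_path_vertical[of 0 n r 0 0] in simp)
      then show ?thesis using r by (intro exI[of _ 0]) auto
    next
      case 2
      have "s \<in> set (cyclic_path n r ?k)" if s: "s \<in> set a" for s
      proof (cases "s = p")
        case False
        then have "s \<in> set (q # L)" using s L by auto
        then have "snd s = 0 \<and> 0 < fst s \<or> ?k \<le> fst s"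
          by (rule successively_invariant[OF chain, rotated 2])
            (auto simp: 2 R_def unit_step_def split: if_splits)
        then show ?thesis
          using mem_cyclic_path_vertical[of ?k n r "fst s" "snd s"] box[OF s] r by auto
      qed (use \<open>p = (0, 0)\<close> r mem_cyclic_path_vertical[of ?k n r 0 0] in simp)
      then show ?thesis using k by (intro exI[of _ ?k]) auto
    qed
  qed
qed

text \<open>An arrow from corner to corner is as long as a complete path, so it is equal to every
  complete path that contains it. An interval determines \<open>c\<close>, the position after which it starts.\<close>

lemma full_arrow_in_unique_cyclic_path:
  assumes a: "a \<in> LQ1 n r" "hd a = (0, 0)" "last a = (n - r, r)" and r: "0 < r" "r < n"
    and c: "c < n" "set a \<subseteq> set (cyclic_path n r c)"
    and c': "c' < n" "set a \<subseteq> set (cyclic_path n r c')"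
  shows "c = c'"
proof -
  have lat: "a \<in> lattice_paths n r" using a by (auto simp: LQ1_def lattice_paths_def)
  have eq: "a = cyclic_path n r e" if "e < n" "set a \<subseteq> set (cyclic_path n r e)" for e
  proof -
    have P: "cyclic_path n r e \<in> lattice_paths n r" using cyclic_path_lattice_path that r by blast
    have "sublist a (cyclic_path n r e)"
      using P lat that(2) by (intro sublist_if_subset) (auto simp: lattice_paths_def)
    moreover have "length a = length (cyclic_path n r e)"
      using length_lattice_path[OF P] length_lattice_path[OF lat] r by simp
    ultimately show ?thesis unfolding sublist_def by auto
  qed
  have "cyclic_path n r c = cyclic_path n r c'" using eq[OF c] eq[OF c'] by simp
  then have *: "cyclic_interval n r c = cyclic_interval n r c'"
  proof -
    have "vsteps (cyclic_path n r e) = cyclic_interval n r e" for e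
      unfolding cyclic_path_def by (rule vsteps_path_of_set) (auto simp: cyclic_interval_def)
    then show ?thesis using \<open>cyclic_path n r c = cyclic_path n r c'\<close> by metis
  qed
  have False if "e < e'" "e' < n" "cyclic_interval n r e = cyclic_interval n r e'" for e e'
  proof -
    have in_own: "Suc d \<in> cyclic_interval n r d" "d \<notin> cyclic_interval n r d" if "d < n" for d
      using that r by (auto simp: cyclic_interval_def)
    have "e' \<notin> cyclic_interval n r e" "Suc e \<in> cyclic_interval n r e'"
      using in_own(1)[of e] in_own(2)[of e'] that by auto
    then have "e + r < e'" "Suc e + (n - r) \<le> e'"
      using that(1,2) by (auto simp: cyclic_interval_def)
    moreover have "Suc e' \<in> cyclic_interval n r e" using in_own(1)[of e'] that by simp
    ultimately show False using that(1,2) r by (simp add: cyclic_interval_def)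
  qed
  then show ?thesis using * c(1) c'(1) by (metis linorder_neqE_nat)
qed

text \<open>Two such paths share no interior vertex, except that a path climbing at an abscissa \<open>c\<close> and
  a path crossing at a height \<open>d\<close> meet in the point \<open>(c, d)\<close>, where they cross. An arrow common to both would
  therefore either join the two corners, and so be equal to both paths, or it would start or end at the
  crossing point, where the paths have no step in common.\<close>

lemma arrow_in_unique_cyclic_path:
  assumes a: "a \<in> LQ1 n r" and r: "0 < r" "r < n" and lt: "c < c'" "c' < n"
    and sub: "set a \<subseteq> set (cyclic_path n r c)" "set a \<subseteq> set (cyclic_path n r c')"
  shows False
proof -
  let ?k = "n - r"
  note cases = LQ1_vertices_at_ends[OF a r(2)]
  have box: "fst p \<le> ?k \<and> snd p \<le> r" if "p \<in> set a" for p using a that by (auto simp: LQ1_def)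
  have ends: "hd a \<in> set a" "last a \<in> set a" "hd a \<in> LQ0 n r" "last a \<in> LQ0 n r"
    using a cases(1) by (auto simp: LQ1_def)
  have order: "fst (hd a) \<le> fst (last a)" "snd (hd a) \<le> snd (last a)"
    using unit_steps_between[OF cases(2) ends(2)] by auto
  have not_full: "\<not> (hd a = (0, 0) \<and> last a = (?k, r))"
    using full_arrow_in_unique_cyclic_path[OF a _ _ r _ sub(1) lt(2) sub(2)] lt by auto
  have not_corners: "\<not> (hd a \<in> {(0, 0), (?k, r)} \<and> last a \<in> {(0, 0), (?k, r)})"
    using not_full order cases(3) r by (auto simp: prod_eq_iff)
  have mem: "p \<in> set (cyclic_path n r c)" "p \<in> set (cyclic_path n r c')" if "p \<in> set a" for p
    using sub that by auto
  consider (vv) "c' \<le> ?k" | (vh) "c \<le> ?k" "?k < c'" | (hh) "?k < c" using lt by linarith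
  then show False
  proof cases
    case vv
    have "p \<in> {(0, 0), (?k, r)}" if "p \<in> set a" "p \<in> LQ0 n r" for p
    proof -
      have "fst p = e \<or> snd p = 0 \<or> snd p = r" if "e \<in> {c, c'}" for e
        using mem_cyclic_path_vertical[of e n r "fst p" "snd p"] mem[OF \<open>p \<in> set a\<close>]
          box[OF \<open>p \<in> set a\<close>] that vv lt r by auto
      from this[of c] this[of c'] have "snd p = 0 \<or> snd p = r" using lt by auto
      then show ?thesis using that(2) by (auto simp: LQ0_def)
    qed
    then show False using ends not_corners by blast
  next
    case hh
    define d d' where "d = c - ?k" and "d' = c' - ?k"
    have d: "c = ?k + d" "c' = ?k + d'" "0 < d" "d < d'" "d' < r"
      using hh lt r by (auto simp: d_def d'_def)
    have "p \<in> {(0, 0), (?k, r)}" if "p \<in> set a" "p \<in> LQ0 n r" for p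
    proof -
      have "snd p = e \<or> fst p = 0 \<or> fst p = ?k" if "e \<in> {d, d'}" for e
        using mem_cyclic_path_horizontal[of e r n "fst p" "snd p"] mem[OF \<open>p \<in> set a\<close>]
          box[OF \<open>p \<in> set a\<close>] that d r by auto
      from this[of d] this[of d'] have "fst p = 0 \<or> fst p = ?k" using d by auto
      then show ?thesis using that(2) by (auto simp: LQ0_def)
    qed
    then show False using ends not_corners by blast
  next
    case vh
    define d where "d = c' - ?k"
    have d: "c' = ?k + d" "0 < d" "d < r" using vh lt r by (auto simp: d_def)
    have V: "fst p = c \<or> snd p = 0 \<and> fst p \<le> c \<or> snd p = r \<and> c \<le> fst p" if "p \<in> set a" for p
      using mem(1)[OF that] box[OF that] vh(1) r mem_cyclic_path_vertical[of c n r "fst p" "snd p"]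
      by simp
    have H: "snd p = d \<or> fst p = 0 \<and> snd p \<le> d \<or> fst p = ?k \<and> d \<le> snd p" if "p \<in> set a" for p
      using mem(2)[OF that] box[OF that] d r
        mem_cyclic_path_horizontal[of d r n "fst p" "snd p"] by simp
    have VH: "p \<in> {(0, 0), (?k, r)} \<or> p = (c, d) \<and> 0 < c \<and> c < ?k" if "p \<in> set a" "p \<in> LQ0 n r" for p
    proof (cases "p \<in> {(0, 0), (?k, r)}")
      case False
      then have "0 < fst p" "fst p < ?k" "0 < snd p" "snd p < r" using that(2) by (auto simp: LQ0_def)
      then show ?thesis using V[OF that(1)] H[OF that(1)] by (auto simp: prod_eq_iff)
    qed simp
    obtain p q L where L: "a = p # q # L" using a
      by (auto simp: LQ1_def numeral_2_eq_2 Suc_le_length_iff)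
    obtain s t M where M: "a = M @ [s, t]"
    proof -
      have "butlast a \<noteq> []" unfolding L by simp
      then have "butlast a = butlast (butlast a) @ [last (butlast a)]" by simp
      moreover have "a = butlast a @ [last a]" unfolding L by simp
      ultimately have "a = butlast (butlast a) @ [last (butlast a), last a]"
        by (metis append.assoc append_Cons append_Nil)
      then show thesis using that by blast
    qed
    have steps: "unit_step p q" "unit_step s t"
      using cases(2) by (simp add: L, simp add: M successively_append_iff)
    have "hd a = (c, d) \<and> 0 < c \<and> c < ?k \<or> last a = (c, d) \<and> 0 < c \<and> c < ?k"
      using VH[of "hd a"] VH[of "last a"] ends not_corners by blast
    then show False
    proof
      assume *: "hd a = (c, d) \<and> 0 < c \<and> c < ?k"
      then have "p = (c, d)" "q \<in> set a" by (auto simp: L)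
      then show False using V[of q] H[of q] steps(1) d * unfolding unit_step_def
        by (elim disjE) simp_all
    next
      assume *: "last a = (c, d) \<and> 0 < c \<and> c < ?k"
      then have "t = (c, d)" "s \<in> set a" by (auto simp: M)
      then show False using V[of s] H[of s] steps(2) d * unfolding unit_step_def
        by (cases s) (elim disjE; simp)
    qed
  qed
qed

text \<open>The arrows of the cyclic paths partition the set of all arrows.\<close>

lemma prod_LQ1:
  assumes "0 < r" "r < n"
  shows "(\<Prod>a\<in>LQ1 n r. f a) = (\<Prod>c<n. arrow_prod n r f (cyclic_path n r c))"
proof -
  have sub: "sublist a (cyclic_path n r c) \<longleftrightarrow> set a \<subseteq> set (cyclic_path n r c)"
    if "a \<in> LQ1 n r" "c < n" for a c
    using cyclic_path_lattice_path[OF that(2) assms(2)] LQ1_vertices_at_ends(1,2)[OF that(1) assms(2)]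
      sublist_if_subset[of "cyclic_path n r c" a] set_mono_sublist[of a "cyclic_path n r c"]
    by (auto simp: lattice_paths_def)
  have "LQ1 n r = (\<Union>c<n. arrows_in n r (cyclic_path n r c))"
  proof (intro equalityI subsetI)
    fix a assume a: "a \<in> LQ1 n r"
    then obtain c where "c < n" "set a \<subseteq> set (cyclic_path n r c)"
      using LQ1_in_cyclic_path[OF _ assms] by blast
    then show "a \<in> (\<Union>c<n. arrows_in n r (cyclic_path n r c))"
      using a sub unfolding arrows_in_def by blast
  qed (auto simp: arrows_in_def)
  moreover have "arrows_in n r (cyclic_path n r c) \<inter> arrows_in n r (cyclic_path n r c') = {}"
    if "c < n" "c' < n" "c \<noteq> c'" for c c'
  proof -
    have "\<not> (a \<in> LQ1 n r \<and> sublist a (cyclic_path n r e) \<and> sublist a (cyclic_path n r e'))"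
      if "e < e'" "e' < n" for a e e'
      using arrow_in_unique_cyclic_path[of a n r e e'] sub[of a e] sub[of a e'] that assms by auto
    note disjoint = this
    from that(3) consider "c < c'" | "c' < c" by linarith
    then show ?thesis
      using disjoint[of c c'] disjoint[of c' c] that(1,2) unfolding arrows_in_def by cases blast+
  qed
  ultimately show ?thesis
    unfolding arrow_prod_def by (simp add: prod.UNION_disjoint finite_arrows_in)
qed

lemma prod_cyclic_intervals:
  fixes zeta :: "nat \<Rightarrow> complex"
  assumes "r < n"
  shows "(\<Prod>c<n. \<Prod>i\<in>cyclic_interval n r c. zeta i) = (\<Prod>i\<in>{1..n}. zeta i) ^ r"
proof -
  have "(\<Prod>c<n. \<Prod>i\<in>cyclic_interval n r c. zeta i) =
    (\<Prod>c<n. \<Prod>i | i \<in> {1..n} \<and> i \<in> cyclic_interval n r c. zeta i)"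
    by (intro prod.cong refl) (auto simp: cyclic_interval_def)
  also have "\<dots> = (\<Prod>i\<in>{1..n}. \<Prod>c | c \<in> {..<n} \<and> i \<in> cyclic_interval n r c. zeta i)"
    by (rule prod.swap_restrict) auto
  also have "\<dots> = (\<Prod>i\<in>{1..n}. zeta i ^ r)"
    using card_cyclic_intervals_containing[OF _ assms] by (intro prod.cong refl) auto
  finally show ?thesis by (simp add: prod_power_distrib)
qed

section \<open>Maximal minors\<close>

lemma card_less_pick: "l < card I \<Longrightarrow> card {i \<in> I. i < pick I l} = l"
  by (simp add: card_pick_le)

lemma bij_betw_pick:
  assumes "finite I"
  shows "bij_betw (pick I) {..<card I} I"
  unfolding bij_betw_def
proof
  show inj: "inj_on (pick I) {..<card I}"
    by (rule inj_onI) (metis card_less_pick lessThan_iff)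
  show "pick I ` {..<card I} = I"
    using inj assms by (intro card_subset_eq) (auto simp: pick_in_set_le card_image)
qed

lemma pick_Suc_shift:
  assumes "0 \<notin> I" "l < card I"
  shows "pick {j. Suc j \<in> I} l = pick I l - 1"
proof -
  have s: "pick I l \<in> I" using assms(2) by (rule pick_in_set_le)
  then obtain s where s': "pick I l = Suc s" using assms(1) by (cases "pick I l") auto
  have "{i \<in> I. i < Suc s} = Suc ` {a \<in> {j. Suc j \<in> I}. a < s}"
  proof (intro equalityI subsetI)
    fix i assume "i \<in> {i \<in> I. i < Suc s}"
    then show "i \<in> Suc ` {a \<in> {j. Suc j \<in> I}. a < s}" using assms(1) by (cases i) auto
  qed auto
  then have "card {a \<in> {j. Suc j \<in> I}. a < s} = l"
    using card_less_pick[OF assms(2)] unfolding s' by (simp add: card_image)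
  then show ?thesis using pick_card_in_set[of s "{j. Suc j \<in> I}"] s s' by simp
qed

text \<open>Deleting the element in position \<open>p\<close> shifts the enumeration from \<open>p\<close> on by one.\<close>

lemma pick_delete:
  assumes I: "finite I" "j \<in> I" and m: "m < card I - 1"
  defines "p \<equiv> card {i \<in> I. i < j}"
  shows "pick (I - {j}) m = pick I (insert_index p m)"
proof -
  define m' where "m' = (if m < p then m else Suc m)"
  define s where "s = pick I m'"
  have m': "m' < card I" using m by (auto simp: m'_def)
  have s: "s \<in> I" "card {i \<in> I. i < s} = m'"
    using pick_in_set_le[OF m'] card_less_pick[OF m'] by (auto simp: s_def)
  have "m' \<noteq> p" by (auto simp: m'_def)
  then have "s \<noteq> j" using s(2) by (auto simp: p_def)
  have mono: "card {i \<in> I. i < a} < card {i \<in> I. i < b}" if "a < b" "a \<in> I" for a b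
    using that I(1) by (intro psubset_card_mono) auto
  have "card {i \<in> I - {j}. i < s} = m"
  proof (cases "s < j")
    case True
    then have "m' < p" using mono[of s j] s by (simp add: p_def)
    moreover have "{i \<in> I - {j}. i < s} = {i \<in> I. i < s}" using True by auto
    ultimately show ?thesis using s(2) by (auto simp: m'_def split: if_splits)
  next
    case False
    then have "j < s" using \<open>s \<noteq> j\<close> by simp
    then have "p < m'" using mono[of j s] s I(2) by (simp add: p_def)
    moreover have "{i \<in> I - {j}. i < s} = {i \<in> I. i < s} - {j}" by auto
    moreover have "j \<in> {i \<in> I. i < s}" using \<open>j < s\<close> I(2) by simp
    ultimately show ?thesis using s(2) by (auto simp: m'_def split: if_splits)
  qed
  then show ?thesis
    using pick_card_in_set[of s "I - {j}"] s \<open>s \<noteq> j\<close> unfolding s_def m'_def insert_index_def by simp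
qed

lemma mat_delete_mat:
  assumes "i < Suc a" "j < Suc b"
  shows "mat_delete (mat (Suc a) (Suc b) f) i j =
    mat a b (\<lambda>(i', j'). f (insert_index i i', insert_index j j'))"
  using assms by (intro eq_matI) (auto simp: mat_delete_def insert_index_def)

lemma mat_cong:
  assumes "\<And>i j. i < a \<Longrightarrow> j < b \<Longrightarrow> f (i, j) = g (i, j)"
  shows "mat a b f = mat a b g"
  using assms by (intro eq_matI) auto

text \<open>The minor of the columns in \<open>I\<close>, where columns are numbered from \<open>1\<close>.\<close>

definition minor :: "complex mat \<Rightarrow> nat set \<Rightarrow> complex" where
  "minor M I = det (submatrix M UNIV {j. Suc j \<in> I})"

lemma card_columns:
  assumes "I \<subseteq> {1..n}"
  shows "card {j. j < n \<and> Suc j \<in> I} = card I"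
proof -
  have "I = Suc ` {j. j < n \<and> Suc j \<in> I}"
  proof (intro equalityI subsetI)
    fix i assume "i \<in> I"
    then show "i \<in> Suc ` {j. j < n \<and> Suc j \<in> I}" using assms by (cases i) auto
  qed auto
  then show ?thesis by (metis card_image inj_Suc inj_on_subset subset_UNIV)
qed

lemma minor_eq_det:
  assumes "M \<in> carrier_mat r n" "I \<subseteq> {1..n}" "card I = r"
  shows "minor M I = det (mat r r (\<lambda>(i, l). M $$ (i, pick I l - 1)))"
proof -
  have "0 \<notin> I" using assms(2) by auto
  then show ?thesis
    using assms card_columns[OF assms(2)] unfolding minor_def submatrix_def
    by (intro arg_cong[of _ _ det] eq_matI) (auto simp: pick_UNIV pick_Suc_shift)
qed

text \<open>Expand along the column \<open>j\<close>. The sign in front moves this column to the last place, after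
  which the cofactors depend on \<open>I\<close> only. For \<open>j\<close> in \<open>I\<close> the same sum is the determinant of a matrix in
  which the column \<open>j\<close> occurs twice.\<close>

lemma minor_insert_laplace:
  fixes M :: "complex mat"
  assumes M: "M \<in> carrier_mat r n" and I: "I \<subseteq> {1..n}" "card I = r - 1" "0 < r"
  obtains C where
    "\<And>j. j \<in> {1..n} - I \<Longrightarrow>
      (- 1) ^ card {i \<in> I. j < i} * minor M (insert j I) = (\<Sum>i<r. M $$ (i, j - 1) * C i)"
    "\<And>j. j \<in> I \<Longrightarrow> (\<Sum>i<r. M $$ (i, j - 1) * C i) = 0"
proof -
  \<comment> \<open>The minors of the columns in \<open>I\<close> with row \<open>i\<close> deleted; \<open>C\<close> are the cofactors of a last column.\<close>
  define D where "D i = det (mat (r - 1) (r - 1)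
    (\<lambda>(i', l). M $$ (insert_index i i', pick I l - 1)))" for i
  define C where "C i = (- 1) ^ (r - 1) * ((- 1) ^ i * D i)" for i
  have fin: "finite I" using I(1) finite_subset by blast
  show thesis
  proof (rule that[of C])
    fix j assume j: "j \<in> {1..n} - I"
    let ?J = "insert j I"
    define p where "p = card {i \<in> ?J. i < j}"
    have p: "p = card {i \<in> I. i < j}" unfolding p_def by (rule arg_cong[of _ _ card]) auto
    have J: "?J \<subseteq> {1..n}" "card ?J = r" "finite ?J" using j I fin by auto
    have r1: "r - 1 = p + card {i \<in> I. j < i}"
    proof -
      have "card I = card ({i \<in> I. i < j} \<union> {i \<in> I. j < i})"
        using j by (intro arg_cong[of _ _ card]) (auto simp: not_less le_less)
      also have "\<dots> = card {i \<in> I. i < j} + card {i \<in> I. j < i}"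
        using fin by (intro card_Un_disjoint) auto
      finally have "card I = card {i \<in> I. i < j} + card {i \<in> I. j < i}" .
      then show ?thesis using I p by simp
    qed
    then have pr: "p < r" using I(3) by simp
    define A where "A = mat r r (\<lambda>(i, l). M $$ (i, pick ?J l - 1))"
    have A: "A \<in> carrier_mat r r" by (simp add: A_def)
    have "pick ?J p = j" unfolding p_def by (rule pick_card_in_set) simp
    then have entry: "A $$ (i, p) = M $$ (i, j - 1)" if "i < r" for i
      using that pr by (simp add: A_def)
    obtain r' where r': "r = Suc r'" using I(3) by (cases r) auto
    have "mat_delete A i p = mat (r - 1) (r - 1)
        (\<lambda>(i', l). M $$ (insert_index i i', pick I l - 1))" if "i < r" for i
    proof -
      have "pick I l = pick ?J (insert_index p l)" if "l < r'" for l
        using pick_delete[of ?J j l] J j that r' unfolding p_def[symmetric] by simp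
      then show ?thesis
        using that pr unfolding A_def r' by (simp only: mat_delete_mat) (auto intro!: mat_cong)
    qed
    then have cof: "cofactor A i p = (- 1) ^ (i + p) * D i" if "i < r" for i
      using that by (simp add: cofactor_def D_def)
    have "minor M ?J = (\<Sum>i<r. A $$ (i, p) * cofactor A i p)"
      using minor_eq_det[OF M J(1,2)] laplace_expansion_column[OF A pr] by (simp add: A_def)
    also have "\<dots> = (- 1) ^ p * (\<Sum>i<r. M $$ (i, j - 1) * ((- 1) ^ i * D i))"
      by (simp add: entry cof sum_distrib_left power_add mult_ac)
    finally show "(- 1) ^ card {i \<in> I. j < i} * minor M ?J = (\<Sum>i<r. M $$ (i, j - 1) * C i)"
      unfolding C_def r1 power_add by (simp add: sum_distrib_left mult_ac)
  next
    fix j assume j: "j \<in> I"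
    define A where "A = mat r r (\<lambda>(i, l). M $$ (i, if l = 0 then j - 1 else pick I (l - 1) - 1))"
    have A: "A \<in> carrier_mat r r" by (simp add: A_def)
    define q where "q = card {i \<in> I. i < j}"
    have "{i \<in> I. i < j} \<subset> I" using j by auto
    then have q: "q < r - 1" using fin I(2) unfolding q_def by (metis psubset_card_mono)
    have "pick I q = j" unfolding q_def using j by (rule pick_card_in_set)
    then have "col A 0 = col A (Suc q)"
      using q I(3) by (intro eq_vecI) (auto simp: A_def)
    then have "det A = 0" using det_identical_columns[OF A, of 0 "Suc q"] q by simp
    moreover have cof: "cofactor A i 0 = (- 1) ^ i * D i" if "i < r" for i
    proof -
      obtain r' where r': "r = Suc r'" using I(3) by (cases r) auto
      have "mat_delete A i 0 = mat (r - 1) (r - 1)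
          (\<lambda>(i', l). M $$ (insert_index i i', pick I l - 1))"
        using that unfolding A_def r'
        by (simp only: mat_delete_mat) (auto intro!: mat_cong simp: insert_index_def)
      then show ?thesis by (simp add: cofactor_def D_def)
    qed
    have "det A = (\<Sum>i<r. M $$ (i, j - 1) * ((- 1) ^ i * D i))"
    proof -
      have "det A = (\<Sum>i<r. A $$ (i, 0) * cofactor A i 0)" by (rule laplace_expansion_column[OF A I(3)])
      also have "\<dots> = (\<Sum>i<r. M $$ (i, j - 1) * ((- 1) ^ i * D i))"
        using I(3) by (intro sum.cong refl) (simp add: cof, simp add: A_def)
      finally show ?thesis .
    qed
    ultimately have "(- 1) ^ (r - 1) * (\<Sum>i<r. M $$ (i, j - 1) * ((- 1) ^ i * D i)) = 0" by simp
    then show "(\<Sum>i<r. M $$ (i, j - 1) * C i) = 0"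
      by (simp add: C_def sum_distrib_left mult_ac)
  qed
qed

text \<open>Cramer's rule for the columns in \<open>J\<close>: the sum is the expansion, along its first row, of the
  determinant in which row \<open>i\<close> is put on top of the matrix, and this determinant has two equal rows.\<close>

lemma minor_delete_dependency:
  fixes M :: "complex mat"
  assumes M: "M \<in> carrier_mat r n" and J: "J \<subseteq> {1..n}" "card J = r + 1" and i: "i < r"
  shows "(\<Sum>j\<in>J. (- 1) ^ card {a \<in> J. a < j} * M $$ (i, j - 1) * minor M (J - {j})) = 0"
proof -
  have fin: "finite J" using J(1) finite_subset by blast
  define A where "A = mat (Suc r) (Suc r)
    (\<lambda>(i', l). M $$ (if i' = 0 then i else i' - 1, pick J l - 1))"
  have A: "A \<in> carrier_mat (Suc r) (Suc r)" by (simp add: A_def)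
  have "row A 0 = row A (Suc i)" using i by (intro eq_vecI) (auto simp: A_def)
  then have "det A = 0" using det_identical_rows[OF A, of 0 "Suc i"] i by simp
  have cof: "cofactor A 0 l = (- 1) ^ l * minor M (J - {pick J l})" if l: "l < Suc r" for l
  proof -
    have lJ: "l < card J" using l J by simp
    have mem: "pick J l \<in> J" using pick_in_set_le[OF lJ] .
    have pos: "card {i \<in> J. i < pick J l} = l" using card_less_pick[OF lJ] .
    have sub: "J - {pick J l} \<subseteq> {1..n}" "card (J - {pick J l}) = r"
      using J mem fin by auto
    have "pick (J - {pick J l}) m = pick J (insert_index l m)" if "m < r" for m
      using pick_delete[OF fin mem, of m] J that unfolding pos by simp
    then have "mat_delete A 0 l = mat r r (\<lambda>(i, m). M $$ (i, pick (J - {pick J l}) m - 1))"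
      using l unfolding A_def
      by (simp only: mat_delete_mat zero_less_Suc) (auto intro!: mat_cong simp: insert_index_def)
    then show ?thesis using minor_eq_det[OF M sub] by (simp add: cofactor_def)
  qed
  have "(\<Sum>j\<in>J. (- 1) ^ card {a \<in> J. a < j} * M $$ (i, j - 1) * minor M (J - {j})) =
    (\<Sum>l<Suc r. (- 1) ^ l * M $$ (i, pick J l - 1) * minor M (J - {pick J l}))"
  proof -
    have "bij_betw (pick J) {..<Suc r} J" using bij_betw_pick[OF fin] J(2) by simp
    then have "(\<Sum>j\<in>J. (- 1) ^ card {a \<in> J. a < j} * M $$ (i, j - 1) * minor M (J - {j})) =
      (\<Sum>l<Suc r. (- 1) ^ card {a \<in> J. a < pick J l} * M $$ (i, pick J l - 1) *
        minor M (J - {pick J l}))"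
      by (rule sum.reindex_bij_betw[symmetric])
    also have "\<dots> = (\<Sum>l<Suc r. (- 1) ^ l * M $$ (i, pick J l - 1) * minor M (J - {pick J l}))"
    proof (rule sum.cong[OF refl])
      fix l assume "l \<in> {..<Suc r}"
      then have "l < card J" using J(2) by simp
      then show "(- 1) ^ card {a \<in> J. a < pick J l} * M $$ (i, pick J l - 1) *
          minor M (J - {pick J l}) = (- 1) ^ l * M $$ (i, pick J l - 1) * minor M (J - {pick J l})"
        by (simp only: card_less_pick)
    qed
    finally show ?thesis .
  qed
  also have "\<dots> = (\<Sum>l<Suc r. A $$ (0, l) * cofactor A 0 l)"
    by (intro sum.cong refl) (simp add: cof, simp add: A_def)
  also have "\<dots> = det A" using laplace_expansion_row[OF A, of 0] by simp
  finally show ?thesis using \<open>det A = 0\<close> by simp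
qed

text \<open>Up to signs, the minors of the sets \<open>insert j I\<close> form a vector in the row space and those of the
  sets \<open>J - {j}\<close> are the coefficients of a linear relation between the columns. The sum pairs the two.\<close>

lemma plucker_relation_minors:
  fixes M :: "complex mat"
  assumes M: "M \<in> carrier_mat r n" and r: "0 < r"
    and I: "I \<subseteq> {1..n}" "card I = r - 1" and J: "J \<subseteq> {1..n}" "card J = r + 1"
  shows "(\<Sum>j\<in>J - I. (- 1) ^ card {i \<in> I. j < i} * (- 1) ^ card {i \<in> J. i < j} *
    minor M (insert j I) * minor M (J - {j})) = 0"
proof -
  obtain C where C: "\<And>j. j \<in> {1..n} - I \<Longrightarrow>
      (- 1) ^ card {i \<in> I. j < i} * minor M (insert j I) = (\<Sum>i<r. M $$ (i, j - 1) * C i)"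
    "\<And>j. j \<in> I \<Longrightarrow> (\<Sum>i<r. M $$ (i, j - 1) * C i) = 0"
    using minor_insert_laplace[OF M I r] by blast
  have fin: "finite J" using J(1) finite_subset by blast
  let ?s = "\<lambda>j. (- 1) ^ card {i \<in> J. i < j} * minor M (J - {j})"
  have "(\<Sum>j\<in>J - I. (- 1) ^ card {i \<in> I. j < i} * (- 1) ^ card {i \<in> J. i < j} *
      minor M (insert j I) * minor M (J - {j})) = (\<Sum>j\<in>J - I. (\<Sum>i<r. M $$ (i, j - 1) * C i) * ?s j)"
    using C(1) J(1) by (intro sum.cong refl) (auto simp flip: C(1) simp: mult_ac)
  also have "\<dots> = (\<Sum>j\<in>J. (\<Sum>i<r. M $$ (i, j - 1) * C i) * ?s j)"
    using C(2) fin by (intro sum.mono_neutral_left) auto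
  also have "\<dots> = (\<Sum>j\<in>J. \<Sum>i<r. C i *
      ((- 1) ^ card {a \<in> J. a < j} * M $$ (i, j - 1) * minor M (J - {j})))"
    by (simp add: sum_distrib_left sum_distrib_right mult_ac)
  also have "\<dots> = (\<Sum>i<r. C i *
      (\<Sum>j\<in>J. (- 1) ^ card {a \<in> J. a < j} * M $$ (i, j - 1) * minor M (J - {j})))"
    by (subst sum.swap) (simp add: sum_distrib_left)
  also have "\<dots> = 0"
    by (intro sum.neutral ballI) (simp only: minor_delete_dependency[OF M J] lessThan_iff mult_zero_right)
  finally show ?thesis .
qed

definition scale_columns :: "nat \<Rightarrow> nat \<Rightarrow> (nat \<Rightarrow> complex) \<Rightarrow> complex mat \<Rightarrow> complex mat" where
  "scale_columns r n zeta M = mat r n (\<lambda>(i, j). zeta (Suc j) * M $$ (i, j))"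

lemma scale_columns_carrier: "scale_columns r n zeta M \<in> carrier_mat r n"
  by (simp add: scale_columns_def)

text \<open>Every term of the Leibniz expansion takes one entry from each column.\<close>

lemma minor_scale_columns:
  assumes M: "M \<in> carrier_mat r n" and I: "I \<subseteq> {1..n}" "card I = r"
  shows "minor (scale_columns r n zeta M) I = (\<Prod>i\<in>I. zeta i) * minor M I"
proof -
  have fin: "finite I" using I(1) finite_subset by blast
  have mem: "pick I l \<in> {1..n}" if "l < r" for l using pick_in_set_le[of l I] I that by auto
  let ?A = "mat r r (\<lambda>(i, l). M $$ (i, pick I l - 1))"
  let ?B = "mat r r (\<lambda>(i, l). scale_columns r n zeta M $$ (i, pick I l - 1))"
  have "(\<Prod>i=0..<r. ?B $$ (i, p i)) = (\<Prod>i\<in>I. zeta i) * (\<Prod>i=0..<r. ?A $$ (i, p i))"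
    if p: "p permutes {0..<r}" for p
  proof -
    have pr: "p i < r" if "i < r" for i using permutes_in_image[OF p, of i] that by simp
    have "(\<Prod>i=0..<r. ?B $$ (i, p i)) = (\<Prod>i=0..<r. zeta (pick I (p i)) * ?A $$ (i, p i))"
    proof (intro prod.cong refl)
      fix i assume "i \<in> {0..<r}"
      then have "i < r" "p i < r" "pick I (p i) \<in> {1..n}" using pr mem by auto
      then show "?B $$ (i, p i) = zeta (pick I (p i)) * ?A $$ (i, p i)"
        by (auto simp: scale_columns_def)
    qed
    also have "\<dots> = (\<Prod>i=0..<r. zeta (pick I (p i))) * (\<Prod>i=0..<r. ?A $$ (i, p i))"
      by (rule prod.distrib)
    also have "(\<Prod>i=0..<r. zeta (pick I (p i))) = (\<Prod>i=0..<r. zeta (pick I i))"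
      using prod.permute[OF p, of "\<lambda>i. zeta (pick I i)"] by (simp add: comp_def)
    also have "\<dots> = (\<Prod>i\<in>I. zeta i)"
      using prod.reindex_bij_betw[OF bij_betw_pick[OF fin], of zeta] I(2) by (simp add: lessThan_atLeast0)
    finally show ?thesis .
  qed
  then have "det ?B = (\<Prod>i\<in>I. zeta i) * det ?A"
    by (subst (1 2) det_def'[of _ r]) (auto simp: sum_distrib_left mult_ac intro!: sum.cong)
  then show ?thesis
    using minor_eq_det[OF M I] minor_eq_det[OF scale_columns_carrier I] by simp
qed

text \<open>Scaling the columns by nonzero factors does not change their span.\<close>

lemma rank_scale_columns:
  assumes M: "M \<in> carrier_mat r n" and nz: "\<And>i. i \<in> {1..n} \<Longrightarrow> zeta i \<noteq> 0"
  shows "vec_space.rank r (scale_columns r n zeta M) = vec_space.rank r M"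
proof -
  interpret vec_space "TYPE(complex)" r .
  have sub: "span (set (cols (scale_columns r n xi N))) \<subseteq> span (set (cols N))"
    if N: "N \<in> carrier_mat r n" for xi N
  proof -
    have carr: "set (cols N) \<subseteq> carrier_vec r" using N cols_dim by blast
    have "set (cols (scale_columns r n xi N)) \<subseteq> span (set (cols N))"
    proof
      fix v assume "v \<in> set (cols (scale_columns r n xi N))"
      then obtain j where j: "j < n" "v = col (scale_columns r n xi N) j"
        by (auto simp: cols_def scale_columns_def)
      then have "v = xi (Suc j) \<cdot>\<^sub>v col N j"
        using N by (intro eq_vecI) (auto simp: scale_columns_def)
      moreover have "col N j \<in> set (cols N)" using j(1) N by (auto simp: cols_def)
      ultimately show "v \<in> span (set (cols N))"
        using smult_in_span[OF carr] span_mem[OF carr] by simp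
    qed
    then show ?thesis by (rule span_subsetI[OF carr])
  qed
  have "scale_columns r n (\<lambda>i. inverse (zeta i)) (scale_columns r n zeta M) = M"
    using M nz by (intro eq_matI) (auto simp: scale_columns_def)
  then have "span (set (cols (scale_columns r n zeta M))) = span (set (cols M))"
    using sub[OF M, of zeta]
      sub[OF scale_columns_carrier[of r n zeta M], of "\<lambda>i. inverse (zeta i)"] by auto
  then show ?thesis by (simp add: rank_def)
qed

lemma rank_le_nrows:
  assumes "M \<in> carrier_mat r n"
  shows "vec_space.rank r (M :: complex mat) \<le> r"
proof -
  interpret vec_space "TYPE(complex)" r .
  have carr: "set (cols M) \<subseteq> carrier_vec r" using assms cols_dim by blast
  obtain S where S: "maximal S (\<lambda>T. T \<subseteq> set (cols M) \<and> lin_indpt T)"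
    using maximal_exists_superset[of "set (cols M)" "\<lambda>T. T \<subseteq> set (cols M) \<and> lin_indpt T" "{}"]
      finite_lin_indpt2 by (auto simp: lin_dep_def)
  then have "S \<subseteq> set (cols M)" "lin_indpt S" by (auto simp: maximal_def)
  then have "card S \<le> r" using li_le_dim(2) carr fin_dim dim_is_n by force
  then show ?thesis using rank_card_indpt[OF assms S] by simp
qed

lemma rank_eq_nrows_if_minor:
  assumes M: "M \<in> carrier_mat r n" and I: "I \<subseteq> {1..n}" "card I = r" and "minor M I \<noteq> 0"
  shows "vec_space.rank r M = r"
proof -
  have "r \<le> vec_space.rank r M"
    using vec_space.rank_gt_minor[OF M assms(4)[unfolded minor_def]] card_columns[OF I(1)] I(2) by simp
  then show ?thesis using rank_le_nrows[OF M] by simp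
qed

text \<open>The column \<open>j\<close>, counted from \<open>1\<close>, is the unit vector with index \<open>f j\<close>, or zero if \<open>f j\<close> is not below \<open>r\<close>.\<close>

definition unit_columns :: "nat \<Rightarrow> nat \<Rightarrow> (nat \<Rightarrow> nat) \<Rightarrow> complex mat" where
  "unit_columns r n f = mat r n (\<lambda>(i, j). if f (Suc j) = i then 1 else 0)"

text \<open>The selected columns are orthonormal, so the square of the minor is \<open>1\<close>.\<close>

lemma minor_unit_columns_nonzero:
  assumes I: "I \<subseteq> {1..n}" "card I = r" and bij: "bij_betw f I {..<r}"
  shows "minor (unit_columns r n f) I \<noteq> 0"
proof -
  have fin: "finite I" using I(1) finite_subset by blast
  have mem: "pick I l \<in> I" if "l < r" for l using pick_in_set_le[of l I] I(2) that by simp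
  define A :: "complex mat" where "A = mat r r (\<lambda>(i, l). if f (pick I l) = i then 1 else 0)"
  have A: "A \<in> carrier_mat r r" by (simp add: A_def)
  have "minor (unit_columns r n f) I = det A"
  proof -
    have "mat r r (\<lambda>(i, l). unit_columns r n f $$ (i, pick I l - 1)) = A"
    proof (rule eq_matI)
      fix i l assume "i < dim_row A" "l < dim_col A"
      then have "i < r" "l < r" "pick I l \<in> {1..n}" using mem[of l] I(1) by (auto simp: A_def)
      then show "mat r r (\<lambda>(i, l). unit_columns r n f $$ (i, pick I l - 1)) $$ (i, l) = A $$ (i, l)"
        by (auto simp: A_def unit_columns_def)
    qed (auto simp: A_def)
    then show ?thesis using minor_eq_det[of "unit_columns r n f" r n I] I by (simp add: unit_columns_def)
  qed
  moreover have "transpose_mat A * A = 1\<^sub>m r"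
  proof (rule eq_matI)
    fix l m assume "l < dim_row (1\<^sub>m r)" "m < dim_col (1\<^sub>m r)"
    then have lm: "l < r" "m < r" by auto
    have "(transpose_mat A * A) $$ (l, m) =
      (\<Sum>i=0..<r. (if f (pick I l) = i then 1 else 0) * (if f (pick I m) = i then 1 else 0))"
      using lm by (simp add: A_def scalar_prod_def)
    also have "\<dots> = (if f (pick I m) = f (pick I l) then 1 else 0)"
    proof -
      have "f (pick I l) < r" using bij mem[OF lm(1)] by (auto simp: bij_betw_def)
      then show ?thesis by (simp add: if_distrib[of "\<lambda>x. x * _"] sum.delta' cong: if_cong)
    qed
    also have "\<dots> = (if l = m then 1 else 0)"
    proof -
      have "f (pick I m) = f (pick I l) \<longleftrightarrow> pick I m = pick I l"
        using bij mem lm by (metis bij_betw_def inj_on_eq_iff)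
      also have "\<dots> \<longleftrightarrow> l = m"
        using bij_betw_pick[OF fin] lm I(2) by (auto simp: bij_betw_def inj_on_def)
      finally show ?thesis by simp
    qed
    finally show "(transpose_mat A * A) $$ (l, m) = 1\<^sub>m r $$ (l, m)" using lm by simp
  qed (auto simp: A_def)
  then have "det (transpose_mat A) * det A = 1"
    using det_mult[of "transpose_mat A" r A] A by simp
  ultimately show ?thesis by auto
qed

lemma minor_unit_columns_zero:
  assumes I: "I \<subseteq> {1..n}" "card I = r" and ab: "a \<in> I" "b \<in> I" "a \<noteq> b" "f a = f b"
  shows "minor (unit_columns r n f) I = 0"
proof -
  have fin: "finite I" using I(1) finite_subset by blast
  define A :: "complex mat" where "A = mat r r (\<lambda>(i, l). unit_columns r n f $$ (i, pick I l - 1))"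
  have A: "A \<in> carrier_mat r r" by (simp add: A_def)
  have "a \<in> pick I ` {..<r}" "b \<in> pick I ` {..<r}"
    using bij_betw_pick[OF fin] ab I(2) by (auto simp: bij_betw_def)
  then obtain l m where lm: "l < r" "m < r" "pick I l = a" "pick I m = b" by auto
  then have "a \<in> {1..n}" "b \<in> {1..n}" using ab I by auto
  then have "col A l = col A m"
    using lm ab by (intro eq_vecI) (auto simp: A_def unit_columns_def)
  moreover have "l \<noteq> m" using lm ab by auto
  ultimately have "det A = 0" using det_identical_columns[OF A] lm by blast
  then show ?thesis
    using minor_eq_det[of "unit_columns r n f" r n I] I by (simp add: A_def unit_columns_def)
qed

section \<open>Diagonal matrices that respect the exchange relations\<close>

definition r_subsets :: "nat \<Rightarrow> nat \<Rightarrow> nat set set" where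
  "r_subsets n r = {I. I \<subseteq> {1..n} \<and> card I = r}"

lemma r_subsets_finite: "I \<in> r_subsets n r \<Longrightarrow> finite I"
  using finite_subset[of I "{1..n}"] by (simp add: r_subsets_def)

lemma insert_r_subsets:
  "S \<in> r_subsets n m \<Longrightarrow> i \<in> {1..n} - S \<Longrightarrow> insert i S \<in> r_subsets n (Suc m)"
  using r_subsets_finite[of S n m] by (simp add: r_subsets_def)

lemma delete_r_subsets:
  "I \<in> r_subsets n (Suc m) \<Longrightarrow> i \<in> I \<Longrightarrow> I - {i} \<in> r_subsets n m"
  using r_subsets_finite[of I n "Suc m"] by (auto simp: r_subsets_def)

text \<open>Every \<open>r\<close>-subset is joined to \<open>J\<close> by a chain of exchanges of single elements.\<close>

lemma r_subsets_induct [consumes 2, case_names same exchange]: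
  assumes "I \<in> r_subsets n r" "J \<in> r_subsets n r"
    and same: "P J"
    and exchange: "\<And>I a b. I \<in> r_subsets n r \<Longrightarrow> a \<in> I - J \<Longrightarrow> b \<in> J - I \<Longrightarrow>
      insert b (I - {a}) \<in> r_subsets n r \<Longrightarrow> P (insert b (I - {a})) \<Longrightarrow> P I"
  shows "P I"
  using assms(1)
proof (induction "card (I - J)" arbitrary: I)
  case 0
  have "finite I" using 0(2) by (rule r_subsets_finite)
  then have "I \<subseteq> J" using 0(1) by simp
  moreover have "card I = card J" using 0(2) assms(2) by (simp add: r_subsets_def)
  ultimately have "I = J" using r_subsets_finite[OF assms(2)] by (simp add: card_subset_eq)
  then show ?case using same by simp
next
  case (Suc m)
  have fin: "finite I" "finite J" using Suc(3) assms(2) r_subsets_finite by auto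
  have "card I = card J" using Suc(3) assms(2) by (simp add: r_subsets_def)
  then have "card (J - I) = card (I - J)"
    using card_Diff_subset_Int[of I J] card_Diff_subset_Int[of J I] fin by (simp add: Int_commute)
  then obtain a b where ab: "a \<in> I - J" "b \<in> J - I"
    using Suc(2) by (metis card.empty ex_in_conv nat.distinct(1))
  have T: "insert b (I - {a}) \<in> r_subsets n r"
  proof -
    obtain r' where "r = Suc r'" using ab(1) fin(1) Suc(3) by (cases r) (auto simp: r_subsets_def)
    then show ?thesis
      using insert_r_subsets[OF delete_r_subsets[of I n r' a], of b] Suc(3) ab assms(2)
      by (auto simp: r_subsets_def)
  qed
  have "insert b (I - {a}) - J = (I - J) - {a}" using ab by auto
  then have "m = card (insert b (I - {a}) - J)" using Suc(2) ab(1) fin by simp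
  then show ?case using Suc(1)[OF _ T] exchange[OF Suc(3) ab T] by blast
qed

text \<open>For an entrywise nonzero \<open>d\<close> this is the statement that the ratio of \<open>d (insert i T)\<close> and
  \<open>d (insert j T)\<close> does not change when one element of \<open>T\<close> is replaced; here \<open>T\<close> changes from \<open>insert a S\<close> to
  \<open>insert b S\<close>.\<close>

definition exchange_property :: "nat \<Rightarrow> nat \<Rightarrow> (nat set \<Rightarrow> complex) \<Rightarrow> bool" where
  "exchange_property n r d \<longleftrightarrow> (\<forall>S a b i j. S \<subseteq> {1..n} \<and> card S + 2 = r \<and>
     {a, b, i, j} \<subseteq> {1..n} - S \<and> distinct [a, b, i, j] \<longrightarrow>
     d (insert i (insert a S)) * d (insert j (insert b S)) =
     d (insert j (insert a S)) * d (insert i (insert b S)))"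

text \<open>The entries of the diagonal matrix by which \<open>diag(\<zeta>\<^sub>1, \<dots>, \<zeta>\<^sub>n)\<close> acts on the \<open>r\<close>-th exterior
  power, up to a common factor.\<close>

definition monomial_on :: "nat \<Rightarrow> nat \<Rightarrow> (nat set \<Rightarrow> complex) \<Rightarrow> complex \<Rightarrow> (nat \<Rightarrow> complex) \<Rightarrow> bool" where
  "monomial_on n r d c zeta \<longleftrightarrow> c \<noteq> 0 \<and> (\<forall>i\<in>{1..n}. zeta i \<noteq> 0) \<and>
     (\<forall>I\<in>r_subsets n r. d I = c * (\<Prod>i\<in>I. zeta i))"

text \<open>Replacing the elements of \<open>S\<close> one at a time reaches \<open>S'\<close> without changing the ratio.\<close>

lemma exchange_ratio:
  assumes ex: "exchange_property n r d" and nz: "\<And>I. I \<in> r_subsets n r \<Longrightarrow> d I \<noteq> 0"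
    and r: "r = Suc r'" and ij: "i \<in> {1..n}" "j \<in> {1..n}" "i \<noteq> j"
    and S: "S \<in> r_subsets n r'" "S \<inter> {i, j} = {}" and S': "S' \<in> r_subsets n r'" "S' \<inter> {i, j} = {}"
  shows "d (insert i S) * d (insert j S') = d (insert j S) * d (insert i S')"
proof -
  have "S \<inter> {i, j} = {} \<longrightarrow> d (insert i S) * d (insert j S') = d (insert j S) * d (insert i S')"
    using S(1) S'(1)
  proof (induction rule: r_subsets_induct)
    case same
    then show ?case by simp
  next
    case (exchange S a b)
    show ?case
    proof
      assume disj: "S \<inter> {i, j} = {}"
      define U where "U = S - {a}"
      let ?T = "insert b U"
      have fin: "finite S" using exchange(1) by (rule r_subsets_finite)
      have U: "S = insert a U" "a \<notin> U" "b \<notin> U" "U \<subseteq> {1..n}" "card U + 2 = r"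
        using exchange(1,2,3) fin r card_Suc_Diff1[OF fin, of a] by (auto simp: U_def r_subsets_def)
      have b: "b \<in> {1..n}" "b \<noteq> i" "b \<noteq> j"
        using exchange(3) S' by (auto simp: r_subsets_def)
      have a: "a \<in> {1..n}" "a \<noteq> i" "a \<noteq> j" "a \<noteq> b"
        using exchange(1,2,3) disj by (auto simp: r_subsets_def)
      have T: "?T \<in> r_subsets n r'" "?T \<inter> {i, j} = {}"
        using exchange(4) disj b by (auto simp: U_def)
      have "{a, b, i, j} \<subseteq> {1..n} - U" "distinct [a, b, i, j]"
        using U(2,3) a b ij disj unfolding U_def by auto
      then have e: "d (insert i (insert a U)) * d (insert j ?T) = d (insert j (insert a U)) * d (insert i ?T)"
        using ex U(4,5) unfolding exchange_property_def by blast
      have IH: "d (insert i ?T) * d (insert j S') = d (insert j ?T) * d (insert i S')"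
        using exchange(5) T(2) unfolding U_def by simp
      have "d (insert i ?T) \<noteq> 0" "d (insert j ?T) \<noteq> 0"
        using nz insert_r_subsets[OF T(1), of i] insert_r_subsets[OF T(1), of j] T(2) ij r by auto
      moreover have "(d (insert i S) * d (insert j S')) * (d (insert i ?T) * d (insert j ?T)) =
          (d (insert j S) * d (insert i S')) * (d (insert i ?T) * d (insert j ?T))"
      proof -
        have "(d (insert i S) * d (insert j S')) * (d (insert i ?T) * d (insert j ?T)) =
            (d (insert i S) * d (insert j ?T)) * (d (insert i ?T) * d (insert j S'))"
          by (simp only: mult_ac)
        also have "\<dots> = (d (insert j S) * d (insert i ?T)) * (d (insert j ?T) * d (insert i S'))"
          using e IH unfolding U(1) by simp
        also have "\<dots> = (d (insert j S) * d (insert i S')) * (d (insert i ?T) * d (insert j ?T))"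
          by (simp only: mult_ac)
        finally show ?thesis .
      qed
      ultimately show "d (insert i S) * d (insert j S') = d (insert j S) * d (insert i S')" by simp
    qed
  qed
  then show ?thesis using S(2) by simp
qed

lemma r_subset_avoiding:
  assumes "finite B" "card B + m \<le> n" "B \<subseteq> {1..n}"
  shows "\<exists>S\<in>r_subsets n m. S \<inter> B = {}"
proof -
  have "m \<le> card ({1..n} - B)" using assms by (simp add: card_Diff_subset)
  then obtain S where "S \<subseteq> {1..n} - B" "card S = m" by (meson obtain_subset_with_card_n)
  then show ?thesis by (intro bexI[of _ S]) (auto simp: r_subsets_def)
qed

lemma r_subset_avoiding_two:
  assumes "i \<in> {1..n}" "j \<in> {1..n}" "m + 2 \<le> n"
  shows "\<exists>S\<in>r_subsets n m. S \<inter> {i, j} = {}"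
proof (rule r_subset_avoiding)
  have "card {i, j} \<le> 2" by (cases "i = j") simp_all
  then show "card {i, j} + m \<le> n" using assms(3) by linarith
qed (use assms in simp_all)

text \<open>Normalize \<open>\<zeta>\<^sub>1 = 1\<close> and let \<open>\<zeta>\<^sub>i\<close> be the ratio for the exchange of \<open>1\<close> and \<open>i\<close>. The ratio for
  \<open>i\<close> and \<open>j\<close> is then \<open>\<zeta>\<^sub>i / \<zeta>\<^sub>j\<close>: compare both sides with the set that contains \<open>1\<close> instead of \<open>i\<close> or \<open>j\<close>,
  or, if \<open>1\<close> is already present, with the set that contains \<open>i\<close> and \<open>j\<close> but not \<open>1\<close>. Hence an exchange
  of elements changes \<open>d\<^sub>I\<close> and \<open>\<Prod>\<^sub>i\<^sub>\<in>\<^sub>I \<zeta>\<^sub>i\<close> by the same factor.\<close>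

lemma exchange_imp_monomial:
  assumes r: "0 < r" "r < n" and ex: "exchange_property n r d"
    and nz: "\<And>I. I \<in> r_subsets n r \<Longrightarrow> d I \<noteq> 0"
  shows "\<exists>c zeta. monomial_on n r d c zeta"
proof -
  obtain r' where r': "r = Suc r'" using r by (cases r) auto
  have nz': "d (insert i S) \<noteq> 0" if "S \<in> r_subsets n r'" "i \<in> {1..n} - S" for i S
    using nz insert_r_subsets[OF that] r' by simp
  have one: "1 \<in> {1..n}" using r by simp
  \<comment> \<open>A reference set from which the ratio for \<open>i\<close> and \<open>1\<close> is read off.\<close>
  define ref where "ref i = (SOME S. S \<in> r_subsets n r' \<and> S \<inter> {i, 1} = {})" for i :: nat
  have ref: "ref i \<in> r_subsets n r' \<and> ref i \<inter> {i, 1} = {}" if "i \<in> {1..n}" for i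
  proof -
    have "\<exists>S. S \<in> r_subsets n r' \<and> S \<inter> {i, 1} = {}"
      using r_subset_avoiding_two[OF that one, of r'] r(2) r' by auto
    from someI_ex[OF this] show ?thesis unfolding ref_def .
  qed
  define zeta where "zeta i = (if i = 1 then 1 else d (insert i (ref i)) / d (insert 1 (ref i)))" for i
  have zeta_nz: "zeta i \<noteq> 0" if "i \<in> {1..n}" for i
  proof -
    have "d (insert i (ref i)) \<noteq> 0" "d (insert 1 (ref i)) \<noteq> 0"
      using ref[OF that] nz'[of "ref i"] one that by blast+
    then show ?thesis by (simp add: zeta_def)
  qed
  have ratio1: "d (insert i S) = zeta i * d (insert 1 S)"
    if "i \<in> {1..n}" "i \<noteq> 1" "S \<in> r_subsets n r'" "S \<inter> {i, 1} = {}" for i S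
  proof -
    have "d (insert i S) * d (insert 1 (ref i)) = d (insert 1 S) * d (insert i (ref i))"
      using exchange_ratio[OF ex nz r' that(1) one that(2-4)] ref[OF that(1)] by blast
    moreover have "d (insert 1 (ref i)) \<noteq> 0" using ref[OF that(1)] nz' one by blast
    ultimately show ?thesis using that(2) by (simp add: zeta_def field_simps)
  qed
  have ratio: "d (insert i S) * zeta j = d (insert j S) * zeta i"
    if i: "i \<in> {1..n}" and j: "j \<in> {1..n}" and S: "S \<in> r_subsets n r'" "S \<inter> {i, j} = {}" for i j S
  proof -
    consider "i = j" | "i \<noteq> j" "i = 1" | "i \<noteq> j" "j = 1" | "i \<noteq> j" "i \<noteq> 1" "j \<noteq> 1" "1 \<notin> S"
      | "i \<noteq> j" "i \<noteq> 1" "j \<noteq> 1" "1 \<in> S" by blast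
    then show ?thesis
    proof cases
      case 2
      then have "d (insert j S) = zeta j * d (insert 1 S)" using ratio1[OF j _ S(1)] S(2) by auto
      then show ?thesis using 2 by (simp add: zeta_def)
    next
      case 3
      then have "d (insert i S) = zeta i * d (insert 1 S)" using ratio1[OF i _ S(1)] S(2) by auto
      then show ?thesis using 3 by (simp add: zeta_def)
    next
      case 4
      then have "d (insert i S) = zeta i * d (insert 1 S)" "d (insert j S) = zeta j * d (insert 1 S)"
        using ratio1[OF i _ S(1)] ratio1[OF j _ S(1)] S(2) by auto
      then show ?thesis by (simp only: mult_ac)
    next
      case 5
      define U where "U = S - {1}"
      obtain r'' where r'': "r' = Suc r''"
        using S(1) 5 r_subsets_finite[OF S(1)] by (cases r') (auto simp: r_subsets_def)
      have U: "U \<in> r_subsets n r''" "S = insert 1 U" "1 \<notin> U"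
        using delete_r_subsets[of S n r'' 1] S(1) 5(4) r'' by (auto simp: U_def)
      have "insert j U \<in> r_subsets n r'" "insert i U \<in> r_subsets n r'"
        using insert_r_subsets[OF U(1)] i j S(2) r'' by (auto simp: U_def)
      have "d (insert i (insert j U)) = zeta i * d (insert 1 (insert j U))"
        "d (insert j (insert i U)) = zeta j * d (insert 1 (insert i U))"
        using ratio1[OF i 5(2) \<open>insert j U \<in> r_subsets n r'\<close>]
          ratio1[OF j 5(3) \<open>insert i U \<in> r_subsets n r'\<close>] 5 S(2) U(3) unfolding U_def by blast+
      moreover have "insert i (insert j U) = insert j (insert i U)" by (rule insert_commute)
      moreover have "insert 1 (insert j U) = insert j S" "insert 1 (insert i U) = insert i S"
        unfolding U(2) by (rule insert_commute)+
      ultimately have "zeta i * d (insert j S) = zeta j * d (insert i S)" by metis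
      then show ?thesis by (simp only: mult_ac)
    qed simp
  qed
  have indep: "d I * (\<Prod>i\<in>J. zeta i) = d J * (\<Prod>i\<in>I. zeta i)"
    if I: "I \<in> r_subsets n r" and J: "J \<in> r_subsets n r" for I J
    using I J
  proof (induction rule: r_subsets_induct)
    case same
    then show ?case by simp
  next
    case (exchange I a b)
    define S where "S = I - {a}"
    have S: "S \<in> r_subsets n r'" "I = insert a S" "a \<notin> S" "b \<notin> S" "finite S"
      using delete_r_subsets[of I n r' a] exchange(1-3) r' r_subsets_finite[OF exchange(1)]
      by (auto simp: S_def)
    have ab: "a \<in> {1..n}" "b \<in> {1..n}" using exchange(1-3) J by (auto simp: r_subsets_def)
    have "d (insert a S) * zeta b = d (insert b S) * zeta a" using ratio[OF ab S(1)] S by blast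
    have IH: "d (insert b S) * (\<Prod>i\<in>J. zeta i) = d J * (zeta b * (\<Prod>i\<in>S. zeta i))"
      using exchange(5) S unfolding S_def[symmetric] by simp
    have "zeta b * (d (insert a S) * (\<Prod>i\<in>J. zeta i)) = (d (insert a S) * zeta b) * (\<Prod>i\<in>J. zeta i)"
      by (simp only: mult_ac)
    also have "\<dots> = zeta a * (d (insert b S) * (\<Prod>i\<in>J. zeta i))"
      unfolding \<open>d (insert a S) * zeta b = d (insert b S) * zeta a\<close> by (simp only: mult_ac)
    also have "\<dots> = zeta b * (d J * (zeta a * (\<Prod>i\<in>S. zeta i)))"
      unfolding IH by (simp only: mult_ac)
    finally have "zeta b * (d (insert a S) * (\<Prod>i\<in>J. zeta i)) =
        zeta b * (d J * (zeta a * (\<Prod>i\<in>S. zeta i)))" .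
    then show ?case using zeta_nz[OF ab(2)] S by simp
  qed
  obtain J where J: "J \<in> r_subsets n r"
    using r_subset_avoiding[of "{}" r n] r by auto
  have prod_nz: "(\<Prod>i\<in>J. zeta i) \<noteq> 0"
    using zeta_nz J r_subsets_finite[OF J] by (auto simp: r_subsets_def prod_zero_iff)
  have "monomial_on n r d (d J / (\<Prod>i\<in>J. zeta i)) zeta"
    unfolding monomial_on_def
  proof (intro conjI ballI)
    fix I assume "I \<in> r_subsets n r"
    then have "d I * (\<Prod>i\<in>J. zeta i) = d J * (\<Prod>i\<in>I. zeta i)" using J by (rule indep)
    then show "d I = d J / (\<Prod>i\<in>J. zeta i) * (\<Prod>i\<in>I. zeta i)"
      using prod_nz by (simp add: eq_divide_eq)
  qed (use zeta_nz prod_nz nz[OF J] in simp_all)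
  then show ?thesis by blast
qed

section \<open>Pluecker relations under diagonal matrices\<close>

text \<open>The action of a diagonal matrix that is given by a function on subsets rather than on partitions.\<close>

definition diag_act :: "nat \<Rightarrow> nat \<Rightarrow> (nat set \<Rightarrow> complex) \<Rightarrow> (nat list \<Rightarrow> complex) \<Rightarrow> nat list \<Rightarrow> complex" where
  "diag_act n r d p = (\<lambda>lam\<in>partitions_in_box n r. d (vertical_steps n r lam) * p lam)"

lemma vertical_steps_r_subset:
  assumes "lam \<in> partitions_in_box n r" "r \<le> n"
  shows "vertical_steps n r lam \<in> r_subsets n r"
  using bij_betw_vertical_steps[OF assms(2)] assms(1) by (auto simp: bij_betw_def r_subsets_def)

lemma plucker_coord_eq:
  assumes "I \<in> r_subsets n r" "r \<le> n"
  obtains lam where "lam \<in> partitions_in_box n r" "vertical_steps n r lam = I"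
    "\<forall>p. plucker_coord n r p I = p lam"
proof -
  let ?lam = "the_inv_into (partitions_in_box n r) (vertical_steps n r) I"
  have *: "inj_on (vertical_steps n r) (partitions_in_box n r)"
    "I \<in> vertical_steps n r ` partitions_in_box n r"
    using bij_betw_vertical_steps[OF assms(2)] assms(1) by (auto simp: bij_betw_def r_subsets_def)
  show thesis
    using that[of ?lam] the_inv_into_into[OF * order_refl] f_the_inv_into_f[OF *]
    by (simp add: plucker_coord_def)
qed

lemma plucker_coord_family:
  assumes "I \<in> r_subsets n r" "r \<le> n"
  shows "plucker_coord n r (\<lambda>lam\<in>partitions_in_box n r. f (vertical_steps n r lam)) I = f I"
  using plucker_coord_eq[OF assms] by (metis (no_types, lifting) restrict_apply')

lemma plucker_coord_diag_act:
  assumes "I \<in> r_subsets n r" "r \<le> n"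
  shows "plucker_coord n r (diag_act n r d p) I = d I * plucker_coord n r p I"
proof -
  obtain lam where "lam \<in> partitions_in_box n r" "vertical_steps n r lam = I"
    "\<forall>p. plucker_coord n r p I = p lam" using plucker_coord_eq[OF assms] by blast
  then show ?thesis by (simp add: diag_act_def)
qed

lemma plucker_coord_plucker_vec:
  assumes "I \<in> r_subsets n r" "r \<le> n"
  shows "plucker_coord n r (plucker_vec n r M) I = minor M I"
proof -
  obtain lam where "lam \<in> partitions_in_box n r" "vertical_steps n r lam = I"
    "\<forall>p. plucker_coord n r p I = p lam" using plucker_coord_eq[OF assms] by blast
  then show ?thesis by (simp add: plucker_vec_def minor_def)
qed

lemma plucker_vec_nonzero:
  assumes "I \<in> r_subsets n r" "r \<le> n" "minor M I \<noteq> 0"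
  shows "plucker_vec n r M \<in> nonzero_vecs n r"
proof -
  obtain lam where lam: "lam \<in> partitions_in_box n r" "\<forall>p. plucker_coord n r p I = p lam"
    using plucker_coord_eq[OF assms(1,2)] by blast
  have "plucker_vec n r M lam \<noteq> 0"
    using plucker_coord_plucker_vec[OF assms(1,2)] assms(3) lam(2) by metis
  moreover have "plucker_vec n r M \<in> partitions_in_box n r \<rightarrow>\<^sub>E UNIV"
    by (auto simp: plucker_vec_def)
  ultimately show ?thesis using lam(1) by (auto simp: nonzero_vecs_def)
qed

lemma plucker_relation_summand_sets:
  assumes "I \<subseteq> {1..n}" "card I = r - 1" "J \<subseteq> {1..n}" "card J = r + 1" "0 < r" "j \<in> J - I"
  shows "insert j I \<in> r_subsets n r" "J - {j} \<in> r_subsets n r"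
proof -
  obtain r' where r': "r = Suc r'" using assms(5) by (cases r) auto
  show "insert j I \<in> r_subsets n r"
    using insert_r_subsets[of I n r' j] assms r' by (auto simp: r_subsets_def)
  show "J - {j} \<in> r_subsets n r"
    using delete_r_subsets[of J n r j] assms by (auto simp: r_subsets_def)
qed

lemma plucker_relation_plucker_vec:
  assumes "M \<in> carrier_mat r n" "0 < r" "r \<le> n"
    and IJ: "I \<subseteq> {1..n}" "card I = r - 1" "J \<subseteq> {1..n}" "card J = r + 1"
  shows "plucker_relation n r I J (plucker_vec n r M) = 0"
proof -
  have "plucker_relation n r I J (plucker_vec n r M) =
    (\<Sum>j\<in>J - I. (- 1) ^ card {i \<in> I. j < i} * (- 1) ^ card {i \<in> J. i < j} *
      minor M (insert j I) * minor M (J - {j}))"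
    unfolding plucker_relation_def
    using plucker_relation_summand_sets[OF IJ assms(2)] assms(3)
    by (intro sum.cong refl) (simp add: plucker_coord_plucker_vec)
  then show ?thesis using plucker_relation_minors[OF assms(1,2) IJ] by simp
qed

text \<open>In every term the two index sets together contain the elements of \<open>I\<close> and of \<open>J\<close>.\<close>

lemma plucker_relation_monomial:
  assumes "monomial_on n r d c zeta" "0 < r" "r \<le> n"
    and IJ: "I \<subseteq> {1..n}" "card I = r - 1" "J \<subseteq> {1..n}" "card J = r + 1"
  shows "plucker_relation n r I J (diag_act n r d p) =
    (c * c * (\<Prod>i\<in>I. zeta i) * (\<Prod>i\<in>J. zeta i)) * plucker_relation n r I J p"
  unfolding plucker_relation_def sum_distrib_left
proof (intro sum.cong refl)
  fix j assume j: "j \<in> J - I"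
  have fin: "finite I" "finite J" using IJ finite_subset by blast+
  note sets = plucker_relation_summand_sets[OF IJ assms(2) j]
  have "d (insert j I) * d (J - {j}) =
      c * c * (zeta j * (\<Prod>i\<in>I. zeta i)) * (\<Prod>i\<in>J - {j}. zeta i)"
    using assms(1) sets fin j unfolding monomial_on_def by simp
  also have "\<dots> = c * c * (\<Prod>i\<in>I. zeta i) * (\<Prod>i\<in>J. zeta i)"
    using prod.remove[OF fin(2), of j zeta] j by simp
  finally have *: "d (insert j I) * d (J - {j}) = c * c * (\<Prod>i\<in>I. zeta i) * (\<Prod>i\<in>J. zeta i)" .
  show "(- 1) ^ card {i \<in> I. j < i} * (- 1) ^ card {i \<in> J. i < j} *
      plucker_coord n r (diag_act n r d p) (insert j I) * plucker_coord n r (diag_act n r d p) (J - {j}) =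
    c * c * (\<Prod>i\<in>I. zeta i) * (\<Prod>i\<in>J. zeta i) *
      ((- 1) ^ card {i \<in> I. j < i} * (- 1) ^ card {i \<in> J. i < j} *
        plucker_coord n r p (insert j I) * plucker_coord n r p (J - {j}))"
    unfolding plucker_coord_diag_act[OF sets(1) assms(3)] plucker_coord_diag_act[OF sets(2) assms(3)]
      *[symmetric] by (simp add: mult_ac)
qed

text \<open>The relation of \<open>S \<union> {a}\<close> and \<open>S \<union> {b, i, j}\<close> has three terms, one for each of \<open>i\<close>, \<open>j\<close> and
  \<open>b\<close>, with coefficients that do not depend on the vector.\<close>

lemma three_term_relation:
  assumes S: "S \<subseteq> {1..n}" "card S + 2 = r" and T: "{a, b, i, j} \<subseteq> {1..n} - S" "distinct [a, b, i, j]"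
  defines "I \<equiv> insert a S" and "J \<equiv> insert i (insert j (insert b S))"
  obtains s1 s2 s3 :: complex where "s1 \<noteq> 0" "s2 \<noteq> 0"
    "\<forall>p. plucker_relation n r I J p =
      s1 * (plucker_coord n r p (insert i (insert a S)) * plucker_coord n r p (insert j (insert b S))) +
      s2 * (plucker_coord n r p (insert j (insert a S)) * plucker_coord n r p (insert i (insert b S))) +
      s3 * (plucker_coord n r p (insert b (insert a S)) * plucker_coord n r p (insert i (insert j S)))"
proof -
  define s :: "nat \<Rightarrow> complex" where
    "s l = (- 1) ^ card {i \<in> I. l < i} * (- 1) ^ card {i \<in> J. i < l}" for l
  have diff: "J - I = {i, j, b}" using T by (auto simp: I_def J_def)
  have sets: "J - {i} = insert j (insert b S)" "J - {j} = insert i (insert b S)"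
    "J - {b} = insert i (insert j S)"
    using T by (auto simp: J_def)
  have "plucker_relation n r I J p =
      s i * (plucker_coord n r p (insert i (insert a S)) * plucker_coord n r p (insert j (insert b S))) +
      s j * (plucker_coord n r p (insert j (insert a S)) * plucker_coord n r p (insert i (insert b S))) +
      s b * (plucker_coord n r p (insert b (insert a S)) * plucker_coord n r p (insert i (insert j S)))"
    for p
    unfolding plucker_relation_def diff using T(2)
    by (simp add: sets s_def[symmetric] mult.assoc) (simp add: I_def)
  moreover have "s i \<noteq> 0" "s j \<noteq> 0" by (simp_all add: s_def)
  ultimately show thesis using that[of "s i" "s j" "s b"] by blast
qed

lemma three_term_index_sets:
  assumes "S \<subseteq> {1..n}" "card S + 2 = r" "{a, b, i, j} \<subseteq> {1..n} - S" "distinct [a, b, i, j]"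
  shows "insert a S \<subseteq> {1..n}" "card (insert a S) = r - 1"
    "insert i (insert j (insert b S)) \<subseteq> {1..n}" "card (insert i (insert j (insert b S))) = r + 1"
    "x \<in> {a, b, i, j} \<Longrightarrow> y \<in> {a, b, i, j} \<Longrightarrow> x \<noteq> y \<Longrightarrow> insert x (insert y S) \<in> r_subsets n r"
proof -
  have fin: "finite S" using assms(1) finite_subset by blast
  have notin: "a \<notin> S" "b \<notin> S" "i \<notin> S" "j \<notin> S"
    and dist: "b \<noteq> i" "b \<noteq> j" "i \<noteq> j" using assms(3,4) by auto
  show "insert a S \<subseteq> {1..n}" "insert i (insert j (insert b S)) \<subseteq> {1..n}"
    using assms(1,3) by auto
  show "card (insert a S) = r - 1" "card (insert i (insert j (insert b S))) = r + 1"
    using assms(2) fin notin dist by simp_all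
  obtain s where s: "r = Suc (Suc s)" "S \<in> r_subsets n s" using assms(1,2) by (auto simp: r_subsets_def)
  assume xy: "x \<in> {a, b, i, j}" "y \<in> {a, b, i, j}" "x \<noteq> y"
  then have "x \<in> {1..n} - insert y S" "y \<in> {1..n} - S" using assms(3) by blast+
  then show "insert x (insert y S) \<in> r_subsets n r"
    unfolding s(1) by (intro insert_r_subsets s(2))
qed

text \<open>Evaluate a three-term relation at a vector with just two nonzero coordinates, chosen so that
  one single term survives. The factor of the relation is then the product of the two corresponding
  entries of \<open>d\<close>, whichever term is chosen.\<close>

lemma exchange_if_homogeneous:
  assumes r: "0 < r" "r \<le> n"
    and hom: "\<And>I J. I \<subseteq> {1..n} \<Longrightarrow> card I = r - 1 \<Longrightarrow> J \<subseteq> {1..n} \<Longrightarrow> card J = r + 1 \<Longrightarrow>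
      \<exists>c. \<forall>p \<in> partitions_in_box n r \<rightarrow>\<^sub>E UNIV.
        plucker_relation n r I J (diag_act n r d p) = c * plucker_relation n r I J p"
  shows "exchange_property n r d"
  unfolding exchange_property_def
proof (intro allI impI)
  fix S a b i j
  assume "S \<subseteq> {1..n} \<and> card S + 2 = r \<and> {a, b, i, j} \<subseteq> {1..n} - S \<and> distinct [a, b, i, j]"
  then have A: "S \<subseteq> {1..n}" "card S + 2 = r" "{a, b, i, j} \<subseteq> {1..n} - S" "distinct [a, b, i, j]"
    by auto
  note idx = three_term_index_sets[OF A]
  obtain s1 s2 s3 :: complex where s: "s1 \<noteq> 0" "s2 \<noteq> 0" and
    rel: "\<forall>p. plucker_relation n r (insert a S) (insert i (insert j (insert b S))) p =
      s1 * (plucker_coord n r p (insert i (insert a S)) * plucker_coord n r p (insert j (insert b S))) +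
      s2 * (plucker_coord n r p (insert j (insert a S)) * plucker_coord n r p (insert i (insert b S))) +
      s3 * (plucker_coord n r p (insert b (insert a S)) * plucker_coord n r p (insert i (insert j S)))"
    using three_term_relation[OF A] by blast
  obtain c where c: "\<And>p. p \<in> partitions_in_box n r \<rightarrow>\<^sub>E UNIV \<Longrightarrow>
      plucker_relation n r (insert a S) (insert i (insert j (insert b S))) (diag_act n r d p) =
      c * plucker_relation n r (insert a S) (insert i (insert j (insert b S))) p"
    using hom[OF idx(1-4)] by blast
  \<comment> \<open>The vector whose coordinates are \<open>1\<close> at the index sets in \<open>E\<close> and \<open>0\<close> elsewhere.\<close>
  define test where "test E = (\<lambda>lam\<in>partitions_in_box n r.
    (\<lambda>I. if I \<in> E then 1 else 0 :: complex) (vertical_steps n r lam))" for E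
  have test_ext: "test E \<in> partitions_in_box n r \<rightarrow>\<^sub>E UNIV" for E by (auto simp: test_def)
  have coord: "plucker_coord n r (test E) (insert x (insert y S)) = (if insert x (insert y S) \<in> E then 1 else 0)"
    "plucker_coord n r (diag_act n r d (test E)) (insert x (insert y S)) =
      (if insert x (insert y S) \<in> E then d (insert x (insert y S)) else 0)"
    if "x \<in> {a, b, i, j}" "y \<in> {a, b, i, j}" "x \<noteq> y" for E x y
  proof -
    show *: "plucker_coord n r (test E) (insert x (insert y S)) =
        (if insert x (insert y S) \<in> E then 1 else 0)"
      unfolding test_def
      by (rule plucker_coord_family[OF idx(5)[OF that] r(2), where f = "\<lambda>I. if I \<in> E then 1 else 0"])
    show "plucker_coord n r (diag_act n r d (test E)) (insert x (insert y S)) =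
        (if insert x (insert y S) \<in> E then d (insert x (insert y S)) else 0)"
      unfolding plucker_coord_diag_act[OF idx(5)[OF that] r(2)] * by simp
  qed
  define E1 where "E1 = {insert i (insert a S), insert j (insert b S)}"
  define E2 where "E2 = {insert j (insert a S), insert i (insert b S)}"
  have notin: "a \<notin> S" "b \<notin> S" "i \<notin> S" "j \<notin> S"
    and dist: "a \<noteq> b" "a \<noteq> i" "a \<noteq> j" "b \<noteq> i" "b \<noteq> j" "i \<noteq> j" using A(3,4) by auto
  have other: "insert j (insert a S) \<notin> E1" "insert b (insert a S) \<notin> E1"
    "insert i (insert a S) \<notin> E2" "insert b (insert a S) \<notin> E2"
  proof -
    have ne: "insert x (insert y S) \<noteq> insert z (insert w S)"
      if "x \<notin> S \<and> x \<noteq> z \<and> x \<noteq> w \<or> y \<notin> S \<and> y \<noteq> z \<and> y \<noteq> w" for x y z w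
      using that by (metis insertI1 insertI2 insertE)
    show "insert j (insert a S) \<notin> E1" "insert b (insert a S) \<notin> E1"
      "insert i (insert a S) \<notin> E2" "insert b (insert a S) \<notin> E2"
      unfolding E1_def E2_def using notin dist by (simp_all add: ne)
  qed
  have mem: "insert i (insert a S) \<in> E1" "insert j (insert b S) \<in> E1"
    "insert j (insert a S) \<in> E2" "insert i (insert b S) \<in> E2"
    by (simp_all add: E1_def E2_def)
  have "d (insert i (insert a S)) * d (insert j (insert b S)) = c"
    using c[OF test_ext[of E1]] s(1) dist by (simp add: rel coord other mem)
  moreover have "d (insert j (insert a S)) * d (insert i (insert b S)) = c"
    using c[OF test_ext[of E2]] s(2) dist by (simp add: rel coord other mem)
  ultimately show "d (insert i (insert a S)) * d (insert j (insert b S)) =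
     d (insert j (insert a S)) * d (insert i (insert b S))" by simp
qed

text \<open>Take a matrix whose columns \<open>a\<close> and \<open>b\<close> are equal and whose columns \<open>i\<close> and \<open>j\<close> are equal, with
  \<open>S \<union> {a, i}\<close> a basis of columns. At this point the third term of the three-term relation vanishes and
  the other two are nonzero. The relation holds at this point and at its image, and comparing the two
  equations gives the exchange property.\<close>

lemma exchange_if_preserves_Grassmannian:
  assumes r: "0 < r" "r \<le> n"
    and pres: "\<And>M. M \<in> carrier_mat r n \<Longrightarrow> vec_space.rank r M = r \<Longrightarrow> plucker_vec n r M \<in> nonzero_vecs n r \<Longrightarrow>
      \<exists>M' c. M' \<in> carrier_mat r n \<and>
        diag_act n r d (plucker_vec n r M) = (\<lambda>lam\<in>partitions_in_box n r. c * plucker_vec n r M' lam)"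
  shows "exchange_property n r d"
  unfolding exchange_property_def
proof (intro allI impI)
  fix S a b i j
  assume "S \<subseteq> {1..n} \<and> card S + 2 = r \<and> {a, b, i, j} \<subseteq> {1..n} - S \<and> distinct [a, b, i, j]"
  then have A: "S \<subseteq> {1..n}" "card S + 2 = r" "{a, b, i, j} \<subseteq> {1..n} - S" "distinct [a, b, i, j]"
    by auto
  note idx = three_term_index_sets[OF A]
  have notin: "a \<notin> S" "b \<notin> S" "i \<notin> S" "j \<notin> S"
    and dist: "a \<noteq> b" "a \<noteq> i" "a \<noteq> j" "b \<noteq> i" "b \<noteq> j" "i \<noteq> j" using A(3,4) by auto
  have fin: "finite S" using A(1) finite_subset by blast
  obtain g where g: "bij_betw g S {..<r - 2}"
    using ex_bij_betw_finite_nat[OF fin] A(2) by (auto simp: lessThan_atLeast0)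
  \<comment> \<open>The last two unit vectors are the columns \<open>a\<close>, \<open>b\<close> and \<open>i\<close>, \<open>j\<close>; the value \<open>r\<close> gives a zero column.\<close>
  define f where "f l = (if l \<in> S then g l else if l = a \<or> l = b then r - 2
    else if l = i \<or> l = j then r - 1 else r)" for l
  define M where "M = unit_columns r n f"
  have M: "M \<in> carrier_mat r n" by (simp add: M_def unit_columns_def)
  have bij: "bij_betw f (insert y (insert x S)) {..<r}" if "x \<in> {a, b}" "y \<in> {i, j}" for x y
  proof -
    have "bij_betw f S {..<r - 2}" using g by (rule bij_betw_cong[THEN iffD1, rotated]) (simp add: f_def)
    moreover have "f x = r - 2" "f y = r - 1" using that notin dist by (auto simp: f_def)
    moreover have "{..<r} = insert (r - 1) (insert (r - 2) {..<r - 2})" using A(2) by auto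
    moreover have "r - 1 \<noteq> r - 2" using A(2) by simp
    moreover have "x \<notin> S" "y \<notin> insert x S" using that notin dist by auto
    ultimately show ?thesis
      using notIn_Un_bij_betw[of x S f "{..<r - 2}"]
        notIn_Un_bij_betw[of y "insert x S" f "insert (r - 2) {..<r - 2}"]
      by (simp add: \<open>r - 1 \<noteq> r - 2\<close>[simplified])
  qed
  have nz: "minor M (insert y (insert x S)) \<noteq> 0" if "x \<in> {a, b}" "y \<in> {i, j}" for x y
    unfolding M_def using idx(5)[of y x] that dist bij[OF that]
    by (intro minor_unit_columns_nonzero) (auto simp: r_subsets_def)
  have zero: "minor M (insert b (insert a S)) = 0"
    unfolding M_def using idx(5)[of b a] dist notin
    by (intro minor_unit_columns_zero[of _ n r a b]) (auto simp: r_subsets_def f_def)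
  have rank: "vec_space.rank r M = r"
    using idx(5)[of i a] dist nz[of a i] by (intro rank_eq_nrows_if_minor[OF M]) (auto simp: r_subsets_def)
  obtain s1 s2 s3 :: complex where s: "s1 \<noteq> 0" "s2 \<noteq> 0" and
    rel: "\<forall>p. plucker_relation n r (insert a S) (insert i (insert j (insert b S))) p =
      s1 * (plucker_coord n r p (insert i (insert a S)) * plucker_coord n r p (insert j (insert b S))) +
      s2 * (plucker_coord n r p (insert j (insert a S)) * plucker_coord n r p (insert i (insert b S))) +
      s3 * (plucker_coord n r p (insert b (insert a S)) * plucker_coord n r p (insert i (insert j S)))"
    using three_term_relation[OF A] by blast
  let ?p = "plucker_vec n r M"
  have coord: "plucker_coord n r ?p (insert x (insert y S)) = minor M (insert x (insert y S))"
    "plucker_coord n r (diag_act n r d ?p) (insert x (insert y S)) =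
      d (insert x (insert y S)) * minor M (insert x (insert y S))"
    if "x \<in> {a, b, i, j}" "y \<in> {a, b, i, j}" "x \<noteq> y" for x y
    using plucker_coord_plucker_vec[OF idx(5)[OF that] r(2)] plucker_coord_diag_act[OF idx(5)[OF that] r(2)]
    by auto
  have "?p \<in> nonzero_vecs n r"
    using plucker_vec_nonzero[OF idx(5)[of i a] r(2)] nz[of a i] dist by blast
  then obtain M' c where M': "M' \<in> carrier_mat r n"
    "diag_act n r d ?p = (\<lambda>lam\<in>partitions_in_box n r. c * plucker_vec n r M' lam)"
    using pres[OF M rank] by blast
  have rel0: "plucker_relation n r (insert a S) (insert i (insert j (insert b S))) (diag_act n r d ?p) = 0"
  proof -
    have "plucker_coord n r (diag_act n r d ?p) I = c * plucker_coord n r (plucker_vec n r M') I"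
      if I: "I \<in> r_subsets n r" for I
    proof -
      obtain lam where "lam \<in> partitions_in_box n r" "\<forall>p. plucker_coord n r p I = p lam"
        using plucker_coord_eq[OF I r(2)] by blast
      then show ?thesis using M'(2) by simp
    qed
    then have *: "plucker_coord n r (diag_act n r d ?p) (insert x (insert y S)) =
        c * plucker_coord n r (plucker_vec n r M') (insert x (insert y S))"
      if "x \<in> {a, b, i, j}" "y \<in> {a, b, i, j}" "x \<noteq> y" for x y
      using idx(5)[OF that] by blast
    have "plucker_relation n r (insert a S) (insert i (insert j (insert b S))) (diag_act n r d ?p) =
      c * c * plucker_relation n r (insert a S) (insert i (insert j (insert b S))) (plucker_vec n r M')"
      unfolding rel[rule_format] using dist by (simp add: * algebra_simps)
    then show ?thesis using plucker_relation_plucker_vec[OF M'(1) r idx(1-4)] by simp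
  qed
  have rel1: "plucker_relation n r (insert a S) (insert i (insert j (insert b S))) ?p = 0"
    using plucker_relation_plucker_vec[OF M r idx(1-4)] .
  let ?x = "s1 * (minor M (insert i (insert a S)) * minor M (insert j (insert b S)))"
  let ?y = "s2 * (minor M (insert j (insert a S)) * minor M (insert i (insert b S)))"
  let ?d1 = "d (insert i (insert a S)) * d (insert j (insert b S))"
  let ?d2 = "d (insert j (insert a S)) * d (insert i (insert b S))"
  have "?x + ?y = 0" using rel1 dist unfolding rel[rule_format] by (simp add: coord zero)
  moreover have "?d1 * ?x + ?d2 * ?y = 0"
  proof -
    have "s1 * ((d (insert i (insert a S)) * minor M (insert i (insert a S))) *
        (d (insert j (insert b S)) * minor M (insert j (insert b S)))) +
      s2 * ((d (insert j (insert a S)) * minor M (insert j (insert a S))) *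
        (d (insert i (insert b S)) * minor M (insert i (insert b S)))) = 0"
      using rel0 dist unfolding rel[rule_format] by (simp add: coord zero)
    then show ?thesis by (simp only: mult_ac)
  qed
  moreover have "(?d1 - ?d2) * ?x = (?d1 * ?x + ?d2 * ?y) - ?d2 * (?x + ?y)"
    by (simp only: algebra_simps)
  ultimately have "(?d1 - ?d2) * ?x = 0" by simp
  moreover have "?x \<noteq> 0" using s nz by simp
  ultimately show "?d1 = ?d2" by simp
qed

text \<open>On Pluecker vectors a monomial diagonal matrix acts by scaling the columns.\<close>

lemma diag_act_plucker_vec:
  assumes "monomial_on n r d c zeta" "M \<in> carrier_mat r n" "r \<le> n"
  shows "diag_act n r d (plucker_vec n r M) =
    (\<lambda>lam\<in>partitions_in_box n r. c * plucker_vec n r (scale_columns r n zeta M) lam)"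
  unfolding diag_act_def
proof (rule restrict_ext)
  fix lam assume lam: "lam \<in> partitions_in_box n r"
  then have I: "vertical_steps n r lam \<in> r_subsets n r" by (rule vertical_steps_r_subset[OF _ assms(3)])
  then show "d (vertical_steps n r lam) * plucker_vec n r M lam =
      c * plucker_vec n r (scale_columns r n zeta M) lam"
    using lam minor_scale_columns[OF assms(2), of "vertical_steps n r lam" zeta] assms(1)
    by (simp add: plucker_vec_def monomial_on_def r_subsets_def minor_def)
qed

text \<open>The factor \<open>c\<close> disappears in projective space.\<close>

lemma diag_act_proj_class:
  assumes m: "monomial_on n r d c zeta" and M: "M \<in> carrier_mat r n" and r: "r \<le> n"
  shows "diag_act n r d ` (proj_rel n r `` {plucker_vec n r M}) =
    proj_rel n r `` {plucker_vec n r (scale_columns r n zeta M)}"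
proof -
  let ?P = "partitions_in_box n r" and ?p = "plucker_vec n r M"
    and ?q = "plucker_vec n r (scale_columns r n zeta M)"
  have dnz: "d I \<noteq> 0" if "I \<in> r_subsets n r" for I
    using m that r_subsets_finite[OF that]
    by (auto simp: monomial_on_def r_subsets_def prod_zero_iff subset_iff)
  have "c \<noteq> 0" using m by (simp add: monomial_on_def)
  have d: "d (vertical_steps n r lam) * ?p lam = c * ?q lam"
    and nz: "d (vertical_steps n r lam) \<noteq> 0" if "lam \<in> ?P" for lam
    using fun_cong[OF diag_act_plucker_vec[OF m M r], of lam] that
      dnz[OF vertical_steps_r_subset[OF that r]] by (simp_all add: diag_act_def)
  have ext: "?p \<in> ?P \<rightarrow>\<^sub>E UNIV" "?q \<in> ?P \<rightarrow>\<^sub>E UNIV" by (auto simp: plucker_vec_def)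
  have cls: "proj_rel n r `` {p} =
      (if p \<in> nonzero_vecs n r then {(\<lambda>lam\<in>?P. t * p lam) | t. t \<noteq> 0} else {})" for p
    by (auto simp: proj_rel_def nonzero_vecs_def)
  have "?p lam = 0 \<longleftrightarrow> ?q lam = 0" if "lam \<in> ?P" for lam
    using d[OF that] nz[OF that] \<open>c \<noteq> 0\<close> by (metis mult_eq_0_iff)
  then have nzv: "?p \<in> nonzero_vecs n r \<longleftrightarrow> ?q \<in> nonzero_vecs n r"
    using ext by (auto simp: nonzero_vecs_def)
  have act: "diag_act n r d (\<lambda>lam\<in>?P. t * ?p lam) = (\<lambda>lam\<in>?P. (t * c) * ?q lam)" for t
    unfolding diag_act_def
  proof (rule restrict_ext)
    fix lam assume "lam \<in> ?P"
    then show "d (vertical_steps n r lam) * (\<lambda>lam\<in>?P. t * ?p lam) lam = t * c * ?q lam"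
      using d[of lam] by (simp add: algebra_simps)
  qed
  have "diag_act n r d ` {(\<lambda>lam\<in>?P. t * ?p lam) | t. t \<noteq> 0} = {(\<lambda>lam\<in>?P. t * ?q lam) | t. t \<noteq> 0}"
  proof (intro equalityI subsetI)
    fix p assume "p \<in> diag_act n r d ` {(\<lambda>lam\<in>?P. t * ?p lam) | t. t \<noteq> 0}"
    then obtain t where "t \<noteq> 0" "p = (\<lambda>lam\<in>?P. (t * c) * ?q lam)" using act by auto
    then show "p \<in> {(\<lambda>lam\<in>?P. t * ?q lam) | t. t \<noteq> 0}" using \<open>c \<noteq> 0\<close> by auto
  next
    fix p assume "p \<in> {(\<lambda>lam\<in>?P. t * ?q lam) | t. t \<noteq> 0}"
    then obtain t where t: "t \<noteq> 0" "p = (\<lambda>lam\<in>?P. t * ?q lam)" by auto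
    then have "p = diag_act n r d (\<lambda>lam\<in>?P. (t / c) * ?p lam)"
      using act[of "t / c"] \<open>c \<noteq> 0\<close> by simp
    moreover have "t / c \<noteq> 0" using t \<open>c \<noteq> 0\<close> by simp
    ultimately show "p \<in> diag_act n r d ` {(\<lambda>lam\<in>?P. t * ?p lam) | t. t \<noteq> 0}" by blast
  qed
  then show ?thesis unfolding cls using nzv by auto
qed

section \<open>The action on the coordinates\<close>

text \<open>The entry at the coordinate \<open>p\<^sub>I\<close> of the diagonal matrix by which \<open>\<psi>\<close> acts.\<close>

definition coord_weight :: "nat \<Rightarrow> nat \<Rightarrow> (point list \<Rightarrow> complex) \<Rightarrow> nat set \<Rightarrow> complex" where
  "coord_weight n r psi I = arrow_prod n r psi (path_of_set n I)"

lemma lattice_paths_eq: "r \<le> n \<Longrightarrow> lattice_paths n r = path_of_set n ` r_subsets n r"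
proof (intro equalityI subsetI)
  fix P assume r: "r \<le> n" and P: "P \<in> lattice_paths n r"
  then have "vsteps P \<in> r_subsets n r"
    using bij_betw_vsteps[OF r] by (auto simp: bij_betw_def r_subsets_def)
  then show "P \<in> path_of_set n ` r_subsets n r" using path_of_set_vsteps[OF P r] by (metis image_eqI)
next
  fix P assume "r \<le> n" "P \<in> path_of_set n ` r_subsets n r"
  then show "P \<in> lattice_paths n r"
    using path_of_set_in_lattice_paths unfolding r_subsets_def by blast
qed

lemma root_of_unity_nonzero: "z ^ n = (1 :: complex) \<Longrightarrow> 0 < n \<Longrightarrow> z \<noteq> 0"
  by (auto simp: power_0_left)

lemma G_tilde_act_eq_diag_act:
  assumes "r \<le> n"
  shows "G_tilde_act n r psi p = diag_act n r (coord_weight n r psi) p"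
  unfolding G_tilde_act_def diag_act_def
proof (rule restrict_ext)
  fix lam assume lam: "lam \<in> partitions_in_box n r"
  then have "partition_path n r lam \<in> lattice_paths n r"
    using bij_betw_partition_path bij_betw_apply by metis
  then have "path_of_set n (vertical_steps n r lam) = partition_path n r lam"
    unfolding vertical_steps_eq_vsteps[OF lam assms] by (rule path_of_set_vsteps[OF _ assms])
  then show "(\<Prod>a\<in>arrows_of n r lam. psi a) * p lam =
      coord_weight n r psi (vertical_steps n r lam) * p lam"
    by (simp add: coord_weight_def arrow_prod_def arrows_of_def arrows_in_def)
qed

lemma coord_weight_mult:
  "coord_weight n r (\<lambda>a\<in>LQ1 n r. psi a * phi a) I = coord_weight n r psi I * coord_weight n r phi I"
  unfolding coord_weight_def arrow_prod_def prod.distrib[symmetric]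
  by (intro prod.cong refl) (simp add: arrows_in_def)

lemma coord_weight_power:
  assumes "\<And>a. a \<in> LQ1 n r \<Longrightarrow> psi a ^ m = 1"
  shows "coord_weight n r psi I ^ m = 1"
  unfolding coord_weight_def arrow_prod_def prod_power_distrib
  using assms by (intro prod.neutral) (simp add: arrows_in_def)

lemma prod_LQ1_eq_cyclic:
  assumes "0 < r" "r < n"
  shows "(\<Prod>a\<in>LQ1 n r. psi a) = (\<Prod>c<n. coord_weight n r psi (cyclic_interval n r c))"
  using prod_LQ1[OF assms] by (simp add: cyclic_path_def coord_weight_def)

lemma cyclic_interval_r_subset: "c < n \<Longrightarrow> r < n \<Longrightarrow> cyclic_interval n r c \<in> r_subsets n r"
  using card_cyclic_interval by (auto simp: r_subsets_def cyclic_interval_def)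

section \<open>The groups\<close>

lemma G_tilde_simps [simp]:
  "psi \<in> carrier (G_tilde n r) \<longleftrightarrow> psi \<in> extensional (LQ1 n r) \<and> (\<forall>a\<in>LQ1 n r. psi a ^ n = 1) \<and>
    (\<Prod>a\<in>LQ1 n r. psi a) = 1"
  "psi \<otimes>\<^bsub>G_tilde n r\<^esub> phi = (\<lambda>a\<in>LQ1 n r. psi a * phi a)"
  "\<one>\<^bsub>G_tilde n r\<^esub> = (\<lambda>a\<in>LQ1 n r. 1)"
  by (auto simp: G_tilde_def PiE_def)

lemma H_tilde_simps [simp]:
  "zeta \<in> carrier (H_tilde n r) \<longleftrightarrow> zeta \<in> extensional {1..n} \<and> (\<forall>i\<in>{1..n}. zeta i ^ n = 1) \<and>
    (\<Prod>i\<in>{1..n}. zeta i) ^ r = 1"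
  "zeta \<otimes>\<^bsub>H_tilde n r\<^esub> xi = (\<lambda>i\<in>{1..n}. zeta i * xi i)"
  "\<one>\<^bsub>H_tilde n r\<^esub> = (\<lambda>i\<in>{1..n}. 1)"
  by (auto simp: H_tilde_def PiE_def)

lemma G_tilde_nonzero:
  assumes "psi \<in> carrier (G_tilde n r)" "a \<in> LQ1 n r" "0 < n"
  shows "psi a \<noteq> 0"
proof -
  have "psi a ^ n = 1" using assms(1,2) by simp
  then show ?thesis using assms(3) by (rule root_of_unity_nonzero)
qed

lemma H_tilde_nonzero:
  assumes "zeta \<in> carrier (H_tilde n r)" "i \<in> {1..n}" "0 < n"
  shows "zeta i \<noteq> 0"
proof -
  have "zeta i ^ n = 1" using assms(1,2) by simp
  then show ?thesis using assms(3) by (rule root_of_unity_nonzero)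
qed

lemma comm_group_G_tilde:
  assumes "0 < n"
  shows "comm_group (G_tilde n r)"
proof (rule comm_groupI)
  fix psi assume psi: "psi \<in> carrier (G_tilde n r)"
  let ?inv = "\<lambda>a\<in>LQ1 n r. inverse (psi a)"
  have "?inv \<in> carrier (G_tilde n r)"
    using psi by (simp add: power_inverse prod_inversef[unfolded comp_def])
  moreover have "?inv \<otimes>\<^bsub>G_tilde n r\<^esub> psi = \<one>\<^bsub>G_tilde n r\<^esub>"
  proof -
    have "psi a \<noteq> 0" if "a \<in> LQ1 n r" for a
      using G_tilde_nonzero[OF psi that assms] .
    then show ?thesis by (auto intro!: restrict_ext)
  qed
  ultimately show "\<exists>phi\<in>carrier (G_tilde n r). phi \<otimes>\<^bsub>G_tilde n r\<^esub> psi = \<one>\<^bsub>G_tilde n r\<^esub>"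
    by blast
qed (auto simp: power_mult_distrib prod.distrib mult_ac restrict_def extensional_def fun_eq_iff)

lemma comm_group_H_tilde:
  assumes "0 < n"
  shows "comm_group (H_tilde n r)"
proof (rule comm_groupI)
  fix zeta assume zeta: "zeta \<in> carrier (H_tilde n r)"
  let ?inv = "\<lambda>i\<in>{1..n}. inverse (zeta i)"
  have "?inv \<in> carrier (H_tilde n r)"
    using zeta by (simp add: power_inverse prod_inversef[unfolded comp_def])
  moreover have "?inv \<otimes>\<^bsub>H_tilde n r\<^esub> zeta = \<one>\<^bsub>H_tilde n r\<^esub>"
  proof -
    have "zeta i \<noteq> 0" if "i \<in> {1..n}" for i
      using H_tilde_nonzero[OF zeta that assms] .
    then show ?thesis by (auto intro!: restrict_ext)
  qed
  ultimately show "\<exists>xi\<in>carrier (H_tilde n r). xi \<otimes>\<^bsub>H_tilde n r\<^esub> zeta = \<one>\<^bsub>H_tilde n r\<^esub>"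
    by blast
qed (auto simp: power_mult_distrib prod.distrib mult_ac restrict_def extensional_def fun_eq_iff)

lemma coord_weight_nonzero:
  assumes "psi \<in> carrier (G_tilde n r)" "0 < n"
  shows "coord_weight n r psi I \<noteq> 0"
  unfolding coord_weight_def using G_tilde_nonzero[OF assms(1) _ assms(2)] by (rule arrow_prod_nonzero)

text \<open>The kernel of the projection from \<open>G_tilde\<close> to \<open>G\<close>.\<close>

abbreviation scalars :: "nat \<Rightarrow> nat \<Rightarrow> (point list \<Rightarrow> complex) set" where
  "scalars n r \<equiv> torus_diag n r \<inter> carrier (G_tilde n r)"

text \<open>The elements of the torus are the families that act by scalars.\<close>

lemma scalars_iff:
  assumes "psi \<in> carrier (G_tilde n r)" "r < n"
  shows "psi \<in> scalars n r \<longleftrightarrow> (\<exists>c. \<forall>I\<in>r_subsets n r. coord_weight n r psi I = c)"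
proof
  assume "psi \<in> scalars n r"
  then obtain c where "\<forall>P\<in>lattice_paths n r. arrow_prod n r psi P = c"
    using arrow_prod_torus by blast
  then show "\<exists>c. \<forall>I\<in>r_subsets n r. coord_weight n r psi I = c"
    using assms(2) by (auto simp: lattice_paths_eq coord_weight_def)
next
  assume "\<exists>c. \<forall>I\<in>r_subsets n r. coord_weight n r psi I = c"
  then obtain c where c: "\<forall>I\<in>r_subsets n r. coord_weight n r psi I = c" by blast
  have "psi \<in> torus_diag n r"
  proof (rule torus_diag_if_arrow_prod_const)
    show "psi \<in> extensional (LQ1 n r)" using assms(1) by simp
    show "psi a \<noteq> 0" if "a \<in> LQ1 n r" for a using G_tilde_nonzero[OF assms(1) that] assms(2) by simp
    show "arrow_prod n r psi P = c" if "P \<in> lattice_paths n r" for P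
      using that c assms(2) by (auto simp: lattice_paths_eq coord_weight_def)
  qed
  then show "psi \<in> scalars n r" using assms(1) by blast
qed

lemma subgroup_scalars:
  assumes "r < n"
  shows "subgroup (scalars n r) (G_tilde n r)"
proof -
  have n: "0 < n" using assms by simp
  interpret comm_group "G_tilde n r" using n by (rule comm_group_G_tilde)
  have one: "\<one>\<^bsub>G_tilde n r\<^esub> \<in> scalars n r"
    unfolding scalars_iff[OF one_closed assms]
    by (intro exI[of _ 1]) (simp add: coord_weight_def arrow_prod_def arrows_in_def)
  have mult: "coord_weight n r (psi \<otimes>\<^bsub>G_tilde n r\<^esub> phi) I = coord_weight n r psi I * coord_weight n r phi I"
    for psi phi I by (simp add: coord_weight_mult)
  show ?thesis
  proof (rule subgroupI)
    show "scalars n r \<noteq> {}" using one by blast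
  next
    fix psi assume psi: "psi \<in> scalars n r"
    then have psi': "psi \<in> carrier (G_tilde n r)" by blast
    obtain c where c: "\<forall>I\<in>r_subsets n r. coord_weight n r psi I = c"
      using psi scalars_iff[OF psi' assms] by blast
    have "coord_weight n r (inv\<^bsub>G_tilde n r\<^esub> psi) I = 1 / c" if "I \<in> r_subsets n r" for I
    proof -
      have "coord_weight n r (inv\<^bsub>G_tilde n r\<^esub> psi) I * c = coord_weight n r \<one>\<^bsub>G_tilde n r\<^esub> I"
        using mult[of "inv\<^bsub>G_tilde n r\<^esub> psi" psi I] c that l_inv[OF psi'] by simp
      also have "\<dots> = 1" by (simp add: coord_weight_def arrow_prod_def arrows_in_def)
      finally show ?thesis by (metis nonzero_eq_divide_eq mult_zero_right zero_neq_one)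
    qed
    then show "inv\<^bsub>G_tilde n r\<^esub> psi \<in> scalars n r"
      using scalars_iff[OF inv_closed[OF psi'] assms] by blast
  next
    fix psi phi assume scal: "psi \<in> scalars n r" "phi \<in> scalars n r"
    then have carr: "psi \<in> carrier (G_tilde n r)" "phi \<in> carrier (G_tilde n r)" by blast+
    obtain c c' where "\<forall>I\<in>r_subsets n r. coord_weight n r psi I = c"
      "\<forall>I\<in>r_subsets n r. coord_weight n r phi I = c'"
      using scal scalars_iff[OF carr(1) assms] scalars_iff[OF carr(2) assms] by blast
    then have "\<forall>I\<in>r_subsets n r. coord_weight n r (psi \<otimes>\<^bsub>G_tilde n r\<^esub> phi) I = c * c'"
      using mult by simp
    then show "psi \<otimes>\<^bsub>G_tilde n r\<^esub> phi \<in> scalars n r"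
      using scalars_iff[OF m_closed[OF carr] assms] by blast
  qed blast
qed

lemma normal_scalars:
  assumes "r < n"
  shows "scalars n r \<lhd> G_tilde n r"
proof -
  interpret comm_group "G_tilde n r" using assms by (intro comm_group_G_tilde) simp
  show ?thesis using subgroup_scalars[OF assms] by (rule subgroup_imp_normal)
qed

lemma carrier_G_ladder:
  "carrier (G_ladder n r) = (\<lambda>psi. scalars n r #>\<^bsub>G_tilde n r\<^esub> psi) ` carrier (G_tilde n r)"
  by (simp add: G_ladder_def carrier_FactGroup)

text \<open>Representatives of one coset act by proportional diagonal matrices.\<close>

lemma coord_weight_coset:
  assumes "phi \<in> scalars n r #>\<^bsub>G_tilde n r\<^esub> psi" "r < n"
  obtains t where "t \<noteq> 0" "\<And>I. I \<in> r_subsets n r \<Longrightarrow> coord_weight n r phi I = t * coord_weight n r psi I"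
proof -
  obtain nu where nu: "nu \<in> scalars n r" "phi = nu \<otimes>\<^bsub>G_tilde n r\<^esub> psi"
    using assms(1) by (auto simp: r_coset_def)
  obtain t where t: "t \<noteq> 0" "\<forall>P\<in>lattice_paths n r. arrow_prod n r nu P = t"
    using arrow_prod_torus nu(1) by blast
  then have "coord_weight n r phi I = t * coord_weight n r psi I" if "I \<in> r_subsets n r" for I
    using that assms(2) unfolding nu(2)
    by (simp add: coord_weight_mult) (simp add: coord_weight_def lattice_paths_eq)
  then show thesis using that t(1) by blast
qed

lemma monomial_coset:
  assumes "monomial_on n r (coord_weight n r psi) c zeta"
    and "phi \<in> scalars n r #>\<^bsub>G_tilde n r\<^esub> psi" "r < n"
  shows "\<exists>c'. monomial_on n r (coord_weight n r phi) c' zeta"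
proof -
  obtain t where "t \<noteq> 0" "\<And>I. I \<in> r_subsets n r \<Longrightarrow> coord_weight n r phi I = t * coord_weight n r psi I"
    using coord_weight_coset[OF assms(2,3)] by blast
  then have "monomial_on n r (coord_weight n r phi) (t * c) zeta"
    using assms(1) by (simp add: monomial_on_def)
  then show ?thesis by blast
qed

section \<open>The stabilizer of the Grassmannian\<close>

text \<open>All elements of \<open>C\<close> send the class of a matrix to the class of the same column-scaled matrix,
  and the matrices of full rank are permuted by this scaling.\<close>

lemma preserves_Grassmannian_if_monomial:
  assumes r: "r \<le> n" and C: "C \<noteq> {}" and nz: "\<And>i. i \<in> {1..n} \<Longrightarrow> zeta i \<noteq> 0"
    and mono: "\<And>phi. phi \<in> C \<Longrightarrow> \<exists>c. monomial_on n r (coord_weight n r phi) c zeta"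
  shows "G_act n r C ` Grassmannian n r = Grassmannian n r"
proof -
  define cls where "cls M = proj_rel n r `` {plucker_vec n r M}" for M
  define Ms where "Ms = {M :: complex mat. M \<in> carrier_mat r n \<and> vec_space.rank r M = r}"
  have Gr: "Grassmannian n r = cls ` Ms" by (auto simp: Grassmannian_def cls_def Ms_def)
  have act: "G_act n r C (cls M) = cls (scale_columns r n zeta M)" if "M \<in> Ms" for M
  proof -
    have "G_tilde_act n r phi ` cls M = cls (scale_columns r n zeta M)" if "phi \<in> C" for phi
    proof -
      obtain c where "monomial_on n r (coord_weight n r phi) c zeta" using mono \<open>phi \<in> C\<close> by blast
      then have "diag_act n r (coord_weight n r phi) ` cls M = cls (scale_columns r n zeta M)"
        unfolding cls_def using \<open>M \<in> Ms\<close> r by (intro diag_act_proj_class) (auto simp: Ms_def)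
      then show ?thesis by (simp add: G_tilde_act_eq_diag_act[OF r])
    qed
    then show ?thesis unfolding G_act_def using C by auto
  qed
  have scale_Ms: "scale_columns r n xi M \<in> Ms" if "M \<in> Ms" "\<And>i. i \<in> {1..n} \<Longrightarrow> xi i \<noteq> 0" for xi M
    using that rank_scale_columns[of M r n xi] by (auto simp: Ms_def scale_columns_carrier)
  have "scale_columns r n zeta ` Ms = Ms"
  proof (intro equalityI subsetI)
    fix M assume M: "M \<in> Ms"
    let ?N = "scale_columns r n (\<lambda>i. inverse (zeta i)) M"
    have "scale_columns r n zeta ?N = M"
      using M nz by (intro eq_matI) (auto simp: scale_columns_def Ms_def)
    moreover have "?N \<in> Ms" using scale_Ms M nz by simp
    ultimately show "M \<in> scale_columns r n zeta ` Ms" by (metis image_eqI)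
  qed (use scale_Ms nz in auto)
  then have "cls ` Ms = cls ` scale_columns r n zeta ` Ms" by simp
  also have "\<dots> = G_act n r C ` cls ` Ms" using act by (auto simp: image_image)
  finally show ?thesis by (simp add: Gr)
qed

lemma monomial_if_preserves_Grassmannian:
  assumes r: "0 < r" "r < n" and psi: "psi \<in> carrier (G_tilde n r)" "psi \<in> C"
    and pres: "G_act n r C ` Grassmannian n r = Grassmannian n r"
  shows "\<exists>c zeta. monomial_on n r (coord_weight n r psi) c zeta"
proof (rule exchange_imp_monomial[OF r])
  show "coord_weight n r psi I \<noteq> 0" for I using coord_weight_nonzero psi r by simp
  show "exchange_property n r (coord_weight n r psi)"
  proof (rule exchange_if_preserves_Grassmannian)
    fix M :: "complex mat"
    assume M: "M \<in> carrier_mat r n" "vec_space.rank r M = r"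
      and nz: "plucker_vec n r M \<in> nonzero_vecs n r"
    let ?p = "plucker_vec n r M" and ?X = "proj_rel n r `` {plucker_vec n r M}"
    have "?X \<in> Grassmannian n r" using M by (auto simp: Grassmannian_def)
    then have "G_act n r C ?X \<in> Grassmannian n r" using pres by blast
    then obtain M' where M': "M' \<in> carrier_mat r n"
      "G_act n r C ?X = proj_rel n r `` {plucker_vec n r M'}"
      by (auto simp: Grassmannian_def)
    have "\<exists>c. c \<noteq> 0 \<and> ?p = (\<lambda>lam\<in>partitions_in_box n r. c * ?p lam)"
      by (intro exI[of _ 1]) (auto simp: plucker_vec_def fun_eq_iff)
    then have "?p \<in> ?X" using nz unfolding proj_rel_def by blast
    then have "G_tilde_act n r psi ?p \<in> G_act n r C ?X" using psi(2) by (auto simp: G_act_def)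
    then have "(plucker_vec n r M', diag_act n r (coord_weight n r psi) ?p) \<in> proj_rel n r"
      using M'(2) r by (simp add: G_tilde_act_eq_diag_act)
    then show "\<exists>M' c. M' \<in> carrier_mat r n \<and> diag_act n r (coord_weight n r psi) ?p =
        (\<lambda>lam\<in>partitions_in_box n r. c * plucker_vec n r M' lam)"
      using M'(1) by (auto simp: proj_rel_def)
  qed (use r in auto)
qed

lemma coset_in_G_h_iff:
  assumes r: "0 < r" "r < n" and psi: "psi \<in> carrier (G_tilde n r)"
  shows "scalars n r #>\<^bsub>G_tilde n r\<^esub> psi \<in> G_h n r \<longleftrightarrow>
    (\<exists>c zeta. monomial_on n r (coord_weight n r psi) c zeta)"
proof -
  interpret comm_group "G_tilde n r" using r by (intro comm_group_G_tilde) simp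
  let ?C = "scalars n r #>\<^bsub>G_tilde n r\<^esub> psi"
  have mem: "psi \<in> ?C" using subgroup_scalars[OF r(2)] psi by (rule rcos_self[rotated])
  have C: "?C \<in> carrier (G_ladder n r)" using psi unfolding carrier_G_ladder by blast
  show ?thesis
  proof
    assume "?C \<in> G_h n r"
    then have "G_act n r ?C ` Grassmannian n r = Grassmannian n r" unfolding G_h_def by blast
    then show "\<exists>c zeta. monomial_on n r (coord_weight n r psi) c zeta"
      by (rule monomial_if_preserves_Grassmannian[OF r psi mem])
  next
    assume "\<exists>c zeta. monomial_on n r (coord_weight n r psi) c zeta"
    then obtain c zeta where m: "monomial_on n r (coord_weight n r psi) c zeta" by blast
    have "G_act n r ?C ` Grassmannian n r = Grassmannian n r"
    proof (rule preserves_Grassmannian_if_monomial)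
      show "\<exists>c. monomial_on n r (coord_weight n r phi) c zeta" if "phi \<in> ?C" for phi
        using monomial_coset[OF m that r(2)] .
      show "zeta i \<noteq> 0" if "i \<in> {1..n}" for i using m that unfolding monomial_on_def by blast
    qed (use r mem in auto)
    then show "?C \<in> G_h n r" using C unfolding G_h_def by blast
  qed
qed

section \<open>The isomorphism\<close>

lemma level_LQ1: "a \<in> LQ1 n r \<Longrightarrow> r \<le> n \<Longrightarrow> p \<in> set a \<Longrightarrow> level p \<le> n"
  by (fastforce simp: LQ1_def level_def)

text \<open>The vertical steps of a path in the grid have numbers between \<open>1\<close> and \<open>n\<close>.\<close>

lemma step_weight_power:
  assumes "\<And>p. p \<in> set a \<Longrightarrow> level p \<le> n" "\<And>i. i \<in> {1..n} \<Longrightarrow> zeta i ^ m = 1"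
  shows "step_weight zeta a ^ m = 1"
  using assms(1)
proof (induction a rule: induct_list012)
  case (3 p q P)
  then have IH: "step_weight zeta (q # P) ^ m = 1" by simp
  show ?case
  proof (cases "snd q = Suc (snd p)")
    case True
    then have "level q \<in> {1..n}" using 3(3)[of q] by (simp add: level_def)
    then show ?thesis using IH assms(2) True by (simp add: power_mult_distrib)
  qed (use IH in simp)
qed simp_all

lemma step_weight_mult:
  assumes "\<And>p. p \<in> set a \<Longrightarrow> level p \<le> n" "\<And>i. i \<in> {1..n} \<Longrightarrow> chi i = zeta i * xi i"
  shows "step_weight chi a = step_weight zeta a * step_weight xi a"
  using assms(1)
proof (induction a rule: induct_list012)
  case (3 p q P)
  then have IH: "step_weight chi (q # P) = step_weight zeta (q # P) * step_weight xi (q # P)"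
    by simp
  show ?case
  proof (cases "snd q = Suc (snd p)")
    case True
    then have "level q \<in> {1..n}" using 3(3)[of q] by (simp add: level_def)
    then show ?thesis using IH True assms(2) by (simp add: mult_ac)
  qed (use IH in simp)
qed simp_all

text \<open>The family on the arrows that acts by \<open>\<Prod>\<^sub>i\<^sub>\<in>\<^sub>I \<zeta>\<^sub>i\<close> on the coordinate \<open>p\<^sub>I\<close>.\<close>

definition step_family :: "nat \<Rightarrow> nat \<Rightarrow> (nat \<Rightarrow> complex) \<Rightarrow> point list \<Rightarrow> complex" where
  "step_family n r zeta = (\<lambda>a\<in>LQ1 n r. step_weight zeta a)"

lemma coord_weight_step_family:
  assumes "I \<in> r_subsets n r" "r \<le> n"
  shows "coord_weight n r (step_family n r zeta) I = (\<Prod>i\<in>I. zeta i)"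
proof -
  have "path_of_set n I \<in> lattice_paths n r" using assms by (auto simp: lattice_paths_eq)
  then show ?thesis unfolding coord_weight_def
    using arrow_prod_vsteps[of "path_of_set n I" n r "step_family n r zeta" zeta]
      vsteps_path_of_set[of I n] assms(1) by (simp add: step_family_def r_subsets_def)
qed

text \<open>The product over all arrows is the product over all cyclic intervals, in which every \<open>\<zeta>\<^sub>i\<close>
  occurs \<open>r\<close> times.\<close>

lemma step_family_in_G_tilde:
  assumes r: "0 < r" "r < n" and zeta: "zeta \<in> carrier (H_tilde n r)"
  shows "step_family n r zeta \<in> carrier (G_tilde n r)"
proof -
  have "step_family n r zeta a ^ n = 1" if "a \<in> LQ1 n r" for a
    using step_weight_power[of a n zeta n] level_LQ1[OF that] zeta r that
    by (simp add: step_family_def)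
  moreover have "(\<Prod>a\<in>LQ1 n r. step_family n r zeta a) = 1"
  proof -
    have "(\<Prod>a\<in>LQ1 n r. step_family n r zeta a) = (\<Prod>c<n. \<Prod>i\<in>cyclic_interval n r c. zeta i)"
      unfolding prod_LQ1_eq_cyclic[OF r]
      using cyclic_interval_r_subset r by (intro prod.cong refl) (simp add: coord_weight_step_family)
    also have "\<dots> = (\<Prod>i\<in>{1..n}. zeta i) ^ r" by (rule prod_cyclic_intervals[OF r(2)])
    finally show ?thesis using zeta by simp
  qed
  ultimately show ?thesis by (simp add: step_family_def)
qed

lemma step_family_hom:
  assumes r: "0 < r" "r < n"
  shows "step_family n r \<in> hom (H_tilde n r) (G_tilde n r)"
proof (rule homI)
  show "step_family n r zeta \<in> carrier (G_tilde n r)" if "zeta \<in> carrier (H_tilde n r)" for zeta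
    using step_family_in_G_tilde[OF r that] .
  show "step_family n r (zeta \<otimes>\<^bsub>H_tilde n r\<^esub> xi) =
      step_family n r zeta \<otimes>\<^bsub>G_tilde n r\<^esub> step_family n r xi" for zeta xi
  proof -
    have "step_weight (\<lambda>i\<in>{1..n}. zeta i * xi i) a = step_weight zeta a * step_weight xi a"
      if "a \<in> LQ1 n r" for a
      using level_LQ1[OF that] r by (intro step_weight_mult[of a n]) auto
    then show ?thesis unfolding step_family_def H_tilde_simps G_tilde_simps
      by (intro restrict_ext) simp
  qed
qed

text \<open>Exchanging \<open>i\<close> for \<open>1\<close> in an \<open>r\<close>-subset shows that equal entries force \<open>\<zeta>\<^sub>i = \<zeta>\<^sub>1\<close>.\<close>

lemma step_family_scalar_iff:
  assumes r: "0 < r" "r < n" and zeta: "zeta \<in> carrier (H_tilde n r)"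
  shows "step_family n r zeta \<in> scalars n r \<longleftrightarrow> (\<exists>z. \<forall>i\<in>{1..n}. zeta i = z)"
  unfolding scalars_iff[OF step_family_in_G_tilde[OF r zeta] r(2)]
proof
  assume "\<exists>z. \<forall>i\<in>{1..n}. zeta i = z"
  then obtain z where z: "\<forall>i\<in>{1..n}. zeta i = z" by blast
  have "coord_weight n r (step_family n r zeta) I = z ^ r" if I: "I \<in> r_subsets n r" for I
  proof -
    have "(\<Prod>i\<in>I. zeta i) = (\<Prod>i\<in>I. z)"
      using z I by (intro prod.cong refl) (auto simp: r_subsets_def)
    then show ?thesis using I r by (simp add: coord_weight_step_family r_subsets_def)
  qed
  then show "\<exists>c. \<forall>I\<in>r_subsets n r. coord_weight n r (step_family n r zeta) I = c" by blast
next
  assume "\<exists>c. \<forall>I\<in>r_subsets n r. coord_weight n r (step_family n r zeta) I = c"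
  then obtain c where c: "\<And>I. I \<in> r_subsets n r \<Longrightarrow> (\<Prod>i\<in>I. zeta i) = c"
    using coord_weight_step_family r by fastforce
  have nz: "zeta i \<noteq> 0" if "i \<in> {1..n}" for i
    using H_tilde_nonzero[OF zeta that] r by simp
  obtain r' where r': "r = Suc r'" using r by (cases r) auto
  have "zeta i = zeta 1" if i: "i \<in> {1..n}" for i
  proof -
    obtain S where S: "S \<in> r_subsets n r'" "S \<inter> {i, 1} = {}"
      using r_subset_avoiding_two[of i n 1 r'] i r r' by auto
    have fin: "finite S" using S(1) by (rule r_subsets_finite)
    have "insert i S \<in> r_subsets n r" "insert 1 S \<in> r_subsets n r"
      using insert_r_subsets[OF S(1)] S(2) i r r' by auto
    then have "(\<Prod>j\<in>insert i S. zeta j) = (\<Prod>j\<in>insert 1 S. zeta j)" using c by simp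
    then have "zeta i * (\<Prod>j\<in>S. zeta j) = zeta 1 * (\<Prod>j\<in>S. zeta j)" using fin S(2) by simp
    moreover have "(\<Prod>j\<in>S. zeta j) \<noteq> 0"
      using nz S(1) fin by (auto simp: prod_zero_iff r_subsets_def)
    ultimately show ?thesis by simp
  qed
  then show "\<exists>z. \<forall>i\<in>{1..n}. zeta i = z" by blast
qed

text \<open>Dividing by \<open>\<zeta>\<^sub>1\<close> makes every \<open>\<zeta>\<^sub>i\<close> a ratio of two entries of the diagonal matrix. The entries are
  products of \<open>n\<close>-th roots of unity, so the normalized \<open>\<zeta>\<^sub>i\<close> and the remaining common factor \<open>c'\<close> are
  \<open>n\<close>-th roots of unity as well. The relation in \<open>G_tilde\<close>, written as a product over the \<open>n\<close> cyclic
  intervals, becomes \<open>c'\<^sup>n (\<Prod>\<zeta>\<^sub>i)\<^sup>r = 1\<close>, and the first factor is \<open>1\<close>.\<close>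

lemma monomial_normalize:
  assumes r: "0 < r" "r < n" and psi: "psi \<in> carrier (G_tilde n r)"
    and mono: "monomial_on n r (coord_weight n r psi) c zeta"
  obtains c' xi where "xi \<in> carrier (H_tilde n r)"
    "\<And>I. I \<in> r_subsets n r \<Longrightarrow> coord_weight n r psi I = c' * (\<Prod>i\<in>I. xi i)"
proof -
  define xi where "xi = (\<lambda>i\<in>{1..n}. zeta i / zeta 1)"
  define c' where "c' = c * zeta 1 ^ r"
  have nz: "c \<noteq> 0" "\<And>i. i \<in> {1..n} \<Longrightarrow> zeta i \<noteq> 0"
    and cw: "\<And>I. I \<in> r_subsets n r \<Longrightarrow> coord_weight n r psi I = c * (\<Prod>i\<in>I. zeta i)"
    using mono unfolding monomial_on_def by auto
  have one: "1 \<in> {1..n}" using r by simp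
  have cw': "coord_weight n r psi I = c' * (\<Prod>i\<in>I. xi i)" if I: "I \<in> r_subsets n r" for I
  proof -
    have "(\<Prod>i\<in>I. xi i) = (\<Prod>i\<in>I. zeta i / zeta 1)"
      using I by (intro prod.cong refl) (auto simp: xi_def r_subsets_def)
    also have "\<dots> = (\<Prod>i\<in>I. zeta i) / zeta 1 ^ r"
      using I by (simp add: prod_dividef r_subsets_def)
    finally show ?thesis using cw[OF I] nz(2)[OF one] by (simp add: c'_def)
  qed
  have root: "coord_weight n r psi I ^ n = 1" for I
    using psi by (intro coord_weight_power) simp
  obtain r' where r': "r = Suc r'" using r by (cases r) auto
  have xi_root: "xi i ^ n = 1" if i: "i \<in> {1..n}" for i
  proof -
    obtain S where S: "S \<in> r_subsets n r'" "S \<inter> {i, 1} = {}"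
      using r_subset_avoiding_two[of i n 1 r'] i r r' by auto
    have fin: "finite S" using S(1) by (rule r_subsets_finite)
    have sets: "insert i S \<in> r_subsets n r" "insert 1 S \<in> r_subsets n r"
      using insert_r_subsets[OF S(1)] S(2) i r r' by auto
    have "(\<Prod>j\<in>S. zeta j) \<noteq> 0"
      using nz(2) S(1) fin by (auto simp: prod_zero_iff r_subsets_def)
    then have "coord_weight n r psi (insert i S) / coord_weight n r psi (insert 1 S) = zeta i / zeta 1"
      using cw[OF sets(1)] cw[OF sets(2)] nz fin S(2) by simp
    then have "(zeta i / zeta 1) ^ n = 1"
      using root[of "insert i S"] root[of "insert 1 S"] by (metis div_by_1 power_divide)
    then show ?thesis using i by (simp add: xi_def)
  qed
  have c'_root: "c' ^ n = 1"
  proof -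
    obtain I where I: "I \<in> r_subsets n r" using r_subset_avoiding[of "{}" r n] r by auto
    have "(\<Prod>i\<in>I. xi i) ^ n = 1"
      unfolding prod_power_distrib using xi_root I by (intro prod.neutral) (auto simp: r_subsets_def)
    then show ?thesis using cw'[OF I] root[of I] by (simp add: power_mult_distrib)
  qed
  have "1 = (\<Prod>c<n. coord_weight n r psi (cyclic_interval n r c))"
    using psi prod_LQ1_eq_cyclic[OF r, of psi] by simp
  also have "\<dots> = (\<Prod>c<n. c' * (\<Prod>i\<in>cyclic_interval n r c. xi i))"
    using cyclic_interval_r_subset r(2) by (intro prod.cong refl cw') auto
  also have "\<dots> = c' ^ n * (\<Prod>i\<in>{1..n}. xi i) ^ r"
    by (simp add: prod.distrib prod_cyclic_intervals[OF r(2)])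
  finally have "(\<Prod>i\<in>{1..n}. xi i) ^ r = 1" using c'_root by simp
  then have "xi \<in> carrier (H_tilde n r)"
    using xi_root by (simp add: xi_def)
  then show thesis using that cw' by blast
qed

definition ladder_hom :: "nat \<Rightarrow> nat \<Rightarrow> (nat \<Rightarrow> complex) \<Rightarrow> (point list \<Rightarrow> complex) set" where
  "ladder_hom n r zeta = scalars n r #>\<^bsub>G_tilde n r\<^esub> step_family n r zeta"

lemma ladder_hom_hom:
  assumes r: "0 < r" "r < n"
  shows "ladder_hom n r \<in> hom (H_tilde n r) (G_ladder n r)"
proof -
  interpret normal "scalars n r" "G_tilde n r" using normal_scalars[OF r(2)] .
  have "(\<lambda>a. scalars n r #>\<^bsub>G_tilde n r\<^esub> a) \<circ> step_family n r \<in> hom (H_tilde n r) (G_ladder n r)"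
    unfolding G_ladder_def by (rule Group.hom_compose[OF step_family_hom[OF r] r_coset_hom_Mod])
  then show ?thesis by (simp add: ladder_hom_def[abs_def] comp_def)
qed

text \<open>A family whose diagonal matrix is monomial differs from the \<open>step_family\<close> of its normalized \<open>\<zeta>\<close>
  by a family that acts by scalars.\<close>

lemma G_h_eq_image:
  assumes r: "0 < r" "r < n"
  shows "G_h n r = ladder_hom n r ` carrier (H_tilde n r)"
proof (intro equalityI subsetI)
  interpret comm_group "G_tilde n r" using r by (intro comm_group_G_tilde) simp
  fix C assume C: "C \<in> G_h n r"
  then obtain psi where psi: "psi \<in> carrier (G_tilde n r)" "C = scalars n r #>\<^bsub>G_tilde n r\<^esub> psi"
    unfolding G_h_def carrier_G_ladder by blast
  then obtain c zeta where "monomial_on n r (coord_weight n r psi) c zeta"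
    using C coset_in_G_h_iff[OF r psi(1)] by blast
  then obtain c' xi where xi: "xi \<in> carrier (H_tilde n r)" and
    cw: "\<And>I. I \<in> r_subsets n r \<Longrightarrow> coord_weight n r psi I = c' * (\<Prod>i\<in>I. xi i)"
    using monomial_normalize[OF r psi(1)] by blast
  let ?phi = "step_family n r xi"
  have phi: "?phi \<in> carrier (G_tilde n r)" using step_family_in_G_tilde[OF r xi] .
  \<comment> \<open>The quotient of the given family and its monomial model acts by scalars.\<close>
  define nu where "nu = psi \<otimes>\<^bsub>G_tilde n r\<^esub> inv\<^bsub>G_tilde n r\<^esub> ?phi"
  have nu: "nu \<in> carrier (G_tilde n r)" "nu \<otimes>\<^bsub>G_tilde n r\<^esub> ?phi = psi"
    unfolding nu_def using psi(1) phi by (simp_all only: m_closed inv_closed m_assoc l_inv r_one)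
  have "coord_weight n r nu I = c'" if I: "I \<in> r_subsets n r" for I
  proof -
    have "coord_weight n r nu I * coord_weight n r ?phi I = coord_weight n r psi I"
      using nu(2) coord_weight_mult[of n r nu ?phi I] by simp
    also have "\<dots> = c' * coord_weight n r ?phi I"
      using cw[OF I] coord_weight_step_family[OF I, of xi] r by simp
    finally show ?thesis using coord_weight_nonzero[OF phi, of I] r by simp
  qed
  then have "nu \<in> scalars n r" using scalars_iff[OF nu(1) r(2)] by blast
  then have "psi \<in> scalars n r #>\<^bsub>G_tilde n r\<^esub> ?phi" using nu(2) by (force simp: r_coset_def)
  then have "C = ladder_hom n r xi"
    unfolding ladder_hom_def psi(2) using repr_independence[OF _ phi subgroup_scalars[OF r(2)]] by simp
  then show "C \<in> ladder_hom n r ` carrier (H_tilde n r)" using xi by blast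
next
  fix C assume "C \<in> ladder_hom n r ` carrier (H_tilde n r)"
  then obtain zeta where zeta: "zeta \<in> carrier (H_tilde n r)" "C = ladder_hom n r zeta" by blast
  have "zeta i \<noteq> 0" if "i \<in> {1..n}" for i
    using H_tilde_nonzero[OF zeta(1) that] r by simp
  then have "monomial_on n r (coord_weight n r (step_family n r zeta)) 1 zeta"
    using r by (simp add: monomial_on_def coord_weight_step_family)
  then show "C \<in> G_h n r"
    unfolding zeta(2) ladder_hom_def using coset_in_G_h_iff[OF r step_family_in_G_tilde[OF r zeta(1)]] by blast
qed

lemma kernel_ladder_hom:
  assumes r: "0 < r" "r < n"
  shows "kernel (H_tilde n r) ((G_ladder n r)\<lparr>carrier := G_h n r\<rparr>) (ladder_hom n r) =
    {\<zeta> \<in> carrier (H_tilde n r). \<exists>z. \<forall>i\<in>{1..n}. \<zeta> i = z}"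
proof -
  interpret comm_group "G_tilde n r" using r by (intro comm_group_G_tilde) simp
  have "ladder_hom n r zeta = scalars n r \<longleftrightarrow> (\<exists>z. \<forall>i\<in>{1..n}. zeta i = z)"
    if zeta: "zeta \<in> carrier (H_tilde n r)" for zeta
  proof -
    note phi = step_family_in_G_tilde[OF r zeta]
    have "ladder_hom n r zeta = scalars n r \<longleftrightarrow> step_family n r zeta \<in> scalars n r"
      unfolding ladder_hom_def
      using coset_join1[OF _ phi subgroup_scalars[OF r(2)]] coset_join2[OF phi subgroup_scalars[OF r(2)]]
      by blast
    then show ?thesis using step_family_scalar_iff[OF r zeta] by simp
  qed
  then show ?thesis by (auto simp: kernel_def G_ladder_def)
qed

theorem theorem4p9:
  fixes n r :: nat
  assumes "0 < r" and "r < n"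
  shows "subgroup (G_h n r) (G_ladder n r) \<and>
    plucker_homogeneous n r (G_h n r) \<and>
    (\<forall>K. subgroup K (G_ladder n r) \<and> plucker_homogeneous n r K \<longrightarrow> K \<subseteq> G_h n r) \<and>
    (G_ladder n r)\<lparr>carrier := G_h n r\<rparr> \<cong> H_group n r"
proof (intro conjI allI impI)
  have n: "0 < n" using assms by simp
  interpret G: comm_group "G_tilde n r" using n by (rule comm_group_G_tilde)
  interpret H: comm_group "H_tilde n r" using n by (rule comm_group_H_tilde)
  interpret N: normal "scalars n r" "G_tilde n r" using normal_scalars[OF assms(2)] .
  interpret Q: group "G_ladder n r" unfolding G_ladder_def by (rule N.factorgroup_is_group)
  interpret f: group_hom "H_tilde n r" "G_ladder n r" "ladder_hom n r"
    by unfold_locales (rule ladder_hom_hom[OF assms])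
  show sub: "subgroup (G_h n r) (G_ladder n r)"
    unfolding G_h_eq_image[OF assms] by (rule f.img_is_subgroup)
  have elem: "psi \<in> carrier (G_tilde n r) \<and> C = scalars n r #>\<^bsub>G_tilde n r\<^esub> psi"
    if carr: "C \<in> carrier (G_ladder n r)" and psi: "psi \<in> C" for C psi
  proof -
    obtain phi where phi: "phi \<in> carrier (G_tilde n r)" "C = scalars n r #>\<^bsub>G_tilde n r\<^esub> phi"
      using carr unfolding carrier_G_ladder by blast
    have mem: "psi \<in> scalars n r #>\<^bsub>G_tilde n r\<^esub> phi" using psi unfolding phi(2) .
    have "scalars n r \<subseteq> carrier (G_tilde n r)" by (rule Int_lower2)
    from G.r_coset_subset_G[OF this phi(1)] mem have "psi \<in> carrier (G_tilde n r)" by (rule subsetD)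
    moreover have "C = scalars n r #>\<^bsub>G_tilde n r\<^esub> psi"
      unfolding phi(2) using mem phi(1) subgroup_scalars[OF assms(2)] by (rule G.repr_independence)
    ultimately show ?thesis by (rule conjI)
  qed
  show "plucker_homogeneous n r (G_h n r)"
    unfolding plucker_homogeneous_def
  proof (intro ballI allI impI)
    fix C psi I J
    assume C: "C \<in> G_h n r" "psi \<in> C"
      and IJ: "I \<subseteq> {1..n} \<and> card I = r - 1 \<and> J \<subseteq> {1..n} \<and> card J = r + 1"
    have "C \<in> carrier (G_ladder n r)" using C(1) unfolding G_h_def by blast
    then obtain c zeta where "monomial_on n r (coord_weight n r psi) c zeta"
      using elem[OF _ C(2)] C(1) coset_in_G_h_iff[OF assms] by blast
    then have "plucker_relation n r I J (G_tilde_act n r psi p) =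
        (c * c * (\<Prod>i\<in>I. zeta i) * (\<Prod>i\<in>J. zeta i)) * plucker_relation n r I J p" for p
      using plucker_relation_monomial[of n r "coord_weight n r psi" c zeta I J p] IJ assms
      by (simp add: G_tilde_act_eq_diag_act)
    then show "\<exists>c. \<forall>p \<in> partitions_in_box n r \<rightarrow>\<^sub>E UNIV.
        plucker_relation n r I J (G_tilde_act n r psi p) = c * plucker_relation n r I J p" by blast
  qed
  show "K \<subseteq> G_h n r" if K: "subgroup K (G_ladder n r) \<and> plucker_homogeneous n r K" for K
  proof
    fix C assume C: "C \<in> K"
    then have carr: "C \<in> carrier (G_ladder n r)" using K subgroup.subset by blast
    then obtain psi where psi: "psi \<in> carrier (G_tilde n r)" "C = scalars n r #>\<^bsub>G_tilde n r\<^esub> psi"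
      unfolding carrier_G_ladder by blast
    have mem: "psi \<in> C"
      unfolding psi(2) using subgroup_scalars[OF assms(2)] psi(1) by (rule G.rcos_self[rotated])
    have "exchange_property n r (coord_weight n r psi)"
    proof (rule exchange_if_homogeneous)
      fix I J :: "nat set"
      assume "I \<subseteq> {1..n}" "card I = r - 1" "J \<subseteq> {1..n}" "card J = r + 1"
      then have "\<exists>c. \<forall>p \<in> partitions_in_box n r \<rightarrow>\<^sub>E UNIV.
          plucker_relation n r I J (G_tilde_act n r psi p) = c * plucker_relation n r I J p"
        using K C mem unfolding plucker_homogeneous_def by blast
      then show "\<exists>c. \<forall>p \<in> partitions_in_box n r \<rightarrow>\<^sub>E UNIV.
          plucker_relation n r I J (diag_act n r (coord_weight n r psi) p) =
          c * plucker_relation n r I J p"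
        using assms(2) by (simp add: G_tilde_act_eq_diag_act)
    qed (use assms in auto)
    then have "\<exists>c zeta. monomial_on n r (coord_weight n r psi) c zeta"
      using exchange_imp_monomial[OF assms] coord_weight_nonzero[OF psi(1) n] by blast
    then show "C \<in> G_h n r" unfolding psi(2) using coset_in_G_h_iff[OF assms psi(1)] by blast
  qed
  let ?Gh = "(G_ladder n r)\<lparr>carrier := G_h n r\<rparr>"
  interpret S: group ?Gh using Q.subgroup_imp_group[OF sub] .
  interpret h: group_hom "H_tilde n r" ?Gh "ladder_hom n r"
    using ladder_hom_hom[OF assms] G_h_eq_image[OF assms]
    by unfold_locales (auto simp: hom_def)
  have iso: "H_group n r \<cong> ?Gh"
    using h.FactGroup_iso G_h_eq_image[OF assms]
    unfolding H_group_def kernel_ladder_hom[OF assms] by simp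
  moreover have "group (H_group n r)"
    using h.normal_kernel unfolding H_group_def kernel_ladder_hom[OF assms]
    by (rule normal.factorgroup_is_group)
  ultimately show "?Gh \<cong> H_group n r" by (simp add: group.iso_sym)
qed

end
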